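(* Two regular control systems $F$ and $G$ (that is, $\dot x=F(x,u,\dot u)$ and $\dot x=G(x,u,\dot u)$) are locally feedback equivalent if and only if $$\Sigma_F=\Sigma_G .$$
   Context: Consider control systems $\dot x=F(x,u,\dot u)$ with scalar state $x$ and scalar control $u$; write $u_1$ for $\dot u$, so a system is given by a smooth function $F(x,u,u_1)$ on a domain in $\mathbb{R}^3$. A feedback transformation is a (local) diffeomorphism $(x,u,t)\mapsto(X(x),U(x,u),t)$. It acts on systems: it relates $F$ and $G$ if $$F\big(X,U,U_xG(x,u,u_1)+U_uu_1\big)=X_x\,G(x,u,u_1).$$ For systems $F$ on a domain $D_F$ and $G$ on a domain $D_G$, local feedback equivalence means that each point of either domain is matched with a point of the other by a local feedback transformation (a local smooth solution $X(x),U(x,u)$, with $X_xU_u\neq0$, of the equation $F\big(X,U,U_xG(x,u,u_1)+U_uu_1\big)=X_x\,G(x,u,u_1)$), the corresponding local map being $(x,u,u_1)\mapsto (X,U,U_xG+U_uu_1)$ from $D_G$ to $D_F$. Let $\kappa:\mathbb{R}^4\to\mathbb{R}^3$, $\kappa(x,u,u_1,f)=(x,u,u_1)$, with jet spaces $J^k\kappa$, symbols $f_\sigma$ for partial derivatives of $f$ with respect to $x,u,u_1$, and total derivatives $\frac{d}{dx},\frac{d}{du},\frac{d}{du_1}$. A point of $J^k\kappa$, $k\ge2$, is regular if $f\neq0$, $f_{u_1}\neq0$, $f_{u_1u_1}\neq0$ there (considered where $u_1f_{u_1}-f\neq 0$, so that $J$ below is defined); regular orbits are the orbits of regular points under the prolonged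 action of feedback transformations, i.e. the integral manifolds of the distribution generated by the prolongations of the fields $a\,\partial_x+b\,\partial_u+(u_1b_u+fb_x)\,\partial_{u_1}+a_xf\,\partial_f$, with $a=a(x)$, $b=b(x,u)$ arbitrary. Put $$J=\frac{f^{2}\,f_{u_{1}u_{1}}}{\left(u_{1}f_{u_{1}}-f\right)f_{u_{1}}^{2}},$$ $$\nabla_1=\frac{u_1f_{u_1}-f}{f_{u_1}}\frac{d}{du}+\frac{f-u_1f_{u_1}}{f_{u_1}^2}f_u\frac{d}{du_1},\qquad \nabla_2=\frac{f}{f_{u_1}}\frac{d}{du_1},$$ $$\nabla_3=f\frac{d}{dx}+\frac{f}{f_{u_1}}\frac{d}{du}+\left(\frac{f_xf_{u_1}+f_u-u_1f_{uu_1}-f f_{xu_1}}{f_{u_1u_1}}+\frac{u_1f_{u_1}-f}{f_{u_1}^2}f_u\right)\frac{d}{du_1},$$ and let $K$ be the function on $J^3\kappa$ defined by $[\nabla_3,\nabla_1]=K\,\nabla_2$. ($J$, $K$ are differential invariants of feedback transformations and $\nabla_i$ are invariant derivations.) For a differential invariant $I$, let $I^F$ denote its value on the system $F$, i.e. the function of $(x,u,u_1)$ obtained by substituting $f=F(x,u,u_1)$. Let $\mathbb{R}^{14}$ have coordinates $(j,j_1,j_2,j_3,j_{11},j_{12},j_{13},j_{22},j_{23},j_{33},k,k_1,k_2,k_3)$. A system $F$ on a domain $D\subset\mathbb{R}^3$ defines a map $\sigma_F:D\to\mathbb{R}^{14}$ by $$j=J^F,\quad k=K^F,\quad j_i=(\nabla_i(J))^F,\quad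 k_i=(\nabla_i(K))^F,\quad j_{ij}=(\nabla_i\nabla_j(J))^F,\qquad 1\le i\le j\le 3,$$ and $\Sigma_F=\sigma_F(D)\subset\mathbb{R}^{14}$ denotes its image. A system $F$ is regular in a domain $D\subset\mathbb{R}^3$ if: (1) the $4$-jets of $F$ at points of $D$ belong to regular orbits; (2) $\sigma_F(D)$ is a smooth $3$-dimensional submanifold of $\mathbb{R}^{14}$; and (3) three of the five functions $j,j_1,j_2,j_3,k$ are coordinates on $\Sigma_F$. *)

theory Defs
  imports "HOL-Analysis.Analysis"
begin

section \<open>Smooth maps and submanifolds\<close>

definition partial :: "'a \<Rightarrow> ('a::real_normed_vector \<Rightarrow> 'b::real_normed_vector) \<Rightarrow> 'a \<Rightarrow> 'b" where
  "partial v f = (\<lambda>p. frechet_derivative f (at p) v)"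

text \<open>\<open>C\<^sup>\<infinity>\<close> on an open set: all iterated directional derivatives exist and are differentiable
  (hence continuous). Openness of the set is part of the definition.\<close>

definition smooth_on :: "'a set \<Rightarrow> ('a::real_normed_vector \<Rightarrow> 'b::real_normed_vector) \<Rightarrow> bool" where
  "smooth_on S f \<longleftrightarrow> open S \<and> (\<forall>vs. foldr partial vs f differentiable_on S)"

text \<open>Embedded submanifolds, through flattening diffeomorphisms \<open>\<Phi>\<close> with inverse \<open>\<Psi>\<close>.\<close>

definition smooth_submanifold :: "nat \<Rightarrow> 'a::euclidean_space set \<Rightarrow> bool" where
  "smooth_submanifold d S \<longleftrightarrow>
     (\<forall>p\<in>S. \<exists>V W \<Phi> \<Psi> L. p \<in> V \<and> smooth_on V \<Phi> \<and> smooth_on W \<Psi> \<and> homeomorphism V W \<Phi> \<Psi> \<and>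
        subspace (L :: 'a set) \<and> dim L = d \<and> \<Phi> ` (V \<inter> S) = W \<inter> L)"

text \<open>The ambient coordinates \<open>a, b, c\<close> restrict to a coordinate system of \<open>S\<close>, i.e. to a
  diffeomorphism from \<open>S\<close> onto an open subset of three-space. The restriction itself is
  smooth as it is the restriction of a linear map, so only the inverse is mentioned.\<close>

definition coordinates_on :: "(real ^ 'n) set \<Rightarrow> 'n \<Rightarrow> 'n \<Rightarrow> 'n \<Rightarrow> bool" where
  "coordinates_on S a b c \<longleftrightarrow>
     (let \<pi> = (\<lambda>y. (y $ a, y $ b, y $ c))
      in inj_on \<pi> S \<and> open (\<pi> ` S) \<and> smooth_on (\<pi> ` S) (inv_into S \<pi>))"


section \<open>Control systems and feedback transformations\<close>

text \<open>Points are triples \<open>(x, u, u\<^sub>1)\<close>; a system is a smooth function on a domain.\<close>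

type_synonym point = "real \<times> real \<times> real"

definition control_system :: "(point \<Rightarrow> real) \<Rightarrow> point set \<Rightarrow> bool" where
  "control_system F D \<longleftrightarrow> D \<noteq> {} \<and> connected D \<and> smooth_on D F"

definition feedback_transformation ::
    "(real \<times> real) set \<Rightarrow> (real \<Rightarrow> real) \<Rightarrow> (real \<times> real \<Rightarrow> real) \<Rightarrow> bool" where
  "feedback_transformation B X U \<longleftrightarrow>
     smooth_on (fst ` B) X \<and> smooth_on B U \<and>
     (\<forall>(x, u) \<in> B. deriv X x * partial (0, 1) U (x, u) \<noteq> 0)"

definition feedback_lift ::
    "(real \<Rightarrow> real) \<Rightarrow> (real \<times> real \<Rightarrow> real) \<Rightarrow> (point \<Rightarrow> real) \<Rightarrow> point \<Rightarrow> point" where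
  "feedback_lift X U G = (\<lambda>(x, u, u1).
     (X x, U (x, u), partial (1, 0) U (x, u) * G (x, u, u1) + partial (0, 1) U (x, u) * u1))"

text \<open>Near \<open>p\<close>, some local feedback transformation relates the system \<open>F\<close> on \<open>DF\<close> and the system
  \<open>G\<close> on \<open>DG\<close>, and the corresponding local map from \<open>DG\<close> to \<open>DF\<close> takes \<open>p\<close> to \<open>q\<close>.\<close>

definition feedback_matched ::
    "(point \<Rightarrow> real) \<Rightarrow> point set \<Rightarrow> (point \<Rightarrow> real) \<Rightarrow> point set \<Rightarrow> point \<Rightarrow> point \<Rightarrow> bool" where
  "feedback_matched F DF G DG p q \<longleftrightarrow>
     (\<exists>B X U N. feedback_transformation B X U \<and>
        open N \<and> p \<in> N \<and> N \<subseteq> DG \<and> (\<forall>(x, u, u1) \<in> N. (x, u) \<in> B) \<and>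
        feedback_lift X U G ` N \<subseteq> DF \<and> feedback_lift X U G p = q \<and>
        (\<forall>(x, u, u1) \<in> N. F (feedback_lift X U G (x, u, u1)) = deriv X x * G (x, u, u1)))"

definition locally_feedback_equivalent ::
    "(point \<Rightarrow> real) \<Rightarrow> point set \<Rightarrow> (point \<Rightarrow> real) \<Rightarrow> point set \<Rightarrow> bool" where
  "locally_feedback_equivalent F DF G DG \<longleftrightarrow>
     (\<forall>p\<in>DG. \<exists>q\<in>DF. feedback_matched F DF G DG p q) \<and>
     (\<forall>q\<in>DF. \<exists>p\<in>DG. feedback_matched F DF G DG p q)"


section \<open>Jets\<close>

text \<open>A jet \<open>((x, u, u\<^sub>1), s)\<close> carries a base point and the values \<open>s \<sigma>\<close> of the coordinates
  \<open>f\<^sub>\<sigma>\<close>, where \<open>\<sigma> = (a, b, c)\<close> counts the differentiations in \<open>x\<close>, \<open>u\<close>, \<open>u\<^sub>1\<close>. General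
  elements are infinite jets, and functions on jet spaces of finite order are regarded as
  functions of infinite jets. A \<open>k\<close>-jet is one whose coordinates of order above \<open>k\<close> are \<open>0\<close>.\<close>

type_synonym multi_index = "nat \<times> nat \<times> nat"
type_synonym jet = "point \<times> (multi_index \<Rightarrow> real)"

definition jet_x :: "jet \<Rightarrow> real" where "jet_x = (\<lambda>((x, u, u1), s). x)"
definition jet_u :: "jet \<Rightarrow> real" where "jet_u = (\<lambda>((x, u, u1), s). u)"
definition jet_u1 :: "jet \<Rightarrow> real" where "jet_u1 = (\<lambda>((x, u, u1), s). u1)"
definition jet_f :: "nat \<Rightarrow> nat \<Rightarrow> nat \<Rightarrow> jet \<Rightarrow> real" where "jet_f a b c = (\<lambda>(p, s). s (a, b, c))"

definition jet_coordinates :: "(jet \<Rightarrow> real) set" where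
  "jet_coordinates = {jet_x, jet_u, jet_u1} \<union> {jet_f a b c | a b c. True}"

definition mixed_partial :: "multi_index \<Rightarrow> (point \<Rightarrow> real) \<Rightarrow> point \<Rightarrow> real" where
  "mixed_partial = (\<lambda>(a, b, c) F.
     (partial (1, 0, 0) ^^ a) ((partial (0, 1, 0) ^^ b) ((partial (0, 0, 1) ^^ c) F)))"

definition infinite_jet :: "(point \<Rightarrow> real) \<Rightarrow> point \<Rightarrow> jet" where
  "infinite_jet F p = (p, \<lambda>\<sigma>. mixed_partial \<sigma> F p)"

definition truncate_jet :: "nat \<Rightarrow> jet \<Rightarrow> jet" where
  "truncate_jet k = (\<lambda>(p, s). (p, \<lambda>(a, b, c). if a + b + c \<le> k then s (a, b, c) else 0))"

definition jet_space :: "nat \<Rightarrow> jet set" where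
  "jet_space k = {\<theta>. truncate_jet k \<theta> = \<theta>}"

definition jet_of :: "nat \<Rightarrow> (point \<Rightarrow> real) \<Rightarrow> point \<Rightarrow> jet" where
  "jet_of k F p = truncate_jet k (infinite_jet F p)"

text \<open>The prolonged action takes the \<open>k\<close>-jet of a system at a point to the \<open>k\<close>-jet of the
  transformed system at the image point.\<close>

definition feedback_orbit :: "nat \<Rightarrow> jet \<Rightarrow> jet set" where
  "feedback_orbit k \<theta> = {\<theta>'. \<exists>F DF G DG p q. smooth_on DF F \<and> smooth_on DG G \<and>
     feedback_matched F DF G DG p q \<and> \<theta> = jet_of k G p \<and> \<theta>' = jet_of k F q}"

definition regular_jet :: "jet \<Rightarrow> bool" where
  "regular_jet \<theta> \<longleftrightarrow> jet_f 0 0 0 \<theta> \<noteq> 0 \<and> jet_f 0 0 1 \<theta> \<noteq> 0 \<and> jet_f 0 0 2 \<theta> \<noteq> 0 \<and>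
     jet_u1 \<theta> * jet_f 0 0 1 \<theta> - jet_f 0 0 0 \<theta> \<noteq> 0"

definition regular_orbits :: "nat \<Rightarrow> jet set set" where
  "regular_orbits k = {feedback_orbit k \<theta> | \<theta>. \<theta> \<in> jet_space k \<and> regular_jet \<theta>}"


section \<open>Differential invariants\<close>

text \<open>The total derivative in direction \<open>e\<close>, one of the three unit multi-indices, is the vector
  field \<open>\<partial>\<^sub>e + (\<Sum>\<sigma>. f\<^bsub>\<sigma>+e\<^esub> \<partial>/\<partial>f\<^sub>\<sigma>)\<close> on infinite jets, written as a derivative along a line.\<close>

definition total_derivative :: "multi_index \<Rightarrow> (jet \<Rightarrow> real) \<Rightarrow> jet \<Rightarrow> real" where
  "total_derivative e \<phi> = (\<lambda>(p, s).
     deriv (\<lambda>t. \<phi> (p + t *\<^sub>R (case e of (a, b, c) \<Rightarrow> (real a, real b, real c)),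
                   \<lambda>\<sigma>. s \<sigma> + t * s (\<sigma> + e))) 0)"

abbreviation "d_x \<equiv> total_derivative (1, 0, 0)"
abbreviation "d_u \<equiv> total_derivative (0, 1, 0)"
abbreviation "d_u1 \<equiv> total_derivative (0, 0, 1)"

definition inv_J :: "jet \<Rightarrow> real" where
  "inv_J \<theta> = (let u1 = jet_u1 \<theta>; f = jet_f 0 0 0 \<theta>; fw = jet_f 0 0 1 \<theta>; fww = jet_f 0 0 2 \<theta>
     in f\<^sup>2 * fww / ((u1 * fw - f) * fw\<^sup>2))"

definition nabla1 :: "(jet \<Rightarrow> real) \<Rightarrow> jet \<Rightarrow> real" where
  "nabla1 \<phi> \<theta> =
     (let u1 = jet_u1 \<theta>; f = jet_f 0 0 0 \<theta>; fu = jet_f 0 1 0 \<theta>; fw = jet_f 0 0 1 \<theta>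
      in (u1 * fw - f) / fw * d_u \<phi> \<theta> + (f - u1 * fw) / fw\<^sup>2 * fu * d_u1 \<phi> \<theta>)"

definition nabla2 :: "(jet \<Rightarrow> real) \<Rightarrow> jet \<Rightarrow> real" where
  "nabla2 \<phi> \<theta> = (let f = jet_f 0 0 0 \<theta>; fw = jet_f 0 0 1 \<theta> in f / fw * d_u1 \<phi> \<theta>)"

definition nabla3 :: "(jet \<Rightarrow> real) \<Rightarrow> jet \<Rightarrow> real" where
  "nabla3 \<phi> \<theta> =
     (let u1 = jet_u1 \<theta>; f = jet_f 0 0 0 \<theta>;
          fx = jet_f 1 0 0 \<theta>; fu = jet_f 0 1 0 \<theta>; fw = jet_f 0 0 1 \<theta>;
          fxw = jet_f 1 0 1 \<theta>; fuw = jet_f 0 1 1 \<theta>; fww = jet_f 0 0 2 \<theta>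
      in f * d_x \<phi> \<theta> + f / fw * d_u \<phi> \<theta> +
         ((fx * fw + fu - u1 * fuw - f * fxw) / fww + (u1 * fw - f) / fw\<^sup>2 * fu) * d_u1 \<phi> \<theta>)"

text \<open>\<open>[\<nabla>\<^sub>3, \<nabla>\<^sub>1] = K \<nabla>\<^sub>2\<close>. Derivations of the algebra of jet functions agree
  iff they agree on the coordinate functions.\<close>

definition inv_K :: "jet \<Rightarrow> real" where
  "inv_K \<theta> = (THE \<kappa>. \<forall>\<phi>\<in>jet_coordinates.
     nabla3 (nabla1 \<phi>) \<theta> - nabla1 (nabla3 \<phi>) \<theta> = \<kappa> * nabla2 \<phi> \<theta>)"

definition on_system :: "(jet \<Rightarrow> real) \<Rightarrow> (point \<Rightarrow> real) \<Rightarrow> point \<Rightarrow> real" where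
  "on_system I F p = I (infinite_jet F p)"

text \<open>The components are, in order,
  \<open>j, j\<^sub>1, j\<^sub>2, j\<^sub>3, j\<^sub>1\<^sub>1, j\<^sub>1\<^sub>2, j\<^sub>1\<^sub>3, j\<^sub>2\<^sub>2, j\<^sub>2\<^sub>3, j\<^sub>3\<^sub>3, k, k\<^sub>1, k\<^sub>2, k\<^sub>3\<close>, with indices \<open>1\<close> to \<open>14\<close>.\<close>

definition sigma :: "(point \<Rightarrow> real) \<Rightarrow> point \<Rightarrow> real ^ 14" where
  "sigma F p = vector (map (\<lambda>I. on_system I F p)
     [inv_J,
      nabla1 inv_J, nabla2 inv_J, nabla3 inv_J,
      nabla1 (nabla1 inv_J), nabla1 (nabla2 inv_J), nabla1 (nabla3 inv_J),
      nabla2 (nabla2 inv_J), nabla2 (nabla3 inv_J), nabla3 (nabla3 inv_J),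
      inv_K,
      nabla1 inv_K, nabla2 inv_K, nabla3 inv_K])"

definition Sigma_of :: "(point \<Rightarrow> real) \<Rightarrow> point set \<Rightarrow> (real ^ 14) set" where
  "Sigma_of F D = sigma F ` D"

text \<open>The indices \<open>1, 2, 3, 4, 11\<close> are those of \<open>j, j\<^sub>1, j\<^sub>2, j\<^sub>3, k\<close>.\<close>

definition regular_system :: "(point \<Rightarrow> real) \<Rightarrow> point set \<Rightarrow> bool" where
  "regular_system F D \<longleftrightarrow> control_system F D \<and>
     (\<forall>p\<in>D. \<exists>O4\<in>regular_orbits 4. jet_of 4 F p \<in> O4) \<and>
     smooth_submanifold 3 (Sigma_of F D) \<and>
     (\<exists>a\<in>{1, 2, 3, 4, 11}. \<exists>b\<in>{1, 2, 3, 4, 11}. \<exists>c\<in>{1, 2, 3, 4, 11}.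
        a \<noteq> b \<and> a \<noteq> c \<and> b \<noteq> c \<and> coordinates_on (Sigma_of F D) a b c)"

end

theory Submission
  imports Defs
begin

text \<open>The operators \<open>\<nabla>\<^sub>1, \<nabla>\<^sub>2, \<nabla>\<^sub>3\<close> define on every regular system a frame of vector fields, and a local
  map between two systems is a feedback transformation iff it carries one frame to the other. The
  brackets of the frame are \<open>[\<nabla>\<^sub>1, \<nabla>\<^sub>2] = -J \<nabla>\<^sub>1\<close>, \<open>[\<nabla>\<^sub>3, \<nabla>\<^sub>1] = K \<nabla>\<^sub>2\<close> and
  \<open>[\<nabla>\<^sub>2, \<nabla>\<^sub>3] = \<nabla>\<^sub>3 - J \<nabla>\<^sub>1 + b \<nabla>\<^sub>2\<close>, where \<open>b = -(\<nabla>\<^sub>1 J + \<nabla>\<^sub>3 J) / J\<close> by the Jacobi identity. Hence,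
  if three of the invariants \<open>j, j\<^sub>1, j\<^sub>2, j\<^sub>3, k\<close> are coordinates on \<open>\<Sigma>\<close>, they map the frame to vector
  fields \<open>M\<^sub>1, M\<^sub>2, M\<^sub>3\<close> on an open subset of three-space that depend on \<open>\<Sigma>\<close> only. The determinant of
  the \<open>M\<^sub>i\<close>, pulled back to the connected domain, satisfies a linear differential equation, so it
  vanishes everywhere or nowhere, and Sard's theorem excludes the former. So two systems with the
  same \<open>\<Sigma>\<close> have local diffeomorphisms to the same three-space that take both frames to the same
  fields, and composing one with the inverse of the other gives the feedback transformation.\<close>

text \<open>Regularity constrains only the image \<open>Sigma_of F D\<close>, not the map
  \<open>sigma F\<close>: a smooth map can have open image and still have critical points, as t^3
  shows. So independence of the three chosen invariants at every point is not given, and without it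
  the chart has no differentiable local inverse; this is what the determinant argument supplies. The
  chart is then only a local diffeomorphism, so several points may share a value of
  \<open>sigma\<close>; every pair of points with equal values gets matched. The Jacobi identity is
  what closes the system: of the second derivatives of J only those with i <= j are coordinates,
  reversing an order costs a bracket, and b is the one bracket coefficient that is not itself a
  constant or one of the fourteen functions. The invariants divide by f, f_{u1}, f_{u1u1} and u1
  f_{u1} - f, so identities between them are available only at regular jets. Differentiating such
  identities is legitimate because regularity persists for small parameters along the lines that
  define total derivatives.\<close>

section \<open>Calculus of smooth maps\<close>

text \<open>\<open>smooth_on\<close> quantifies over all lists of directions at once; a finite order
  gives the closure proofs something to induct on. The count starts low: order 0 already means
  differentiable.\<close>

primrec differentiable_upto :: "nat \<Rightarrow> 'a set \<Rightarrow> ('a::real_normed_vector \<Rightarrow> 'b::real_normed_vector) \<Rightarrow> bool" where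
  "differentiable_upto 0 S f \<longleftrightarrow> f differentiable_on S"
| "differentiable_upto (Suc n) S f \<longleftrightarrow> f differentiable_on S \<and> (\<forall>v. differentiable_upto n S (partial v f))"

lemma differentiable_upto_iff_foldr:
  "differentiable_upto n S f \<longleftrightarrow> (\<forall>vs. length vs \<le> n \<longrightarrow> foldr partial vs f differentiable_on S)"
proof (induction n arbitrary: f)
  case 0
  then show ?case by simp
next
  case (Suc n)
  show ?case
  proof (intro iffI allI impI)
    fix vs :: "'a list"
    assume *: "differentiable_upto (Suc n) S f" "length vs \<le> Suc n"
    \<comment> \<open>\<open>foldr\<close> applies the last direction of the list first, and the
      recursion strips the derivative taken first, so the list is split at its end.\<close>
    show "foldr partial vs f differentiable_on S"
      using * Suc by (cases vs rule: rev_cases) auto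
  next
    assume *: "\<forall>vs. length vs \<le> Suc n \<longrightarrow> foldr partial vs f differentiable_on S"
    have "f differentiable_on S"
      using *[rule_format, of "[]"] by simp
    moreover have "differentiable_upto n S (partial v f)" for v
      unfolding Suc using *[rule_format, of "_ @ [v]"] by simp
    ultimately show "differentiable_upto (Suc n) S f" by simp
  qed
qed

lemma smooth_on_iff: "smooth_on S f \<longleftrightarrow> open S \<and> (\<forall>n. differentiable_upto n S f)"
  unfolding smooth_on_def differentiable_upto_iff_foldr by auto

lemma smooth_on_open: "smooth_on S f \<Longrightarrow> open S"
  by (simp add: smooth_on_def)

lemma smooth_on_partial: "smooth_on S f \<Longrightarrow> smooth_on S (partial v f)"
  unfolding smooth_on_iff by (metis differentiable_upto.simps(2))

lemma smooth_on_differentiable: "smooth_on S f \<Longrightarrow> p \<in> S \<Longrightarrow> f differentiable at p"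
  unfolding smooth_on_iff
  by (metis differentiable_upto.simps(1) differentiable_on_eq_differentiable_at)

lemma has_derivative_partial: "f differentiable at p \<Longrightarrow> (f has_derivative (\<lambda>v. partial v f p)) (at p)"
  unfolding partial_def using frechet_derivative_works[of f "at p"] by simp

lemma smooth_on_has_derivative:
  "smooth_on S f \<Longrightarrow> p \<in> S \<Longrightarrow> (f has_derivative (\<lambda>v. partial v f p)) (at p)"
  by (simp add: has_derivative_partial smooth_on_differentiable)

lemma partial_eqI: "(f has_derivative f') (at p) \<Longrightarrow> partial v f p = f' v"
  by (metis frechet_derivative_at partial_def)

lemma partial_cong:
  assumes "open S" "p \<in> S" "\<And>q. q \<in> S \<Longrightarrow> f q = g q"
  shows "partial v f p = partial v g p"
proof -
  have "(f has_derivative f') (at p) \<longleftrightarrow> (g has_derivative f') (at p)" for f'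
    using assms has_derivative_transform_within_open[of f f' p UNIV S g]
      has_derivative_transform_within_open[of g f' p UNIV S f] by auto
  then show ?thesis
    unfolding partial_def frechet_derivative_def by simp
qed

lemma smooth_on_continuous_on: "smooth_on S f \<Longrightarrow> continuous_on S f"
  by (meson continuous_at_imp_continuous_on differentiable_imp_continuous_within smooth_on_differentiable)

lemma differentiable_upto_imp_differentiable_on: "differentiable_upto n S f \<Longrightarrow> f differentiable_on S"
  by (cases n) auto

lemma differentiable_upto_imp_has_derivative:
  "open S \<Longrightarrow> differentiable_upto n S f \<Longrightarrow> p \<in> S \<Longrightarrow> (f has_derivative (\<lambda>v. partial v f p)) (at p)"
  by (metis differentiable_upto_imp_differentiable_on differentiable_on_eq_differentiable_at
      has_derivative_partial)

lemma differentiable_upto_Suc_imp: "differentiable_upto (Suc n) S f \<Longrightarrow> differentiable_upto n S f"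
proof (induction n arbitrary: f)
  case (Suc n)
  then show ?case by (metis differentiable_upto.simps(2))
qed simp

lemma differentiable_on_open_cong:
  assumes "open S" "\<And>q. q \<in> S \<Longrightarrow> f q = g q" "f differentiable_on S"
  shows "g differentiable_on S"
  unfolding differentiable_on_eq_differentiable_at[OF assms(1)]
proof
  fix p assume p: "p \<in> S"
  then obtain f' where "(f has_derivative f') (at p)"
    using assms(1,3) by (auto simp: differentiable_on_eq_differentiable_at differentiable_def)
  then show "g differentiable at p"
    using has_derivative_transform_within_open[of f f' p UNIV S g] assms(1,2) p
    by (auto intro: differentiableI)
qed

lemma differentiable_upto_cong:
  assumes "open S" "\<And>q. q \<in> S \<Longrightarrow> f q = g q" "differentiable_upto n S f"
  shows "differentiable_upto n S g"
  using assms(2,3)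
proof (induction n arbitrary: f g)
  case 0
  then show ?case using differentiable_on_open_cong[OF assms(1), of f g] by simp
next
  case (Suc n)
  have "partial v f q = partial v g q" if "q \<in> S" for v q
    using partial_cong[OF assms(1) that] Suc.prems by blast
  then show ?case
    using Suc.IH[of "partial _ f" "partial _ g"] Suc.prems differentiable_on_open_cong[OF assms(1), of f g]
    by (simp del: split_paired_All)
qed

text \<open>Any formula for the derivative that is valid on \<open>S\<close> may replace
  \<open>partial v f\<close>, since openness makes values outside \<open>S\<close> immaterial. Most
  closure rules below reduce to this one.\<close>

lemma differentiable_upto_SucI:
  assumes "open S"
    and "\<And>p. p \<in> S \<Longrightarrow> (f has_derivative f' p) (at p)"
    and "\<And>v. differentiable_upto n S (\<lambda>p. f' p v)"
  shows "differentiable_upto (Suc n) S f"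
proof -
  have "partial v f p = f' p v" if "p \<in> S" for p v
    using assms(2) that partial_eqI by blast
  then have "differentiable_upto n S (partial v f)" for v
    using differentiable_upto_cong[OF assms(1) _ assms(3)[of v], of "partial v f"] by simp
  moreover have "f differentiable_on S"
    using assms(1,2) by (meson differentiableI differentiable_on_eq_differentiable_at)
  ultimately show ?thesis by simp
qed

lemma differentiable_upto_const: "open S \<Longrightarrow> differentiable_upto n S (\<lambda>p. c)"
proof (induction n arbitrary: c)
  case (Suc n)
  show ?case by (rule differentiable_upto_SucI) (auto intro!: derivative_eq_intros Suc)
qed simp

lemma differentiable_upto_bounded_linear:
  assumes "open S" "bounded_linear L" "differentiable_upto n S f"
  shows "differentiable_upto n S (\<lambda>p. L (f p))"
  using assms(3)
proof (induction n arbitrary: f)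
  case 0
  then show ?case using assms(2)
    by (simp add: bounded_linear_imp_differentiable differentiable_on_def)
       (metis assms(2) bounded_linear.has_derivative differentiable_def)
next
  case (Suc n)
  show ?case
  proof (rule differentiable_upto_SucI[OF assms(1)])
    fix p assume "p \<in> S"
    then show "((\<lambda>p. L (f p)) has_derivative (\<lambda>v. L (partial v f p))) (at p)"
      using bounded_linear.has_derivative[OF assms(2)]
        differentiable_upto_imp_has_derivative[OF assms(1) Suc.prems] by blast
  next
    show "differentiable_upto n S (\<lambda>p. L (partial v f p))" for v
      using Suc by auto
  qed
qed

lemma differentiable_upto_add:
  assumes "open S" "differentiable_upto n S f" "differentiable_upto n S g"
  shows "differentiable_upto n S (\<lambda>p. f p + g p)"
  using assms(2,3)
proof (induction n arbitrary: f g)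
  case 0
  then show ?case by simp
next
  case (Suc n)
  show ?case
  proof (rule differentiable_upto_SucI[OF assms(1)])
    fix p assume "p \<in> S"
    then show "((\<lambda>p. f p + g p) has_derivative (\<lambda>v. partial v f p + partial v g p)) (at p)"
      using Suc.prems by (intro has_derivative_add differentiable_upto_imp_has_derivative[OF assms(1)])
  next
    show "differentiable_upto n S (\<lambda>p. partial v f p + partial v g p)" for v
      using Suc by auto
  qed
qed

lemma differentiable_upto_sum:
  assumes "open S" "\<And>i. i \<in> I \<Longrightarrow> differentiable_upto n S (f i)"
  shows "differentiable_upto n S (\<lambda>p. \<Sum>i\<in>I. f i p)"
proof (cases "finite I")
  case True
  then show ?thesis using assms(2)
    by (induction I) (auto intro: differentiable_upto_add differentiable_upto_const assms(1))
qed (simp add: differentiable_upto_const assms(1))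

lemma differentiable_upto_scaleR:
  fixes k :: "'a::real_normed_vector \<Rightarrow> real"
  assumes "open S" "differentiable_upto n S k" "differentiable_upto n S f"
  shows "differentiable_upto n S (\<lambda>p. k p *\<^sub>R f p)"
  using assms(2,3)
proof (induction n arbitrary: k f)
  case 0
  then show ?case by (simp add: differentiable_on_def differentiable_scaleR)
next
  case (Suc n)
  show ?case
  proof (rule differentiable_upto_SucI[OF assms(1)])
    fix p assume "p \<in> S"
    then show "((\<lambda>p. k p *\<^sub>R f p) has_derivative
        (\<lambda>v. k p *\<^sub>R partial v f p + partial v k p *\<^sub>R f p)) (at p)"
      using Suc.prems by (intro has_derivative_scaleR differentiable_upto_imp_has_derivative[OF assms(1)])
  next
    show "differentiable_upto n S (\<lambda>p. k p *\<^sub>R partial v f p + partial v k p *\<^sub>R f p)" for v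
      using Suc differentiable_upto_Suc_imp[OF Suc.prems(1)] differentiable_upto_Suc_imp[OF Suc.prems(2)]
      by (auto intro!: differentiable_upto_add assms(1))
  qed
qed

lemma differentiable_upto_inverse:
  fixes f :: "'a::real_normed_vector \<Rightarrow> real"
  assumes "open S" "differentiable_upto n S f" "\<And>p. p \<in> S \<Longrightarrow> f p \<noteq> 0"
  shows "differentiable_upto n S (\<lambda>p. inverse (f p))"
  using assms(2,3)
proof (induction n arbitrary: f)
  case 0
  then show ?case by (simp add: differentiable_on_inverse)
next
  case (Suc n)
  show ?case
  proof (rule differentiable_upto_SucI[OF assms(1)])
    fix p assume "p \<in> S"
    then show "((\<lambda>p. inverse (f p)) has_derivative
        (\<lambda>v. (- 1 *\<^sub>R (inverse (f p) *\<^sub>R inverse (f p))) *\<^sub>R partial v f p)) (at p)"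
      using differentiable_upto_imp_has_derivative[OF assms(1) Suc.prems(1)] Suc.prems(2)
      by (auto intro!: derivative_eq_intros)
  next
    have "differentiable_upto n S (\<lambda>p. inverse (f p))"
      using Suc differentiable_upto_Suc_imp[OF Suc.prems(1)] by blast
    then show "differentiable_upto n S (\<lambda>p. (- 1 *\<^sub>R (inverse (f p) *\<^sub>R inverse (f p))) *\<^sub>R partial v f p)" for v
      using Suc.prems(1) by (intro differentiable_upto_scaleR differentiable_upto_const assms(1)) auto
  qed
qed

text \<open>The chain rule differentiates \<open>g\<close> in a direction that moves with the point.
  Expansion in a basis puts this dependence into scalar coefficients and leaves fixed directions, as
  an induction on the order requires.\<close>

lemma partial_euclidean:
  fixes g :: "'a::euclidean_space \<Rightarrow> 'b::real_normed_vector"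
  assumes "g differentiable at p"
  shows "partial w g p = (\<Sum>b\<in>Basis. (w \<bullet> b) *\<^sub>R partial b g p)"
proof -
  note lin = has_derivative_linear[OF has_derivative_partial[OF assms]]
  have "partial w g p = partial (\<Sum>b\<in>Basis. (w \<bullet> b) *\<^sub>R b) g p"
    by (simp add: euclidean_representation)
  also have "\<dots> = (\<Sum>b\<in>Basis. (w \<bullet> b) *\<^sub>R partial b g p)"
    by (simp only: linear_sum[OF lin] linear_scale[OF lin])
  finally show ?thesis .
qed

lemma differentiable_upto_compose:
  fixes f :: "'a::real_normed_vector \<Rightarrow> 'b::euclidean_space" and g :: "'b \<Rightarrow> 'c::real_normed_vector"
  assumes "open S" "open T" "differentiable_upto n S f" "differentiable_upto n T g"
    and sub: "\<And>p. p \<in> S \<Longrightarrow> f p \<in> T"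
  shows "differentiable_upto n S (\<lambda>p. g (f p))"
  using assms(3,4)
proof (induction n arbitrary: g)
  case 0
  then have "(\<lambda>p. g (f p)) differentiable at p" if "p \<in> S" for p
    using that sub assms(1,2) differentiable_compose[of g f p]
    by (simp add: differentiable_on_eq_differentiable_at)
  then show ?case using assms(1) by (simp add: differentiable_on_eq_differentiable_at)
next
  case (Suc n)
  show ?case
  proof (rule differentiable_upto_SucI[OF assms(1)])
    fix p assume p: "p \<in> S"
    have g: "(g has_derivative (\<lambda>v. partial v g (f p))) (at (f p))"
      using differentiable_upto_imp_has_derivative[OF assms(2) Suc.prems(2)] sub[OF p] by blast
    have "((\<lambda>p. g (f p)) has_derivative (\<lambda>v. partial (partial v f p) g (f p))) (at p)"
      by (rule has_derivative_compose[OF differentiable_upto_imp_has_derivative[OF assms(1) Suc.prems(1) p] g])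
    then show "((\<lambda>p. g (f p)) has_derivative
        (\<lambda>v. \<Sum>b\<in>Basis. (partial v f p \<bullet> b) *\<^sub>R partial b g (f p))) (at p)"
      by (subst (asm) partial_euclidean[OF differentiableI[OF g], abs_def])
  next
    fix v
    have "differentiable_upto n S (\<lambda>p. partial b g (f p))" for b
      using Suc differentiable_upto_Suc_imp[OF Suc.prems(1)] by auto
    moreover have "differentiable_upto n S (\<lambda>p. partial v f p \<bullet> b)" for b
      using Suc.prems(1) by (intro differentiable_upto_bounded_linear[where L="\<lambda>x. x \<bullet> b"] assms(1) bounded_linear_inner_left) auto
    ultimately show "differentiable_upto n S (\<lambda>p. \<Sum>b\<in>Basis. (partial v f p \<bullet> b) *\<^sub>R partial b g (f p))"
      by (intro differentiable_upto_sum differentiable_upto_scaleR assms(1))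
  qed
qed

section \<open>Closure properties of smooth maps\<close>

lemma smooth_on_cong: "smooth_on S f \<Longrightarrow> (\<And>p. p \<in> S \<Longrightarrow> f p = g p) \<Longrightarrow> smooth_on S g"
  unfolding smooth_on_iff using differentiable_upto_cong by blast

lemma smooth_onI:
  assumes "open S" "\<And>p. p \<in> S \<Longrightarrow> (f has_derivative f' p) (at p)" "\<And>v. smooth_on S (\<lambda>p. f' p v)"
  shows "smooth_on S f"
  using assms differentiable_upto_SucI[of S f f'] unfolding smooth_on_iff
  by (metis differentiable_upto_Suc_imp)

named_theorems smooth_intros

lemma smooth_on_const [smooth_intros]: "open S \<Longrightarrow> smooth_on S (\<lambda>p. c)"
  unfolding smooth_on_iff by (simp add: differentiable_upto_const)

lemma smooth_on_bounded_linear: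
  "bounded_linear L \<Longrightarrow> smooth_on S f \<Longrightarrow> smooth_on S (\<lambda>p. L (f p))"
  unfolding smooth_on_iff by (simp add: differentiable_upto_bounded_linear)

lemma smooth_on_ident [smooth_intros]: "open S \<Longrightarrow> smooth_on S (\<lambda>p. p)"
  by (rule smooth_onI[where f' = "\<lambda>p v. v"]) (auto intro: smooth_intros)

lemma smooth_on_add [smooth_intros]:
  "smooth_on S f \<Longrightarrow> smooth_on S g \<Longrightarrow> smooth_on S (\<lambda>p. f p + g p)"
  unfolding smooth_on_iff by (simp add: differentiable_upto_add)

lemma smooth_on_scaleR [smooth_intros]:
  fixes k :: "'a::real_normed_vector \<Rightarrow> real"
  shows "smooth_on S k \<Longrightarrow> smooth_on S f \<Longrightarrow> smooth_on S (\<lambda>p. k p *\<^sub>R f p)"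
  unfolding smooth_on_iff by (simp add: differentiable_upto_scaleR)

lemma smooth_on_mult [smooth_intros]:
  fixes f :: "'a::real_normed_vector \<Rightarrow> real"
  shows "smooth_on S f \<Longrightarrow> smooth_on S g \<Longrightarrow> smooth_on S (\<lambda>p. f p * g p)"
  using smooth_on_scaleR[of S f g] by simp

lemma smooth_on_minus [smooth_intros]: "smooth_on S f \<Longrightarrow> smooth_on S (\<lambda>p. - f p)"
  using smooth_on_bounded_linear[of uminus S f] bounded_linear_minus[OF bounded_linear_ident] by simp

lemma smooth_on_diff [smooth_intros]:
  "smooth_on S f \<Longrightarrow> smooth_on S g \<Longrightarrow> smooth_on S (\<lambda>p. f p - g p)"
  using smooth_on_add[of S f "\<lambda>p. - g p"] smooth_on_minus[of S g] by simp

lemma smooth_on_inverse [smooth_intros]: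
  fixes f :: "'a::real_normed_vector \<Rightarrow> real"
  shows "smooth_on S f \<Longrightarrow> (\<And>p. p \<in> S \<Longrightarrow> f p \<noteq> 0) \<Longrightarrow> smooth_on S (\<lambda>p. inverse (f p))"
  unfolding smooth_on_iff by (simp add: differentiable_upto_inverse)

lemma smooth_on_divide [smooth_intros]:
  fixes f :: "'a::real_normed_vector \<Rightarrow> real"
  shows "smooth_on S f \<Longrightarrow> smooth_on S g \<Longrightarrow> (\<And>p. p \<in> S \<Longrightarrow> g p \<noteq> 0) \<Longrightarrow> smooth_on S (\<lambda>p. f p / g p)"
  unfolding divide_inverse by (intro smooth_intros)

lemma smooth_on_compose:
  fixes f :: "'a::real_normed_vector \<Rightarrow> 'b::euclidean_space" and g :: "'b \<Rightarrow> 'c::real_normed_vector"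
  shows "smooth_on T g \<Longrightarrow> smooth_on S f \<Longrightarrow> (\<And>p. p \<in> S \<Longrightarrow> f p \<in> T) \<Longrightarrow> smooth_on S (\<lambda>p. g (f p))"
  unfolding smooth_on_iff using differentiable_upto_compose[of S T _ f g] by blast

lemma smooth_on_subset: "smooth_on T f \<Longrightarrow> open S \<Longrightarrow> S \<subseteq> T \<Longrightarrow> smooth_on S f"
  unfolding smooth_on_def using differentiable_on_subset by blast

lemma smooth_on_Pair [smooth_intros]:
  assumes "smooth_on S f" "smooth_on S g"
  shows "smooth_on S (\<lambda>p. (f p, g p))"
proof -
  have "bounded_linear (\<lambda>x::'b. (x, 0::'c))" "bounded_linear (\<lambda>x::'c. (0::'b, x))"
    by (intro bounded_linear_Pair bounded_linear_ident bounded_linear_zero)+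
  from smooth_on_add[OF smooth_on_bounded_linear[OF this(1) assms(1)] smooth_on_bounded_linear[OF this(2) assms(2)]]
  show ?thesis by simp
qed

lemma smooth_on_fst [smooth_intros]: "smooth_on S f \<Longrightarrow> smooth_on S (\<lambda>p. fst (f p))"
  using smooth_on_bounded_linear[OF bounded_linear_fst] .

lemma smooth_on_snd [smooth_intros]: "smooth_on S f \<Longrightarrow> smooth_on S (\<lambda>p. snd (f p))"
  using smooth_on_bounded_linear[OF bounded_linear_snd] .

text \<open>When the derivative is an expression in \<open>f\<close> itself, as for solutions of
  first order differential equations, each order of regularity of \<open>f\<close> yields the
  next.\<close>

lemma smooth_on_bootstrap:
  assumes S: "open S"
    and der: "\<And>p. p \<in> S \<Longrightarrow> (f has_derivative f' p) (at p)"
    and step: "\<And>n v. differentiable_upto n S f \<Longrightarrow> differentiable_upto n S (\<lambda>p. f' p v)"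
  shows "smooth_on S f"
proof -
  have "differentiable_upto n S f" for n
  proof (induction n)
    case 0
    then show ?case
      using S der by (auto simp: differentiable_on_eq_differentiable_at intro: differentiableI)
  next
    case (Suc n)
    then show ?case using differentiable_upto_SucI[OF S der] step by blast
  qed
  then show ?thesis using S by (simp add: smooth_on_iff)
qed

section \<open>Symmetry of second derivatives and Lie brackets\<close>

lemma partial_linear:
  assumes "g differentiable at p"
  shows "partial (a + b) g p = partial a g p + partial b g p"
    and "partial (a - b) g p = partial a g p - partial b g p"
    and "partial (c *\<^sub>R a) g p = c *\<^sub>R partial a g p"
    and "partial 0 g p = 0"
  using has_derivative_linear[OF has_derivative_partial[OF assms]]
    linear_add linear_diff linear_scale linear_0 by blast+

lemma has_real_derivative_along_line:
  fixes f :: "'a::real_normed_vector \<Rightarrow> real"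
  assumes "f differentiable at (q + t *\<^sub>R v)"
  shows "((\<lambda>t. f (q + t *\<^sub>R v)) has_real_derivative partial v f (q + t *\<^sub>R v)) (at t)"
proof -
  note d = has_derivative_partial[OF assms]
  have "((\<lambda>t. q + t *\<^sub>R v) has_derivative (\<lambda>h. h *\<^sub>R v)) (at t)"
    by (auto intro!: derivative_eq_intros)
  from has_derivative_compose[OF this d]
  have "((\<lambda>t. f (q + t *\<^sub>R v)) has_derivative (\<lambda>h. h * partial v f (q + t *\<^sub>R v))) (at t)"
    by (simp add: partial_linear(3)[OF assms])
  then show ?thesis by (simp add: has_field_derivative_def mult_commute_abs)
qed

text \<open>The mean value theorem is used twice: in direction \<open>v\<close> on the increment of
  \<open>f\<close> along \<open>w\<close>, then in direction \<open>w\<close> on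
  \<open>partial v f\<close>.\<close>

lemma second_difference_mean_value:
  fixes f :: "'a::real_normed_vector \<Rightarrow> real"
  assumes f: "smooth_on S f" and s: "0 < s"
    and S: "\<And>a b. 0 \<le> a \<Longrightarrow> a \<le> s \<Longrightarrow> 0 \<le> b \<Longrightarrow> b \<le> s \<Longrightarrow> p + a *\<^sub>R v + b *\<^sub>R w \<in> S"
  obtains a b where "0 \<le> a" "a \<le> s" "0 \<le> b" "b \<le> s"
    "f (p + s *\<^sub>R v + s *\<^sub>R w) - f (p + s *\<^sub>R v) - f (p + s *\<^sub>R w) + f p
      = s\<^sup>2 * partial w (partial v f) (p + a *\<^sub>R v + b *\<^sub>R w)"
proof -
  define g where "g = (\<lambda>a. f ((p + s *\<^sub>R w) + a *\<^sub>R v) - f (p + a *\<^sub>R v))"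
  have "(g has_real_derivative partial v f ((p + s *\<^sub>R w) + a *\<^sub>R v) - partial v f (p + a *\<^sub>R v)) (at a)"
    if "0 \<le> a" "a \<le> s" for a
    unfolding g_def
    by (intro DERIV_diff has_real_derivative_along_line smooth_on_differentiable[OF f])
       (use S[of a s] S[of a 0] that s in \<open>simp_all add: algebra_simps\<close>)
  from MVT2[OF s this] obtain a where a: "0 < a" "a < s"
    "g s - g 0 = s * (partial v f ((p + s *\<^sub>R w) + a *\<^sub>R v) - partial v f (p + a *\<^sub>R v))" by auto
  have "((\<lambda>b. partial v f ((p + a *\<^sub>R v) + b *\<^sub>R w)) has_real_derivative
      partial w (partial v f) ((p + a *\<^sub>R v) + b *\<^sub>R w)) (at b)" if "0 \<le> b" "b \<le> s" for b
    by (intro has_real_derivative_along_line smooth_on_differentiable[OF smooth_on_partial[OF f]])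
       (use S[of a b] that a in simp)
  from MVT2[OF s this] obtain b where b: "0 < b" "b < s"
    "partial v f ((p + a *\<^sub>R v) + s *\<^sub>R w) - partial v f ((p + a *\<^sub>R v) + 0 *\<^sub>R w)
      = s * partial w (partial v f) ((p + a *\<^sub>R v) + b *\<^sub>R w)" by auto
  show ?thesis
  proof (rule that[of a b])
    have "f (p + s *\<^sub>R v + s *\<^sub>R w) - f (p + s *\<^sub>R v) - f (p + s *\<^sub>R w) + f p = g s - g 0"
      unfolding g_def by (simp add: algebra_simps)
    also have "\<dots> = s * (s * partial w (partial v f) ((p + a *\<^sub>R v) + b *\<^sub>R w))"
      using a(3) b(3) by (simp add: algebra_simps)
    finally show "f (p + s *\<^sub>R v + s *\<^sub>R w) - f (p + s *\<^sub>R v) - f (p + s *\<^sub>R w) + f p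
      = s\<^sup>2 * partial w (partial v f) (p + a *\<^sub>R v + b *\<^sub>R w)" by (simp add: power2_eq_square)
  qed (use a b in auto)
qed

text \<open>The second difference is symmetric in \<open>v\<close> and \<open>w\<close>, so some
  value of one mixed derivative near \<open>p\<close> equals some value of the other near
  \<open>p\<close>; continuity of both does the rest.\<close>

theorem partial_commute:
  fixes f :: "'a::real_normed_vector \<Rightarrow> real"
  assumes f: "smooth_on S f" and p: "p \<in> S"
  shows "partial v (partial w f) p = partial w (partial v f) p"
proof (rule ccontr)
  assume neq: "partial v (partial w f) p \<noteq> partial w (partial v f) p"
  \<comment> \<open>Half the gap: if both mixed derivatives stay within \<open>e\<close> of their
    values at \<open>p\<close>, two equal nearby values force the gap below
    \<open>2 * e\<close>.\<close>
  define e where "e = \<bar>partial v (partial w f) p - partial w (partial v f) p\<bar> / 2"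
  have e: "e > 0" using neq by (simp add: e_def)
  have "open S" using f by (rule smooth_on_open)
  have cont: "isCont (partial v' (partial w' f)) p" for v' w'
    by (meson smooth_on_differentiable smooth_on_partial f p differentiable_imp_continuous_within)
  obtain d1 where d1: "d1 > 0" "\<And>q. dist q p < d1 \<Longrightarrow> q \<in> S"
    using \<open>open S\<close> p by (meson open_dist)
  obtain d2 where d2: "d2 > 0" "\<And>q. dist q p < d2 \<Longrightarrow> dist (partial v (partial w f) q) (partial v (partial w f) p) < e"
    using cont[unfolded continuous_at_eps_delta] e by blast
  obtain d3 where d3: "d3 > 0" "\<And>q. dist q p < d3 \<Longrightarrow> dist (partial w (partial v f) q) (partial w (partial v f) p) < e"
    using cont[unfolded continuous_at_eps_delta] e by blast
  define d where "d = min d1 (min d2 d3)"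
  \<comment> \<open>The parallelogram spanned by \<open>s *\<^sub>R v\<close> and
    \<open>s *\<^sub>R w\<close> stays within \<open>d / 2\<close> of \<open>p\<close>; the summand
    1 keeps the denominator positive when both directions vanish.\<close>
  define s where "s = d / (norm v + norm w + 1) / 2"
  have d: "d > 0" using d1 d2 d3 by (simp add: d_def)
  have pos: "norm v + norm w + 1 > 0" by (simp add: add_nonneg_pos)
  have s: "s > 0" using d pos by (simp add: s_def)
  have near: "dist (p + a *\<^sub>R v + b *\<^sub>R w) p < d" if "0 \<le> a" "a \<le> s" "0 \<le> b" "b \<le> s" for a b
  proof -
    have "dist (p + a *\<^sub>R v + b *\<^sub>R w) p = norm (a *\<^sub>R v + b *\<^sub>R w)"
      by (simp add: dist_norm algebra_simps)
    also have "\<dots> \<le> a * norm v + b * norm w"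
      using norm_triangle_ineq[of "a *\<^sub>R v" "b *\<^sub>R w"] that by simp
    also have "\<dots> \<le> s * norm v + s * norm w"
      using that by (intro add_mono mult_right_mono) auto
    also have "\<dots> \<le> s * (norm v + norm w + 1)" using s by (simp add: algebra_simps)
    also have "\<dots> = d / 2" using pos by (simp add: s_def field_simps)
    also have "\<dots> < d" using d by simp
    finally show ?thesis .
  qed
  have inS: "p + a *\<^sub>R v + b *\<^sub>R w \<in> S" if "0 \<le> a" "a \<le> s" "0 \<le> b" "b \<le> s" for a b
    using near[OF that] d1(2) by (simp add: d_def)
  have inS': "p + a *\<^sub>R w + b *\<^sub>R v \<in> S" if "0 \<le> a" "a \<le> s" "0 \<le> b" "b \<le> s" for a b
    using inS[OF that(3,4,1,2)] by (simp only: ac_simps)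
  obtain a b where ab: "0 \<le> a" "a \<le> s" "0 \<le> b" "b \<le> s"
    "f (p + s *\<^sub>R v + s *\<^sub>R w) - f (p + s *\<^sub>R v) - f (p + s *\<^sub>R w) + f p
      = s\<^sup>2 * partial w (partial v f) (p + a *\<^sub>R v + b *\<^sub>R w)"
    by (rule second_difference_mean_value[OF f s inS])
  obtain a' b' where ab': "0 \<le> a'" "a' \<le> s" "0 \<le> b'" "b' \<le> s"
    "f (p + s *\<^sub>R w + s *\<^sub>R v) - f (p + s *\<^sub>R w) - f (p + s *\<^sub>R v) + f p
      = s\<^sup>2 * partial v (partial w f) (p + a' *\<^sub>R w + b' *\<^sub>R v)"
    by (rule second_difference_mean_value[OF f s inS'])
  have swap: "p + c *\<^sub>R w + c' *\<^sub>R v = p + c' *\<^sub>R v + c *\<^sub>R w" for c c'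
    by (simp only: ac_simps)
  have "s\<^sup>2 * partial w (partial v f) (p + a *\<^sub>R v + b *\<^sub>R w)
      = s\<^sup>2 * partial v (partial w f) (p + b' *\<^sub>R v + a' *\<^sub>R w)"
    using ab(5) ab'(5) unfolding swap by linarith
  then have "partial w (partial v f) (p + a *\<^sub>R v + b *\<^sub>R w) = partial v (partial w f) (p + b' *\<^sub>R v + a' *\<^sub>R w)"
    using s by simp
  moreover have "dist (partial w (partial v f) (p + a *\<^sub>R v + b *\<^sub>R w)) (partial w (partial v f) p) < e"
    using near[of a b] ab d3(2) by (simp add: d_def)
  moreover have "dist (partial v (partial w f) (p + b' *\<^sub>R v + a' *\<^sub>R w)) (partial v (partial w f) p) < e"
    using near[of b' a'] ab' d2(2) by (simp add: d_def)
  ultimately show False unfolding e_def dist_real_def by (smt (verit) field_sum_of_halves)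
qed

lemma has_derivative_along_field:
  fixes h :: "'a::euclidean_space \<Rightarrow> real"
  assumes h: "smooth_on S h" and p: "p \<in> S" and B: "(B has_derivative B') (at p)"
  shows "((\<lambda>q. partial (B q) h q) has_derivative
     (\<lambda>v. partial (B p) (partial v h) p + partial (B' v) h p)) (at p)"
proof -
  note hb = smooth_on_partial[OF h]
  have "((\<lambda>q. \<Sum>b\<in>Basis. (B q \<bullet> b) *\<^sub>R partial b h q) has_derivative
      (\<lambda>v. \<Sum>b\<in>Basis. (B p \<bullet> b) *\<^sub>R partial v (partial b h) p + (B' v \<bullet> b) *\<^sub>R partial b h p)) (at p)"
    by (intro has_derivative_sum has_derivative_scaleR has_derivative_inner_left B
        smooth_on_has_derivative[OF hb p])
  also have "(\<lambda>v. \<Sum>b\<in>Basis. (B p \<bullet> b) *\<^sub>R partial v (partial b h) p + (B' v \<bullet> b) *\<^sub>R partial b h p)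
      = (\<lambda>v. partial (B p) (partial v h) p + partial (B' v) h p)"
  proof
    fix v
    show "(\<Sum>b\<in>Basis. (B p \<bullet> b) *\<^sub>R partial v (partial b h) p + (B' v \<bullet> b) *\<^sub>R partial b h p)
        = partial (B p) (partial v h) p + partial (B' v) h p"
      by (simp only: partial_euclidean[OF smooth_on_differentiable[OF h p], of "B' v"]
        partial_euclidean[OF smooth_on_differentiable[OF hb p], of "B p"] partial_commute[OF h p, of v]
        sum.distrib)
  qed
  finally show ?thesis
    by (rule has_derivative_transform_within_open[OF _ smooth_on_open[OF h] p])
      (rule partial_euclidean[OF smooth_on_differentiable[OF h], symmetric])
qed

text \<open>The terms with two derivatives of \<open>h\<close> cancel by symmetry, so only the
  derivative of \<open>h\<close> along the Lie bracket of the two fields is left.\<close>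

lemma commutator_along_fields:
  fixes h :: "'a::euclidean_space \<Rightarrow> real"
  assumes h: "smooth_on S h" and p: "p \<in> S"
    and A: "(A has_derivative A') (at p)" and B: "(B has_derivative B') (at p)"
  shows "partial (A p) (\<lambda>q. partial (B q) h q) p - partial (B p) (\<lambda>q. partial (A q) h q) p
     = partial (B' (A p) - A' (B p)) h p"
  unfolding partial_eqI[OF has_derivative_along_field[OF h p A]]
    partial_eqI[OF has_derivative_along_field[OF h p B]]
    partial_linear(2)[OF smooth_on_differentiable[OF h p]]
    partial_commute[OF h p, of "A p" "B p"]
  by simp

section \<open>Rational functions on jet space\<close>

text \<open>The curve along which \<open>total_derivative\<close> differentiates; naming it turns
  the total derivative into an ordinary one-variable \<open>deriv\<close>.\<close>

definition jet_line :: "multi_index \<Rightarrow> jet \<Rightarrow> real \<Rightarrow> jet" where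
  "jet_line e \<theta> t = (fst \<theta> + t *\<^sub>R (case e of (a, b, c) \<Rightarrow> (real a, real b, real c)),
     \<lambda>\<sigma>. snd \<theta> \<sigma> + t * snd \<theta> (\<sigma> + e))"

lemma total_derivative_eq: "total_derivative e \<phi> \<theta> = deriv (\<lambda>t. \<phi> (jet_line e \<theta> t)) 0"
  by (cases \<theta>) (simp add: total_derivative_def jet_line_def)

lemma jet_line_0 [simp]: "jet_line e \<theta> 0 = \<theta>"
  by (cases \<theta>; cases e) (simp add: jet_line_def zero_prod_def)

lemma coordinates_jet_line:
  "jet_x (jet_line (a, b, c) \<theta> t) = jet_x \<theta> + t * real a"
  "jet_u (jet_line (a, b, c) \<theta> t) = jet_u \<theta> + t * real b"
  "jet_u1 (jet_line (a, b, c) \<theta> t) = jet_u1 \<theta> + t * real c"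
  "jet_f i j k (jet_line (a, b, c) \<theta> t) = jet_f i j k \<theta> + t * jet_f (i + a) (j + b) (k + c) \<theta>"
  by (cases \<theta>; simp add: jet_line_def jet_x_def jet_u_def jet_u1_def jet_f_def case_prod_unfold)+

lemma total_derivative_coordinates:
  "total_derivative (a, b, c) jet_x = (\<lambda>_. real a)"
  "total_derivative (a, b, c) jet_u = (\<lambda>_. real b)"
  "total_derivative (a, b, c) jet_u1 = (\<lambda>_. real c)"
  "total_derivative (a, b, c) (jet_f i j k) = jet_f (i + a) (j + b) (k + c)"
  unfolding fun_eq_iff total_derivative_eq coordinates_jet_line
  by (auto intro!: DERIV_imp_deriv derivative_eq_intros)

text \<open>This makes total derivatives local: functions that agree on regular jets agree on a
  short piece of the line, hence have the same total derivative at a regular jet.\<close>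

lemma regular_jet_line:
  assumes "regular_jet \<theta>"
  shows "\<forall>\<^sub>F t in nhds 0. regular_jet (jet_line e \<theta> t)"
proof -
  obtain a b c where e: "e = (a, b, c)" by (cases e)
  have ev: "\<forall>\<^sub>F t in nhds 0. g t \<noteq> 0" if "continuous_on UNIV g" "g 0 \<noteq> 0" for g :: "real \<Rightarrow> real"
  proof -
    have "open {t. g t \<noteq> 0}"
      by (intro open_Collect_neq that continuous_intros)
    then show ?thesis using that by (auto simp: eventually_nhds)
  qed
  show ?thesis
    using assms unfolding regular_jet_def e coordinates_jet_line
    by (intro eventually_conj ev continuous_intros) simp_all
qed

text \<open>Only values on regular jets matter, hence the rule \<open>cong\<close>: elsewhere \<open>inv_K\<close> and the
  quotients in the other invariants take junk values.\<close>

inductive_set rational_jet_functions :: "(jet \<Rightarrow> real) set" where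
  const: "(\<lambda>_. c) \<in> rational_jet_functions"
| coordinate: "\<phi> \<in> jet_coordinates \<Longrightarrow> \<phi> \<in> rational_jet_functions"
| add: "\<phi> \<in> rational_jet_functions \<Longrightarrow> \<psi> \<in> rational_jet_functions \<Longrightarrow>
    (\<lambda>\<theta>. \<phi> \<theta> + \<psi> \<theta>) \<in> rational_jet_functions"
| mult: "\<phi> \<in> rational_jet_functions \<Longrightarrow> \<psi> \<in> rational_jet_functions \<Longrightarrow>
    (\<lambda>\<theta>. \<phi> \<theta> * \<psi> \<theta>) \<in> rational_jet_functions"
| inverse: "\<phi> \<in> rational_jet_functions \<Longrightarrow> (\<And>\<theta>. regular_jet \<theta> \<Longrightarrow> \<phi> \<theta> \<noteq> 0) \<Longrightarrow>
    (\<lambda>\<theta>. inverse (\<phi> \<theta>)) \<in> rational_jet_functions"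
| cong: "\<phi> \<in> rational_jet_functions \<Longrightarrow> (\<And>\<theta>. regular_jet \<theta> \<Longrightarrow> \<psi> \<theta> = \<phi> \<theta>) \<Longrightarrow>
    \<psi> \<in> rational_jet_functions"

named_theorems rational_intros

lemma rational_jet_coordinates:
  "jet_x \<in> rational_jet_functions" "jet_u \<in> rational_jet_functions"
  "jet_u1 \<in> rational_jet_functions" "jet_f a b c \<in> rational_jet_functions"
  by (rule rational_jet_functions.coordinate, unfold jet_coordinates_def, blast)+

lemma rational_jet_minus:
  "\<phi> \<in> rational_jet_functions \<Longrightarrow> (\<lambda>\<theta>. - \<phi> \<theta>) \<in> rational_jet_functions"
  using rational_jet_functions.mult[OF rational_jet_functions.const[of "-1"], of \<phi>] by simp

lemma rational_jet_diff:
  "\<phi> \<in> rational_jet_functions \<Longrightarrow> \<psi> \<in> rational_jet_functions \<Longrightarrow>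
    (\<lambda>\<theta>. \<phi> \<theta> - \<psi> \<theta>) \<in> rational_jet_functions"
  using rational_jet_functions.add[OF _ rational_jet_minus, of \<phi> \<psi>] by simp

lemma rational_jet_divide:
  "\<phi> \<in> rational_jet_functions \<Longrightarrow> \<psi> \<in> rational_jet_functions \<Longrightarrow>
    (\<And>\<theta>. regular_jet \<theta> \<Longrightarrow> \<psi> \<theta> \<noteq> 0) \<Longrightarrow> (\<lambda>\<theta>. \<phi> \<theta> / \<psi> \<theta>) \<in> rational_jet_functions"
  unfolding divide_inverse by (intro rational_jet_functions.mult rational_jet_functions.inverse)

lemma rational_jet_power:
  "\<phi> \<in> rational_jet_functions \<Longrightarrow> (\<lambda>\<theta>. \<phi> \<theta> ^ n) \<in> rational_jet_functions"
  by (induction n) (auto intro: rational_jet_functions.const rational_jet_functions.mult)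

lemmas [rational_intros] =
  rational_jet_functions.const rational_jet_coordinates rational_jet_functions.add
  rational_jet_functions.mult rational_jet_minus rational_jet_diff rational_jet_divide rational_jet_power

lemma total_derivativeI:
  assumes "\<And>\<theta>. regular_jet \<theta> \<Longrightarrow> ((\<lambda>t. \<phi> (jet_line e \<theta> t)) has_real_derivative \<psi> \<theta>) (at 0)"
    and "\<psi> \<in> rational_jet_functions"
  shows "total_derivative e \<phi> \<in> rational_jet_functions \<and> (\<forall>\<theta>. regular_jet \<theta> \<longrightarrow>
    ((\<lambda>t. \<phi> (jet_line e \<theta> t)) has_real_derivative total_derivative e \<phi> \<theta>) (at 0))"
proof -
  have "total_derivative e \<phi> \<theta> = \<psi> \<theta>" if "regular_jet \<theta>" for \<theta>
    using assms(1)[OF that] by (simp add: total_derivative_eq DERIV_imp_deriv)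
  then show ?thesis
    using assms rational_jet_functions.cong[OF assms(2), of "total_derivative e \<phi>"] by auto
qed

text \<open>\<open>deriv\<close> says nothing unless the derivative exists, so the existence of the
  derivative and the formula that shows it to be rational go through one induction together.\<close>

lemma total_derivative_rational_aux:
  assumes "\<phi> \<in> rational_jet_functions"
  shows "total_derivative e \<phi> \<in> rational_jet_functions \<and> (\<forall>\<theta>. regular_jet \<theta> \<longrightarrow>
    ((\<lambda>t. \<phi> (jet_line e \<theta> t)) has_real_derivative total_derivative e \<phi> \<theta>) (at 0))"
  using assms
proof induction
  case (const c)
  show ?case
    by (rule total_derivativeI[where \<psi> = "\<lambda>_. 0"]) (auto intro: rational_intros)
next
  case (coordinate \<phi>)
  obtain a b c where e: "e = (a, b, c)" by (cases e)
  have "\<exists>\<psi>. \<psi> \<in> rational_jet_functions \<and>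
      (\<forall>\<theta>. ((\<lambda>t. \<phi> (jet_line e \<theta> t)) has_real_derivative \<psi> \<theta>) (at 0))"
    using coordinate unfolding jet_coordinates_def
  proof (elim UnE insertE emptyE CollectE exE conjE)
    show ?thesis if "\<phi> = jet_x"
      by (rule exI[of _ "\<lambda>_. real a"])
        (auto simp: that e coordinates_jet_line intro!: rational_intros derivative_eq_intros)
    show ?thesis if "\<phi> = jet_u"
      by (rule exI[of _ "\<lambda>_. real b"])
        (auto simp: that e coordinates_jet_line intro!: rational_intros derivative_eq_intros)
    show ?thesis if "\<phi> = jet_u1"
      by (rule exI[of _ "\<lambda>_. real c"])
        (auto simp: that e coordinates_jet_line intro!: rational_intros derivative_eq_intros)
    show ?thesis if "\<phi> = jet_f i j k" for i j k
      by (rule exI[of _ "jet_f (i + a) (j + b) (k + c)"])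
        (auto simp: that e coordinates_jet_line intro!: rational_intros derivative_eq_intros)
  qed
  then show ?case using total_derivativeI by blast
next
  case (add \<phi> \<psi>)
  show ?case
    by (rule total_derivativeI[where \<psi> = "\<lambda>\<theta>. total_derivative e \<phi> \<theta> + total_derivative e \<psi> \<theta>"])
      (use add in \<open>auto intro!: rational_intros derivative_eq_intros\<close>)
next
  case (mult \<phi> \<psi>)
  show ?case
    by (rule total_derivativeI[where
          \<psi> = "\<lambda>\<theta>. total_derivative e \<phi> \<theta> * \<psi> \<theta> + total_derivative e \<psi> \<theta> * \<phi> \<theta>"])
      (use mult in \<open>auto intro!: rational_intros derivative_eq_intros\<close>)
next
  case (inverse \<phi>)
  show ?case
    by (rule total_derivativeI[where
          \<psi> = "\<lambda>\<theta>. - (inverse (\<phi> \<theta>) * total_derivative e \<phi> \<theta> * inverse (\<phi> \<theta>))"])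
      (use inverse in \<open>auto intro!: rational_intros rational_jet_functions.inverse derivative_eq_intros\<close>)
next
  case (cong \<phi> \<psi>)
  show ?case
  proof (rule total_derivativeI[where \<psi> = "total_derivative e \<phi>"])
    show "((\<lambda>t. \<psi> (jet_line e \<theta> t)) has_real_derivative total_derivative e \<phi> \<theta>) (at 0)"
      if "regular_jet \<theta>" for \<theta>
    proof -
      have ev: "\<forall>\<^sub>F t in nhds 0. \<psi> (jet_line e \<theta> t) = \<phi> (jet_line e \<theta> t)"
        using regular_jet_line[OF that, of e] by eventually_elim (simp add: cong.hyps)
      then show ?thesis
        using cong.IH[THEN conjunct2, rule_format, OF that] by (simp only: DERIV_cong_ev[OF refl ev refl])
    qed
  qed (use cong in auto)
qed

lemma total_derivative_rational [rational_intros]: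
  "\<phi> \<in> rational_jet_functions \<Longrightarrow> total_derivative e \<phi> \<in> rational_jet_functions"
  using total_derivative_rational_aux by blast

lemma has_derivative_jet_line:
  "\<phi> \<in> rational_jet_functions \<Longrightarrow> regular_jet \<theta> \<Longrightarrow>
    ((\<lambda>t. \<phi> (jet_line e \<theta> t)) has_real_derivative total_derivative e \<phi> \<theta>) (at 0)"
  using total_derivative_rational_aux by blast

lemma total_derivative_cong:
  assumes "\<And>\<theta>. regular_jet \<theta> \<Longrightarrow> \<psi> \<theta> = \<phi> \<theta>" "regular_jet \<theta>"
  shows "total_derivative e \<psi> \<theta> = total_derivative e \<phi> \<theta>"
proof -
  have "\<forall>\<^sub>F t in nhds 0. \<psi> (jet_line e \<theta> t) = \<phi> (jet_line e \<theta> t)"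
    using regular_jet_line[OF assms(2), of e] by eventually_elim (simp add: assms(1))
  then show ?thesis unfolding total_derivative_eq by (intro deriv_cong_ev) auto
qed

lemma total_derivative_const: "total_derivative e (\<lambda>_. c) \<theta> = 0"
  by (simp add: total_derivative_eq)

context
  fixes \<phi> \<psi> :: "jet \<Rightarrow> real" and \<theta> :: jet and e :: multi_index
  assumes \<phi>: "\<phi> \<in> rational_jet_functions" and \<theta>: "regular_jet \<theta>"
begin

lemma total_derivative_inverse:
  assumes "\<phi> \<theta> \<noteq> 0"
  shows "total_derivative e (\<lambda>\<theta>. inverse (\<phi> \<theta>)) \<theta> = - total_derivative e \<phi> \<theta> / \<phi> \<theta> ^ 2"
  unfolding total_derivative_eq[of e "\<lambda>\<theta>. inverse (\<phi> \<theta>)"]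
  using DERIV_imp_deriv[OF DERIV_inverse_fun[OF has_derivative_jet_line[OF \<phi> \<theta>, of e]]] assms
  by (simp add: divide_inverse power2_eq_square)

lemma total_derivative_power2:
  "total_derivative e (\<lambda>\<theta>. (\<phi> \<theta>)\<^sup>2) \<theta> = 2 * \<phi> \<theta> * total_derivative e \<phi> \<theta>"
  unfolding total_derivative_eq[of e "\<lambda>\<theta>. (\<phi> \<theta>)\<^sup>2"]
  using DERIV_imp_deriv[OF DERIV_power[OF has_derivative_jet_line[OF \<phi> \<theta>, of e], of 2]]
  by simp

context
  assumes \<psi>: "\<psi> \<in> rational_jet_functions"
begin

lemma total_derivative_add:
  "total_derivative e (\<lambda>\<theta>. \<phi> \<theta> + \<psi> \<theta>) \<theta> = total_derivative e \<phi> \<theta> + total_derivative e \<psi> \<theta>"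
  unfolding total_derivative_eq[of e "\<lambda>\<theta>. \<phi> \<theta> + \<psi> \<theta>"]
  by (intro DERIV_imp_deriv DERIV_add has_derivative_jet_line \<phi> \<psi> \<theta>)

lemma total_derivative_diff:
  "total_derivative e (\<lambda>\<theta>. \<phi> \<theta> - \<psi> \<theta>) \<theta> = total_derivative e \<phi> \<theta> - total_derivative e \<psi> \<theta>"
  unfolding total_derivative_eq[of e "\<lambda>\<theta>. \<phi> \<theta> - \<psi> \<theta>"]
  by (intro DERIV_imp_deriv DERIV_diff has_derivative_jet_line \<phi> \<psi> \<theta>)

lemma total_derivative_mult:
  "total_derivative e (\<lambda>\<theta>. \<phi> \<theta> * \<psi> \<theta>) \<theta> = total_derivative e \<phi> \<theta> * \<psi> \<theta> + \<phi> \<theta> * total_derivative e \<psi> \<theta>"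
  unfolding total_derivative_eq[of e "\<lambda>\<theta>. \<phi> \<theta> * \<psi> \<theta>"]
  using DERIV_imp_deriv[OF DERIV_mult[OF has_derivative_jet_line[OF \<phi> \<theta>] has_derivative_jet_line[OF \<psi> \<theta>]]]
  by simp

lemma total_derivative_divide:
  assumes "\<psi> \<theta> \<noteq> 0"
  shows "total_derivative e (\<lambda>\<theta>. \<phi> \<theta> / \<psi> \<theta>) \<theta>
      = (total_derivative e \<phi> \<theta> * \<psi> \<theta> - \<phi> \<theta> * total_derivative e \<psi> \<theta>) / \<psi> \<theta> ^ 2"
  unfolding total_derivative_eq[of e "\<lambda>\<theta>. \<phi> \<theta> / \<psi> \<theta>"]
  using DERIV_imp_deriv[OF DERIV_divide[OF has_derivative_jet_line[OF \<phi> \<theta>] has_derivative_jet_line[OF \<psi> \<theta>]]] assms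
  by (simp add: power2_eq_square)

end

end

lemmas total_derivative_rules =
  total_derivative_const total_derivative_inverse total_derivative_power2
  total_derivative_add total_derivative_diff total_derivative_mult total_derivative_divide

section \<open>Substituting a system into jet functions\<close>

lemma smooth_on_funpow_partial: "smooth_on S f \<Longrightarrow> smooth_on S ((partial v ^^ n) f)"
  by (induction n) (auto intro: smooth_on_partial)

lemma partial_funpow_partial:
  fixes f :: "'a::real_normed_vector \<Rightarrow> real"
  assumes "smooth_on S f"
  shows "p \<in> S \<Longrightarrow> partial w ((partial v ^^ n) f) p = (partial v ^^ n) (partial w f) p"
proof (induction n arbitrary: p)
  case (Suc n)
  have "partial w (partial v ((partial v ^^ n) f)) p = partial v (partial w ((partial v ^^ n) f)) p"
    by (rule partial_commute[OF smooth_on_funpow_partial[OF assms] Suc.prems])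
  also have "\<dots> = partial v ((partial v ^^ n) (partial w f)) p"
    by (rule partial_cong[OF smooth_on_open[OF assms] Suc.prems Suc.IH])
  finally show ?case by simp
qed simp

lemma funpow_partial_cong:
  assumes "open S" "\<And>q. q \<in> S \<Longrightarrow> f q = g q"
  shows "p \<in> S \<Longrightarrow> (partial v ^^ n) f p = (partial v ^^ n) g p"
proof (induction n arbitrary: p)
  case (Suc n)
  then show ?case using partial_cong[OF assms(1) Suc.prems Suc.IH] by simp
qed (simp add: assms)

lemma smooth_on_mixed_partial: "smooth_on S F \<Longrightarrow> smooth_on S (mixed_partial (a, b, c) F)"
  unfolding mixed_partial_def by (auto intro: smooth_on_funpow_partial)

text \<open>\<open>mixed_partial\<close> differentiates in the fixed order \<open>u1\<close>,
  \<open>u\<close>, \<open>x\<close>; a further derivative in \<open>u\<close> or \<open>u1\<close>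
  has to be moved inwards past the ones taken after it.\<close>

lemma partial_mixed_partial:
  assumes F: "smooth_on S F" and p: "p \<in> S"
  shows "partial (1, 0, 0) (mixed_partial (a, b, c) F) p = mixed_partial (Suc a, b, c) F p"
    and "partial (0, 1, 0) (mixed_partial (a, b, c) F) p = mixed_partial (a, Suc b, c) F p"
    and "partial (0, 0, 1) (mixed_partial (a, b, c) F) p = mixed_partial (a, b, Suc c) F p"
proof -
  note S = smooth_on_open[OF F]
  let ?x = "(1, 0, 0) :: point" and ?u = "(0, 1, 0) :: point" and ?w = "(0, 0, 1) :: point"
  let ?C = "(partial ?w ^^ c) F" and ?B = "(partial ?u ^^ b) ((partial ?w ^^ c) F)"
  have C: "smooth_on S ?C" and B: "smooth_on S ?B"
    by (intro smooth_on_funpow_partial F)+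
  show "partial ?x (mixed_partial (a, b, c) F) p = mixed_partial (Suc a, b, c) F p"
    by (simp add: mixed_partial_def)
  show "partial ?u (mixed_partial (a, b, c) F) p = mixed_partial (a, Suc b, c) F p"
    using partial_funpow_partial[OF B p] by (simp add: mixed_partial_def)
  have "partial ?w ((partial ?x ^^ a) ?B) p = (partial ?x ^^ a) (partial ?w ?B) p"
    by (rule partial_funpow_partial[OF B p])
  also have "\<dots> = (partial ?x ^^ a) ((partial ?u ^^ b) (partial ?w ?C)) p"
    by (rule funpow_partial_cong[OF S partial_funpow_partial[OF C] p])
  finally show "partial ?w (mixed_partial (a, b, c) F) p = mixed_partial (a, b, Suc c) F p"
    by (simp add: mixed_partial_def)
qed

text \<open>The pointwise content of regularity. It passes to open subsets, which matters because a
  transformation lives only near a point.\<close>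

definition regular_jets_on :: "(point \<Rightarrow> real) \<Rightarrow> point set \<Rightarrow> bool" where
  "regular_jets_on F D \<longleftrightarrow> smooth_on D F \<and> (\<forall>p\<in>D. regular_jet (infinite_jet F p))"

lemma on_system_coordinates:
  "on_system jet_x F = (\<lambda>p. fst p)" "on_system jet_u F = (\<lambda>p. fst (snd p))"
  "on_system jet_u1 F = (\<lambda>p. snd (snd p))"
  "on_system (jet_f a b c) F = mixed_partial (a, b, c) F"
  by (auto simp: on_system_def infinite_jet_def jet_x_def jet_u_def jet_u1_def jet_f_def)

lemma point_has_derivativeI:
  fixes g :: "point \<Rightarrow> real"
  assumes "g differentiable at p"
  shows "(g has_derivative (\<lambda>h. fst h * partial (1, 0, 0) g p + fst (snd h) * partial (0, 1, 0) g p
     + snd (snd h) * partial (0, 0, 1) g p)) (at p)"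
proof -
  have "partial h g p = fst h * partial (1, 0, 0) g p + fst (snd h) * partial (0, 1, 0) g p
     + snd (snd h) * partial (0, 0, 1) g p" for h
  proof (cases h)
    case (fields a b c)
    have "(a, b, c) = a *\<^sub>R (1, 0, 0) + b *\<^sub>R (0, 1, 0) + c *\<^sub>R (0, 0, 1 :: real)"
      by simp
    then have "partial (a, b, c) g p = partial (a *\<^sub>R (1, 0, 0) + b *\<^sub>R (0, 1, 0) + c *\<^sub>R (0, 0, 1)) g p"
      by (rule arg_cong[where f = "\<lambda>h. partial h g p"])
    also have "\<dots> = a * partial (1, 0, 0) g p + b * partial (0, 1, 0) g p + c * partial (0, 0, 1) g p"
      by (simp only: partial_linear[OF assms] real_scaleR_def)
    finally show ?thesis by (simp add: fields)
  qed
  then show ?thesis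
    by (intro has_derivative_eq_rhs[OF has_derivative_partial[OF assms]] ext)
qed

text \<open>Both sides obey the same sum, product and inversion rules, so agreement on the jet
  coordinates, where it is the raising of a multi-index, spreads to all rational functions.\<close>

lemma on_system_has_derivative:
  assumes F: "regular_jets_on F D" and "\<phi> \<in> rational_jet_functions" "p \<in> D"
  shows "(on_system \<phi> F has_derivative (\<lambda>h. fst h * on_system (d_x \<phi>) F p
     + fst (snd h) * on_system (d_u \<phi>) F p + snd (snd h) * on_system (d_u1 \<phi>) F p)) (at p)"
  using assms(2,3)
proof (induction arbitrary: p)
  case (const c)
  then show ?case by (simp add: on_system_def total_derivative_rules)
next
  case (coordinate \<phi>)
  have S: "smooth_on D F" using F by (simp add: regular_jets_on_def)
  from coordinate show ?case unfolding jet_coordinates_def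
  proof (elim UnE insertE emptyE CollectE exE conjE)
    show ?thesis if "\<phi> = jet_f a b c" for a b c
      using point_has_derivativeI[OF smooth_on_differentiable[OF smooth_on_mixed_partial[OF S] coordinate.prems], of a b c]
      by (simp add: that total_derivative_coordinates on_system_coordinates partial_mixed_partial[OF S coordinate.prems])
  qed (simp_all add: total_derivative_coordinates on_system_coordinates,
       auto simp: on_system_def intro!: derivative_eq_intros)
next
  case (add \<phi> \<psi>)
  then have "regular_jet (infinite_jet F p)" using F by (simp add: regular_jets_on_def)
  with has_derivative_add[OF add.IH(1)[OF add.prems] add.IH(2)[OF add.prems]] add.hyps show ?case
    by (simp add: on_system_def total_derivative_rules algebra_simps)
next
  case (mult \<phi> \<psi>)
  then have "regular_jet (infinite_jet F p)" using F by (simp add: regular_jets_on_def)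
  with has_derivative_mult[OF mult.IH(1)[OF mult.prems] mult.IH(2)[OF mult.prems]] mult.hyps show ?case
    by (simp add: on_system_def total_derivative_rules algebra_simps)
next
  case (inverse \<phi>)
  then have r: "regular_jet (infinite_jet F p)" using F by (simp add: regular_jets_on_def)
  then have nz: "on_system \<phi> F p \<noteq> 0" using inverse.hyps by (simp add: on_system_def)
  have "(\<lambda>h. - (inverse (on_system \<phi> F p) * (fst h * on_system (d_x \<phi>) F p
     + fst (snd h) * on_system (d_u \<phi>) F p + snd (snd h) * on_system (d_u1 \<phi>) F p) * inverse (on_system \<phi> F p)))
     = (\<lambda>h. fst h * on_system (d_x (\<lambda>\<theta>. inverse (\<phi> \<theta>))) F p
     + fst (snd h) * on_system (d_u (\<lambda>\<theta>. inverse (\<phi> \<theta>))) F p + snd (snd h) * on_system (d_u1 (\<lambda>\<theta>. inverse (\<phi> \<theta>))) F p)"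
    using nz unfolding on_system_def total_derivative_inverse[OF inverse.hyps(1) r nz[unfolded on_system_def]]
    by (intro ext) (simp add: field_simps power2_eq_square)
  with Deriv.has_derivative_inverse[OF nz inverse.IH[OF inverse.prems]] show ?case
    by (simp add: on_system_def)
next
  case (cong \<phi> \<psi>)
  have D: "open D" using F smooth_on_open by (auto simp: regular_jets_on_def)
  have r: "regular_jet (infinite_jet F q)" if "q \<in> D" for q using F that by (simp add: regular_jets_on_def)
  have "on_system (total_derivative e \<psi>) F p = on_system (total_derivative e \<phi>) F p" for e
    unfolding on_system_def using total_derivative_cong[OF cong.hyps(2) r[OF cong.prems]] .
  with cong.IH[OF cong.prems] show ?case
    by (simp only:) (erule has_derivative_transform_within_open[OF _ D cong.prems],
        simp add: on_system_def cong.hyps(2) r)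
qed

text \<open>The coefficients of the derivative come from total derivatives of \<open>\<phi>\<close>,
  which are again rational, so an induction on the order that treats all \<open>\<phi>\<close> at
  once succeeds.\<close>

lemma smooth_on_system:
  assumes F: "regular_jets_on F D" and "\<phi> \<in> rational_jet_functions"
  shows "smooth_on D (on_system \<phi> F)"
proof -
  have D: "open D" using F smooth_on_open by (auto simp: regular_jets_on_def)
  have "differentiable_upto n D (on_system \<phi> F)" if "\<phi> \<in> rational_jet_functions" for n \<phi>
    using that
  proof (induction n arbitrary: \<phi>)
    case 0
    then show ?case
      using D differentiableI[OF on_system_has_derivative[OF F 0]]
      by (simp add: differentiable_on_eq_differentiable_at)
  next
    case (Suc n)
    have IH: "differentiable_upto n D (\<lambda>p. c * on_system (total_derivative e \<phi>) F p)" for c e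
      using differentiable_upto_scaleR[OF D differentiable_upto_const[OF D] Suc.IH[OF total_derivative_rational[OF Suc.prems]]]
      by simp
    show ?case
      by (rule differentiable_upto_SucI[OF D on_system_has_derivative[OF F Suc.prems]])
        (auto intro!: differentiable_upto_add[OF D] IH)
  qed
  then show ?thesis using assms D by (simp add: smooth_on_iff)
qed

section \<open>Structure equations of the invariant frame\<close>

text \<open>Write q, p, w1, w3, b for the five functions defined here. They are the components of
  the frame: \<open>nabla1\<close> is p d/du + w1 d/du1, \<open>nabla2\<close> is q d/du1, and
  \<open>nabla3\<close> is f d/dx + q d/du + w3 d/du1. As p + q = u1, the sum of the first and third
  is f d/dx + u1 d/du + b d/du1.\<close>

definition coef_q :: "jet \<Rightarrow> real" where "coef_q \<theta> = jet_f 0 0 0 \<theta> / jet_f 0 0 1 \<theta>"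

definition coef_p :: "jet \<Rightarrow> real" where "coef_p \<theta> = jet_u1 \<theta> - coef_q \<theta>"

definition coef_w1 :: "jet \<Rightarrow> real" where
  "coef_w1 \<theta> = (coef_q \<theta> - jet_u1 \<theta>) * jet_f 0 1 0 \<theta> / jet_f 0 0 1 \<theta>"

definition coef_b :: "jet \<Rightarrow> real" where
  "coef_b \<theta> = (jet_f 1 0 0 \<theta> * jet_f 0 0 1 \<theta> + jet_f 0 1 0 \<theta> - jet_u1 \<theta> * jet_f 0 1 1 \<theta>
     - jet_f 0 0 0 \<theta> * jet_f 1 0 1 \<theta>) / jet_f 0 0 2 \<theta>"

definition coef_w3 :: "jet \<Rightarrow> real" where "coef_w3 \<theta> = coef_b \<theta> - coef_w1 \<theta>"

lemma regular_jetD: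
  assumes "regular_jet \<theta>"
  shows "jet_f 0 0 0 \<theta> \<noteq> 0" "jet_f 0 0 (Suc 0) \<theta> \<noteq> 0" "jet_f 0 0 1 \<theta> \<noteq> 0" "jet_f 0 0 2 \<theta> \<noteq> 0"
    "jet_u1 \<theta> * jet_f 0 0 1 \<theta> - jet_f 0 0 0 \<theta> \<noteq> 0" "coef_q \<theta> \<noteq> 0" "coef_p \<theta> \<noteq> 0"
  using assms by (auto simp: regular_jet_def coef_q_def coef_p_def field_simps)

lemma coef_rational [rational_intros]:
  "coef_q \<in> rational_jet_functions" "coef_p \<in> rational_jet_functions" "coef_w1 \<in> rational_jet_functions"
  "coef_b \<in> rational_jet_functions" "coef_w3 \<in> rational_jet_functions"
proof -
  show q: "coef_q \<in> rational_jet_functions"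
    unfolding coef_q_def[abs_def] by (intro rational_intros regular_jetD)
  show "coef_p \<in> rational_jet_functions"
    unfolding coef_p_def[abs_def] by (intro rational_intros regular_jetD q)
  show w1: "coef_w1 \<in> rational_jet_functions"
    unfolding coef_w1_def[abs_def] by (intro rational_intros regular_jetD q)
  show b: "coef_b \<in> rational_jet_functions"
    unfolding coef_b_def[abs_def] by (intro rational_intros regular_jetD)
  show "coef_w3 \<in> rational_jet_functions"
    unfolding coef_w3_def[abs_def] by (intro rational_intros w1 b)
qed

lemma inv_J_rational [rational_intros]: "inv_J \<in> rational_jet_functions"
  unfolding inv_J_def[abs_def] Let_def by (intro rational_intros) (simp add: regular_jet_def)

lemma inv_J_nonzero: "regular_jet \<theta> \<Longrightarrow> inv_J \<theta> \<noteq> 0"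
  by (simp add: regular_jet_def inv_J_def Let_def)

lemma nabla_eq:
  assumes "regular_jet \<theta>"
  shows nabla1_eq: "nabla1 \<phi> \<theta> = coef_p \<theta> * d_u \<phi> \<theta> + coef_w1 \<theta> * d_u1 \<phi> \<theta>"
    and nabla2_eq: "nabla2 \<phi> \<theta> = coef_q \<theta> * d_u1 \<phi> \<theta>"
    and nabla3_eq: "nabla3 \<phi> \<theta> = jet_f 0 0 0 \<theta> * d_x \<phi> \<theta> + coef_q \<theta> * d_u \<phi> \<theta> + coef_w3 \<theta> * d_u1 \<phi> \<theta>"
proof -
  note nz = regular_jetD[OF assms]
  have 1: "(jet_u1 \<theta> * jet_f 0 0 1 \<theta> - jet_f 0 0 0 \<theta>) / jet_f 0 0 1 \<theta> = coef_p \<theta>"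
    "(jet_f 0 0 0 \<theta> - jet_u1 \<theta> * jet_f 0 0 1 \<theta>) / (jet_f 0 0 1 \<theta>)\<^sup>2 * jet_f 0 1 0 \<theta> = coef_w1 \<theta>"
    "(jet_u1 \<theta> * jet_f 0 0 1 \<theta> - jet_f 0 0 0 \<theta>) / (jet_f 0 0 1 \<theta>)\<^sup>2 * jet_f 0 1 0 \<theta> = - coef_w1 \<theta>"
    unfolding coef_p_def coef_w1_def coef_q_def using nz
    by (simp_all add: field_simps power2_eq_square del: One_nat_def)
  show "nabla1 \<phi> \<theta> = coef_p \<theta> * d_u \<phi> \<theta> + coef_w1 \<theta> * d_u1 \<phi> \<theta>"
    unfolding nabla1_def Let_def 1 by simp
  show "nabla2 \<phi> \<theta> = coef_q \<theta> * d_u1 \<phi> \<theta>"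
    unfolding nabla2_def Let_def coef_q_def by simp
  show "nabla3 \<phi> \<theta> = jet_f 0 0 0 \<theta> * d_x \<phi> \<theta> + coef_q \<theta> * d_u \<phi> \<theta> + coef_w3 \<theta> * d_u1 \<phi> \<theta>"
    unfolding nabla3_def Let_def 1 coef_w3_def coef_b_def coef_q_def by simp
qed

lemma nabla_rational [rational_intros]:
  assumes "\<phi> \<in> rational_jet_functions"
  shows "nabla1 \<phi> \<in> rational_jet_functions" "nabla2 \<phi> \<in> rational_jet_functions"
    "nabla3 \<phi> \<in> rational_jet_functions"
  using nabla_eq
  by (auto intro!: rational_intros assms rational_jet_functions.cong[of "\<lambda>\<theta>. coef_p \<theta> * d_u \<phi> \<theta> + coef_w1 \<theta> * d_u1 \<phi> \<theta>" "nabla1 \<phi>"]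
    rational_jet_functions.cong[of "\<lambda>\<theta>. coef_q \<theta> * d_u1 \<phi> \<theta>" "nabla2 \<phi>"]
    rational_jet_functions.cong[of "\<lambda>\<theta>. jet_f 0 0 0 \<theta> * d_x \<phi> \<theta> + coef_q \<theta> * d_u \<phi> \<theta> + coef_w3 \<theta> * d_u1 \<phi> \<theta>" "nabla3 \<phi>"])

text \<open>Permits differentiating an identity that is known only at regular jets.\<close>

lemma nabla_cong:
  assumes "\<And>\<theta>. regular_jet \<theta> \<Longrightarrow> \<psi> \<theta> = \<phi> \<theta>" "regular_jet \<theta>"
  shows "nabla1 \<psi> \<theta> = nabla1 \<phi> \<theta>" "nabla2 \<psi> \<theta> = nabla2 \<phi> \<theta>" "nabla3 \<psi> \<theta> = nabla3 \<phi> \<theta>"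
proof -
  have "total_derivative e \<psi> \<theta> = total_derivative e \<phi> \<theta>" for e
    by (rule total_derivative_cong[OF assms])
  then show "nabla1 \<psi> \<theta> = nabla1 \<phi> \<theta>" "nabla2 \<psi> \<theta> = nabla2 \<phi> \<theta>" "nabla3 \<psi> \<theta> = nabla3 \<phi> \<theta>"
    unfolding nabla_eq[OF assms(2)] by simp_all
qed

lemma nabla_diff_mult:
  assumes "\<phi> \<in> rational_jet_functions" "\<psi> \<in> rational_jet_functions" "regular_jet \<theta>"
  shows "nabla1 (\<lambda>\<theta>. \<phi> \<theta> - \<psi> \<theta>) \<theta> = nabla1 \<phi> \<theta> - nabla1 \<psi> \<theta>"
    "nabla2 (\<lambda>\<theta>. \<phi> \<theta> - \<psi> \<theta>) \<theta> = nabla2 \<phi> \<theta> - nabla2 \<psi> \<theta>"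
    "nabla3 (\<lambda>\<theta>. \<phi> \<theta> - \<psi> \<theta>) \<theta> = nabla3 \<phi> \<theta> - nabla3 \<psi> \<theta>"
    "nabla1 (\<lambda>\<theta>. \<phi> \<theta> * \<psi> \<theta>) \<theta> = nabla1 \<phi> \<theta> * \<psi> \<theta> + \<phi> \<theta> * nabla1 \<psi> \<theta>"
    "nabla2 (\<lambda>\<theta>. \<phi> \<theta> * \<psi> \<theta>) \<theta> = nabla2 \<phi> \<theta> * \<psi> \<theta> + \<phi> \<theta> * nabla2 \<psi> \<theta>"
    "nabla3 (\<lambda>\<theta>. \<phi> \<theta> * \<psi> \<theta>) \<theta> = nabla3 \<phi> \<theta> * \<psi> \<theta> + \<phi> \<theta> * nabla3 \<psi> \<theta>"
  unfolding nabla_eq[OF assms(3)] total_derivative_diff[OF assms(1,3,2)] total_derivative_mult[OF assms(1,3,2)]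
  by (simp_all add: algebra_simps)

lemma total_derivative_coef_q:
  assumes "regular_jet \<theta>"
  shows "total_derivative (a, b, c) coef_q \<theta>
    = (jet_f a b c \<theta> * jet_f 0 0 1 \<theta> - jet_f 0 0 0 \<theta> * jet_f a b (1 + c) \<theta>) / (jet_f 0 0 1 \<theta>)\<^sup>2"
  unfolding coef_q_def[abs_def]
  by (subst total_derivative_divide)
    (simp_all add: rational_intros assms regular_jetD[OF assms] total_derivative_coordinates del: One_nat_def)

lemma total_derivative_coef_p:
  assumes "regular_jet \<theta>"
  shows "total_derivative (a, b, c) coef_p \<theta> = real c - total_derivative (a, b, c) coef_q \<theta>"
  unfolding coef_p_def[abs_def]
  by (subst total_derivative_diff) (simp_all add: rational_intros assms total_derivative_coordinates)

lemma total_derivative_coef_w1: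
  assumes "regular_jet \<theta>"
  shows "total_derivative (a, b, c) coef_w1 \<theta>
    = (((total_derivative (a, b, c) coef_q \<theta> - real c) * jet_f 0 1 0 \<theta> - coef_p \<theta> * jet_f a (1 + b) c \<theta>) * jet_f 0 0 1 \<theta>
       + coef_p \<theta> * jet_f 0 1 0 \<theta> * jet_f a b (1 + c) \<theta>) / (jet_f 0 0 1 \<theta>)\<^sup>2"
  unfolding coef_w1_def[abs_def]
  by (simp add: rational_intros assms regular_jetD[OF assms] total_derivative_coordinates
      total_derivative_divide total_derivative_mult total_derivative_diff coef_p_def algebra_simps
      del: One_nat_def)

lemma jet_plus_simps: "1 + (0::nat) = 1" "0 + (1::nat) = 1" "1 + (1::nat) = 2" "0 + (0::nat) = 0"
  by simp_all

text \<open>These are components of the three brackets: for instance, the d/du component of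
  [\<open>nabla1\<close>, \<open>nabla2\<close>] is minus \<open>nabla2 coef_p\<close>. The d/du1
  components of the other two brackets are absent because they define \<open>inv_K\<close> and
  \<open>struct_b\<close>.\<close>

lemma nabla_coef:
  assumes \<theta>: "regular_jet \<theta>"
  shows "nabla1 (jet_f 0 0 0) \<theta> = 0"
    and "nabla2 (jet_f 0 0 0) \<theta> = jet_f 0 0 0 \<theta>"
    and "nabla2 coef_p \<theta> = inv_J \<theta> * coef_p \<theta>"
    and "nabla2 coef_q \<theta> = coef_q \<theta> - inv_J \<theta> * coef_p \<theta>"
    and "nabla3 coef_p \<theta> = nabla1 coef_q \<theta>"
    and "nabla1 coef_q \<theta> - nabla2 coef_w1 \<theta> = - inv_J \<theta> * coef_w1 \<theta>"
proof -
  note nz = regular_jetD(1,3,4,5)[OF \<theta>]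
  note rules = nabla_eq[OF \<theta>] total_derivative_coef_w1[OF \<theta>] total_derivative_coef_p[OF \<theta>] total_derivative_coef_q[OF \<theta>]
    total_derivative_coordinates inv_J_def Let_def coef_w3_def coef_b_def coef_w1_def coef_p_def coef_q_def
    jet_plus_simps of_nat_0 of_nat_1
  \<comment> \<open>Fresh names for the jet coordinates reduce each claim to a rational identity in
    eight unknowns.\<close>
  obtain f where f: "f = jet_f 0 0 0 \<theta>" by simp
  obtain fx where fx: "fx = jet_f 1 0 0 \<theta>" by simp
  obtain fu where fu: "fu = jet_f 0 1 0 \<theta>" by simp
  obtain fw where fw: "fw = jet_f 0 0 1 \<theta>" by simp
  obtain fxw where fxw: "fxw = jet_f 1 0 1 \<theta>" by simp
  obtain fuw where fuw: "fuw = jet_f 0 1 1 \<theta>" by simp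
  obtain fww where fww: "fww = jet_f 0 0 2 \<theta>" by simp
  obtain w where w: "w = jet_u1 \<theta>" by simp
  note vars = f[symmetric] fx[symmetric] fu[symmetric] fw[symmetric] fxw[symmetric] fuw[symmetric] fww[symmetric] w[symmetric]
  note nz = nz[unfolded vars]
  show "nabla1 (jet_f 0 0 0) \<theta> = 0" "nabla2 (jet_f 0 0 0) \<theta> = jet_f 0 0 0 \<theta>"
    unfolding rules vars using nz by (simp_all add: field_simps)
  show "nabla2 coef_p \<theta> = inv_J \<theta> * coef_p \<theta>"
    unfolding rules vars using nz by (simp add: divide_simps) (simp add: algebra_simps power2_eq_square)
  show "nabla2 coef_q \<theta> = coef_q \<theta> - inv_J \<theta> * coef_p \<theta>"
    unfolding rules vars using nz by (simp add: divide_simps) (simp add: algebra_simps power2_eq_square)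
  show "nabla3 coef_p \<theta> = nabla1 coef_q \<theta>"
    unfolding rules vars using nz by (simp add: divide_simps) (simp add: algebra_simps power2_eq_square)
  show "nabla1 coef_q \<theta> - nabla2 coef_w1 \<theta> = - inv_J \<theta> * coef_w1 \<theta>"
    unfolding rules vars using nz by (simp add: divide_simps) (simp add: algebra_simps power2_eq_square)
qed

text \<open>On coordinates total derivatives commute simply because additions of multi-indices do,
  so the second order terms cancel. By \<open>nabla_coef\<close> the remaining d/dx and d/du terms
  vanish too, and d/du1 is a multiple of \<open>nabla2\<close>.\<close>

lemma commutator_coordinates:
  assumes "\<phi> \<in> jet_coordinates" and \<theta>: "regular_jet \<theta>"
  shows "nabla3 (nabla1 \<phi>) \<theta> - nabla1 (nabla3 \<phi>) \<theta>
    = (nabla3 coef_w1 \<theta> - nabla1 coef_w3 \<theta>) / coef_q \<theta> * nabla2 \<phi> \<theta>"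
proof -
  have \<phi>: "\<phi> \<in> rational_jet_functions"
    using assms(1) by (rule rational_jet_functions.coordinate)
  note d = total_derivative_rational[OF \<phi>]
  have comm: "total_derivative e (total_derivative e' \<phi>) = total_derivative e' (total_derivative e \<phi>)" for e e'
    using assms(1) unfolding jet_coordinates_def
    by (cases e; cases e') (auto simp: total_derivative_coordinates total_derivative_const[abs_def] ac_simps)
  have add: "nabla1 (\<lambda>\<theta>. \<psi>1 \<theta> + \<psi>2 \<theta>) \<theta> = nabla1 \<psi>1 \<theta> + nabla1 \<psi>2 \<theta>"
    "nabla3 (\<lambda>\<theta>. \<psi>1 \<theta> + \<psi>2 \<theta>) \<theta> = nabla3 \<psi>1 \<theta> + nabla3 \<psi>2 \<theta>"
    if "\<psi>1 \<in> rational_jet_functions" "\<psi>2 \<in> rational_jet_functions" for \<psi>1 \<psi>2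
    unfolding nabla_eq[OF \<theta>] total_derivative_add[OF that(1) \<theta> that(2)] by (simp_all add: algebra_simps)
  have 31: "nabla3 (nabla1 \<phi>) \<theta> = nabla3 coef_p \<theta> * d_u \<phi> \<theta> + coef_p \<theta> * nabla3 (d_u \<phi>) \<theta>
      + (nabla3 coef_w1 \<theta> * d_u1 \<phi> \<theta> + coef_w1 \<theta> * nabla3 (d_u1 \<phi>) \<theta>)"
  proof -
    have "nabla3 (nabla1 \<phi>) \<theta> = nabla3 (\<lambda>\<theta>. coef_p \<theta> * d_u \<phi> \<theta> + coef_w1 \<theta> * d_u1 \<phi> \<theta>) \<theta>"
      by (rule nabla_cong(3)[OF _ \<theta>]) (rule nabla1_eq)
    then show ?thesis by (simp only: add nabla_diff_mult rational_intros d \<theta>)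
  qed
  have 13: "nabla1 (nabla3 \<phi>) \<theta> = (nabla1 (jet_f 0 0 0) \<theta> * d_x \<phi> \<theta> + jet_f 0 0 0 \<theta> * nabla1 (d_x \<phi>) \<theta>)
      + (nabla1 coef_q \<theta> * d_u \<phi> \<theta> + coef_q \<theta> * nabla1 (d_u \<phi>) \<theta>)
      + (nabla1 coef_w3 \<theta> * d_u1 \<phi> \<theta> + coef_w3 \<theta> * nabla1 (d_u1 \<phi>) \<theta>)"
  proof -
    have "nabla1 (nabla3 \<phi>) \<theta> = nabla1 (\<lambda>\<theta>. jet_f 0 0 0 \<theta> * d_x \<phi> \<theta> + coef_q \<theta> * d_u \<phi> \<theta>
        + coef_w3 \<theta> * d_u1 \<phi> \<theta>) \<theta>"
      by (rule nabla_cong(1)[OF _ \<theta>]) (rule nabla3_eq)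
    then show ?thesis by (simp only: add nabla_diff_mult rational_intros d \<theta>)
  qed
  have "coef_p \<theta> * nabla3 (d_u \<phi>) \<theta> + coef_w1 \<theta> * nabla3 (d_u1 \<phi>) \<theta>
      = jet_f 0 0 0 \<theta> * nabla1 (d_x \<phi>) \<theta> + coef_q \<theta> * nabla1 (d_u \<phi>) \<theta> + coef_w3 \<theta> * nabla1 (d_u1 \<phi>) \<theta>"
    unfolding nabla_eq[OF \<theta>] comm[of "(0, 1, 0)" "(1, 0, 0)"] comm[of "(0, 0, 1)" "(1, 0, 0)"]
      comm[of "(0, 0, 1)" "(0, 1, 0)"]
    by (simp add: algebra_simps)
  then have "nabla3 (nabla1 \<phi>) \<theta> - nabla1 (nabla3 \<phi>) \<theta> = (nabla3 coef_w1 \<theta> - nabla1 coef_w3 \<theta>) * d_u1 \<phi> \<theta>"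
    unfolding 31 13 nabla_coef[OF \<theta>] by (simp add: algebra_simps)
  then show ?thesis
    unfolding nabla2_eq[OF \<theta>] using regular_jetD(6)[OF \<theta>] by simp
qed

text \<open>The definite description has only one solution because \<open>nabla2\<close> does not
  kill the coordinate \<open>u1\<close>: it takes it to \<open>coef_q\<close>.\<close>

lemma inv_K_eq:
  assumes "regular_jet \<theta>"
  shows "inv_K \<theta> = (nabla3 coef_w1 \<theta> - nabla1 coef_w3 \<theta>) / coef_q \<theta>"
  unfolding inv_K_def
proof (rule the_equality)
  show "\<forall>\<phi>\<in>jet_coordinates. nabla3 (nabla1 \<phi>) \<theta> - nabla1 (nabla3 \<phi>) \<theta>
      = (nabla3 coef_w1 \<theta> - nabla1 coef_w3 \<theta>) / coef_q \<theta> * nabla2 \<phi> \<theta>"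
    using commutator_coordinates[OF _ assms] by blast
next
  fix \<kappa> assume "\<forall>\<phi>\<in>jet_coordinates. nabla3 (nabla1 \<phi>) \<theta> - nabla1 (nabla3 \<phi>) \<theta> = \<kappa> * nabla2 \<phi> \<theta>"
  moreover have u1: "jet_u1 \<in> jet_coordinates" by (simp add: jet_coordinates_def)
  ultimately have "\<kappa> * nabla2 jet_u1 \<theta> = (nabla3 coef_w1 \<theta> - nabla1 coef_w3 \<theta>) / coef_q \<theta> * nabla2 jet_u1 \<theta>"
    using commutator_coordinates[OF u1 assms] by metis
  moreover have "nabla2 jet_u1 \<theta> \<noteq> 0"
    unfolding nabla2_eq[OF assms] total_derivative_coordinates using regular_jetD(6)[OF assms] by simp
  ultimately show "\<kappa> = (nabla3 coef_w1 \<theta> - nabla1 coef_w3 \<theta>) / coef_q \<theta>" by (metis mult_right_cancel)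
qed

lemma inv_K_rational [rational_intros]: "inv_K \<in> rational_jet_functions"
  by (rule rational_jet_functions.cong[OF _ inv_K_eq]) (intro rational_intros regular_jetD)

text \<open>The coefficient of \<open>\<nabla>\<^sub>2\<close> in \<open>[\<nabla>\<^sub>2, \<nabla>\<^sub>3] = \<nabla>\<^sub>3 - J \<nabla>\<^sub>1 + b \<nabla>\<^sub>2\<close>.\<close>

definition struct_b :: "jet \<Rightarrow> real" where
  "struct_b \<theta> = (nabla2 coef_w3 \<theta> - nabla3 coef_q \<theta> - coef_w3 \<theta> + inv_J \<theta> * coef_w1 \<theta>) / coef_q \<theta>"

section \<open>The frame as vector fields on the domain of a system\<close>

definition frame1 :: "(point \<Rightarrow> real) \<Rightarrow> point \<Rightarrow> point" where
  "frame1 F p = (0, on_system coef_p F p, on_system coef_w1 F p)"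

definition frame2 :: "(point \<Rightarrow> real) \<Rightarrow> point \<Rightarrow> point" where
  "frame2 F p = (0, 0, on_system coef_q F p)"

definition frame3 :: "(point \<Rightarrow> real) \<Rightarrow> point \<Rightarrow> point" where
  "frame3 F p = (on_system (jet_f 0 0 0) F p, on_system coef_q F p, on_system coef_w3 F p)"

lemma regular_jets_onD:
  assumes "regular_jets_on F D"
  shows "smooth_on D F" "open D" "p \<in> D \<Longrightarrow> regular_jet (infinite_jet F p)"
  using assms smooth_on_open by (auto simp: regular_jets_on_def)

lemma on_system_nabla:
  assumes F: "regular_jets_on F D" and \<phi>: "\<phi> \<in> rational_jet_functions" and p: "p \<in> D"
  shows "on_system (nabla1 \<phi>) F p = partial (frame1 F p) (on_system \<phi> F) p"
    and "on_system (nabla2 \<phi>) F p = partial (frame2 F p) (on_system \<phi> F) p"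
    and "on_system (nabla3 \<phi>) F p = partial (frame3 F p) (on_system \<phi> F) p"
  unfolding partial_eqI[OF on_system_has_derivative[OF F \<phi> p]] frame1_def frame2_def frame3_def
  by (simp_all add: on_system_def nabla_eq[OF regular_jets_onD(3)[OF F p]])

lemma frame_has_derivative:
  assumes F: "regular_jets_on F D" and p: "p \<in> D"
  shows "(frame1 F has_derivative (\<lambda>v. (0, partial v (on_system coef_p F) p, partial v (on_system coef_w1 F) p))) (at p)"
    and "(frame2 F has_derivative (\<lambda>v. (0, 0, partial v (on_system coef_q F) p))) (at p)"
    and "(frame3 F has_derivative (\<lambda>v. (partial v (on_system (jet_f 0 0 0) F) p, partial v (on_system coef_q F) p,
        partial v (on_system coef_w3 F) p))) (at p)"
  unfolding frame1_def[abs_def] frame2_def[abs_def] frame3_def[abs_def]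
  by (intro has_derivative_Pair has_derivative_const
      smooth_on_has_derivative[OF smooth_on_system[OF F] p] rational_intros)+

text \<open>The function \<open>h\<close> is arbitrary, not just the value of a jet function,
  because later it is the last component of a transformation or a coordinate of a chart.\<close>

lemma frame_commutators:
  assumes F: "regular_jets_on F D" and h: "smooth_on S h" and "S \<subseteq> D" and p: "p \<in> S"
  shows "partial (frame1 F p) (\<lambda>q. partial (frame2 F q) h q) p - partial (frame2 F p) (\<lambda>q. partial (frame1 F q) h q) p
      = - on_system inv_J F p * partial (frame1 F p) h p"
    and "partial (frame2 F p) (\<lambda>q. partial (frame3 F q) h q) p - partial (frame3 F p) (\<lambda>q. partial (frame2 F q) h q) p
      = partial (frame3 F p) h p - on_system inv_J F p * partial (frame1 F p) h p
        + on_system struct_b F p * partial (frame2 F p) h p"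
    and "partial (frame3 F p) (\<lambda>q. partial (frame1 F q) h q) p - partial (frame1 F p) (\<lambda>q. partial (frame3 F q) h q) p
      = on_system inv_K F p * partial (frame2 F p) h p"
proof -
  have pD: "p \<in> D" using assms by blast
  note \<theta> = regular_jets_onD(3)[OF F pD]
  note on_nabla = on_system_nabla[OF F _ pD, symmetric]
  note D = frame_has_derivative[OF F pD]
  note lin = partial_linear(1-3)[OF smooth_on_differentiable[OF h p], symmetric, unfolded real_scaleR_def]
  note nz = regular_jetD(6)[OF \<theta>]
  let ?J = "on_system inv_J F p" and ?K = "on_system inv_K F p" and ?b = "on_system struct_b F p"
  have 1: "(0, 0, partial (frame1 F p) (on_system coef_q F) p)
      - (0, partial (frame2 F p) (on_system coef_p F) p, partial (frame2 F p) (on_system coef_w1 F) p)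
      = (- ?J) *\<^sub>R frame1 F p"
    using nabla_coef[OF \<theta>] by (simp add: on_nabla rational_intros) (simp add: on_system_def frame1_def)
  show "partial (frame1 F p) (\<lambda>q. partial (frame2 F q) h q) p - partial (frame2 F p) (\<lambda>q. partial (frame1 F q) h q) p
      = - ?J * partial (frame1 F p) h p"
    unfolding commutator_along_fields[OF h p D(1,2)] 1 lin ..
  have 2: "(partial (frame2 F p) (on_system (jet_f 0 0 0) F) p, partial (frame2 F p) (on_system coef_q F) p,
        partial (frame2 F p) (on_system coef_w3 F) p) - (0, 0, partial (frame3 F p) (on_system coef_q F) p)
      = frame3 F p - ?J *\<^sub>R frame1 F p + ?b *\<^sub>R frame2 F p"
    using nabla_coef[OF \<theta>] nz
    by (simp add: on_nabla rational_intros) (simp add: on_system_def frame1_def frame2_def frame3_def struct_b_def)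
  show "partial (frame2 F p) (\<lambda>q. partial (frame3 F q) h q) p - partial (frame3 F p) (\<lambda>q. partial (frame2 F q) h q) p
      = partial (frame3 F p) h p - ?J * partial (frame1 F p) h p + ?b * partial (frame2 F p) h p"
    unfolding commutator_along_fields[OF h p D(2,3)] 2 lin ..
  have 3: "(0, partial (frame3 F p) (on_system coef_p F) p, partial (frame3 F p) (on_system coef_w1 F) p)
      - (partial (frame1 F p) (on_system (jet_f 0 0 0) F) p, partial (frame1 F p) (on_system coef_q F) p,
        partial (frame1 F p) (on_system coef_w3 F) p)
      = ?K *\<^sub>R frame2 F p"
    using nabla_coef[OF \<theta>] nz
    by (simp add: on_nabla rational_intros) (simp add: on_system_def frame2_def inv_K_eq[OF \<theta>])
  show "partial (frame3 F p) (\<lambda>q. partial (frame1 F q) h q) p - partial (frame1 F p) (\<lambda>q. partial (frame3 F q) h q) p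
      = ?K * partial (frame2 F p) h p"
    unfolding commutator_along_fields[OF h p D(3,1)] 3 lin ..
qed

lemma partial_on_system_nabla_cong:
  assumes F: "regular_jets_on F D" and \<phi>: "\<phi> \<in> rational_jet_functions" and p: "p \<in> D"
  shows "partial v (\<lambda>q. partial (frame1 F q) (on_system \<phi> F) q) p = partial v (on_system (nabla1 \<phi>) F) p"
    and "partial v (\<lambda>q. partial (frame2 F q) (on_system \<phi> F) q) p = partial v (on_system (nabla2 \<phi>) F) p"
    and "partial v (\<lambda>q. partial (frame3 F q) (on_system \<phi> F) q) p = partial v (on_system (nabla3 \<phi>) F) p"
  by (rule partial_cong[OF regular_jets_onD(2)[OF F] p], simp add: on_system_nabla[OF F \<phi>])+

lemma on_system_commutators:
  assumes F: "regular_jets_on F D" and \<phi>: "\<phi> \<in> rational_jet_functions" and p: "p \<in> D"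
  shows "on_system (nabla1 (nabla2 \<phi>)) F p - on_system (nabla2 (nabla1 \<phi>)) F p
      = - on_system inv_J F p * on_system (nabla1 \<phi>) F p"
    and "on_system (nabla2 (nabla3 \<phi>)) F p - on_system (nabla3 (nabla2 \<phi>)) F p
      = on_system (nabla3 \<phi>) F p - on_system inv_J F p * on_system (nabla1 \<phi>) F p
        + on_system struct_b F p * on_system (nabla2 \<phi>) F p"
    and "on_system (nabla3 (nabla1 \<phi>)) F p - on_system (nabla1 (nabla3 \<phi>)) F p
      = on_system inv_K F p * on_system (nabla2 \<phi>) F p"
  using frame_commutators[OF F smooth_on_system[OF F \<phi>] order_refl p]
  by (simp_all only: partial_on_system_nabla_cong[OF F \<phi> p] on_system_nabla[OF F _ p] rational_intros \<phi>)

text \<open>The Jacobi identity of the frame, evaluated on the coordinate \<open>u\<close>.\<close>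

lemma struct_b_eq:
  assumes F: "regular_jets_on F D" and p: "p \<in> D"
  shows "on_system struct_b F p
    = - (on_system (nabla1 inv_J) F p + on_system (nabla3 inv_J) F p) / on_system inv_J F p"
proof -
  let ?\<theta> = "infinite_jet F p"
  note \<theta> = regular_jets_onD(3)[OF F p]
  \<comment> \<open>\<open>coef_p\<close> and \<open>coef_q\<close> are \<open>nabla1\<close> and
    \<open>nabla3\<close> applied to \<open>u\<close>, while \<open>nabla2\<close> kills
    \<open>u\<close>. Their known derivatives are differentiated once more and compared through the
    brackets.\<close>
  have 12: "nabla1 (nabla2 coef_q) ?\<theta> = nabla1 coef_q ?\<theta>
      - (nabla1 inv_J ?\<theta> * coef_p ?\<theta> + inv_J ?\<theta> * nabla1 coef_p ?\<theta>)"
  proof -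
    have "nabla1 (nabla2 coef_q) ?\<theta> = nabla1 (\<lambda>\<theta>. coef_q \<theta> - inv_J \<theta> * coef_p \<theta>) ?\<theta>"
      by (rule nabla_cong(1)[OF _ \<theta>]) (rule nabla_coef)
    then show ?thesis by (simp only: nabla_diff_mult rational_intros \<theta>)
  qed
  have 32: "nabla3 (nabla2 coef_p) ?\<theta> = nabla3 inv_J ?\<theta> * coef_p ?\<theta> + inv_J ?\<theta> * nabla3 coef_p ?\<theta>"
  proof -
    have "nabla3 (nabla2 coef_p) ?\<theta> = nabla3 (\<lambda>\<theta>. inv_J \<theta> * coef_p \<theta>) ?\<theta>"
      by (rule nabla_cong(3)[OF _ \<theta>]) (rule nabla_coef)
    then show ?thesis by (simp only: nabla_diff_mult rational_intros \<theta>)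
  qed
  have 23: "nabla2 (nabla3 coef_p) ?\<theta> = nabla2 (nabla1 coef_q) ?\<theta>"
    by (rule nabla_cong(2)[OF _ \<theta>]) (rule nabla_coef)
  have q: "nabla1 (nabla2 coef_q) ?\<theta> - nabla2 (nabla1 coef_q) ?\<theta> = - inv_J ?\<theta> * nabla1 coef_q ?\<theta>"
    using on_system_commutators(1)[OF F _ p, of coef_q] by (simp add: rational_intros on_system_def)
  have p: "nabla2 (nabla3 coef_p) ?\<theta> - nabla3 (nabla2 coef_p) ?\<theta> = nabla3 coef_p ?\<theta>
      - inv_J ?\<theta> * nabla1 coef_p ?\<theta> + struct_b ?\<theta> * nabla2 coef_p ?\<theta>"
    using on_system_commutators(2)[OF F _ p, of coef_p] by (simp add: rational_intros on_system_def)
  have "coef_p ?\<theta> * (struct_b ?\<theta> * inv_J ?\<theta> + nabla1 inv_J ?\<theta> + nabla3 inv_J ?\<theta>) = 0"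
    using p q unfolding 12 32 23 nabla_coef(3,5)[OF \<theta>] by (simp add: algebra_simps)
  then have "struct_b ?\<theta> * inv_J ?\<theta> + nabla1 inv_J ?\<theta> + nabla3 inv_J ?\<theta> = 0"
    using regular_jetD(7)[OF \<theta>] by simp
  then show ?thesis
    using inv_J_nonzero[OF \<theta>] unfolding on_system_def by (simp add: field_simps)
qed

section \<open>Invariance under feedback transformations\<close>

abbreviation e_x :: point where "e_x \<equiv> (1, 0, 0)"
abbreviation e_u :: point where "e_u \<equiv> (0, 1, 0)"
abbreviation e_w :: point where "e_w \<equiv> (0, 0, 1)"

lemma partial_rules:
  fixes f g :: "'a::real_normed_vector \<Rightarrow> real"
  assumes "f differentiable at p" "g differentiable at p"
  shows "partial v (\<lambda>p. f p + g p) p = partial v f p + partial v g p"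
    and "partial v (\<lambda>p. f p * g p) p = partial v f p * g p + f p * partial v g p"
  using partial_eqI[OF has_derivative_add[OF assms[THEN has_derivative_partial]]]
    partial_eqI[OF has_derivative_mult[OF assms[THEN has_derivative_partial]]]
  by simp_all

lemma partial_point:
  fixes g :: "point \<Rightarrow> real"
  assumes "g differentiable at p"
  shows "partial v g p = fst v * partial e_x g p + fst (snd v) * partial e_u g p + snd (snd v) * partial e_w g p"
  by (rule partial_eqI[OF point_has_derivativeI[OF assms]])

lemma jet_values:
  "jet_u1 (infinite_jet F p) = snd (snd p)" "jet_f 0 0 0 (infinite_jet F p) = F p"
  "jet_f 1 0 0 (infinite_jet F p) = partial e_x F p" "jet_f 0 1 0 (infinite_jet F p) = partial e_u F p"
  "jet_f 0 0 1 (infinite_jet F p) = partial e_w F p" "jet_f 1 0 1 (infinite_jet F p) = partial e_x (partial e_w F) p"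
  "jet_f 0 1 1 (infinite_jet F p) = partial e_u (partial e_w F) p"
  "jet_f 0 0 2 (infinite_jet F p) = partial e_w (partial e_w F) p"
  by (simp_all add: infinite_jet_def jet_u1_def jet_f_def mixed_partial_def numeral_2_eq_2 case_prod_unfold)

lemma regular_jet_infinite_jet:
  "regular_jet (infinite_jet F p) \<longleftrightarrow> F p \<noteq> 0 \<and> partial e_w F p \<noteq> 0 \<and> partial e_w (partial e_w F) p \<noteq> 0 \<and>
    snd (snd p) * partial e_w F p - F p \<noteq> 0"
  unfolding regular_jet_def jet_values ..

lemma coef_values:
  "coef_q (infinite_jet F p) = F p / partial e_w F p"
  "coef_p (infinite_jet F p) = snd (snd p) - F p / partial e_w F p"
  "coef_w1 (infinite_jet F p) = (F p / partial e_w F p - snd (snd p)) * partial e_u F p / partial e_w F p"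
  "coef_b (infinite_jet F p) = (partial e_x F p * partial e_w F p + partial e_u F p
     - snd (snd p) * partial e_u (partial e_w F) p - F p * partial e_x (partial e_w F) p) / partial e_w (partial e_w F) p"
  unfolding coef_p_def coef_q_def coef_w1_def coef_b_def jet_values by simp_all

text \<open>A feedback transformation written on the space of \<open>(x, u, u\<^sub>1)\<close>, so that all its data are
  functions on the same domain.\<close>

locale prolonged_feedback =
  fixes F G :: "point \<Rightarrow> real" and DF N :: "point set" and X U W :: "point \<Rightarrow> real"
  assumes F: "smooth_on DF F" and G: "smooth_on N G" and X: "smooth_on N X" and U: "smooth_on N U"
    and X_u: "r \<in> N \<Longrightarrow> partial e_u X r = 0" and X_w: "r \<in> N \<Longrightarrow> partial e_w X r = 0"
    and U_w: "r \<in> N \<Longrightarrow> partial e_w U r = 0"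
    and W_eq: "r \<in> N \<Longrightarrow> W r = partial e_x U r * G r + partial e_u U r * snd (snd r)"
    and maps: "r \<in> N \<Longrightarrow> (X r, U r, W r) \<in> DF"
    and F_eq: "r \<in> N \<Longrightarrow> F (X r, U r, W r) = partial e_x X r * G r"
    and X_x_nonzero: "r \<in> N \<Longrightarrow> partial e_x X r \<noteq> 0" and U_u_nonzero: "r \<in> N \<Longrightarrow> partial e_u U r \<noteq> 0"
begin

abbreviation "map_to r \<equiv> (X r, U r, W r)"

lemma N: "open N" using G by (rule smooth_on_open)

lemma differentiable_at:
  assumes "r \<in> N"
  shows "G differentiable at r" "X differentiable at r" "U differentiable at r"
    "partial v G differentiable at r" "partial v X differentiable at r" "partial v U differentiable at r"
    "(\<lambda>r. snd (snd r) :: real) differentiable at r"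
  using assms smooth_on_differentiable smooth_on_partial G X U
  by (blast, blast, blast, blast, blast, blast)
    (intro differentiableI derivative_eq_intros | rule refl)+

lemma W: "smooth_on N W"
  by (rule smooth_on_cong[OF _ W_eq[symmetric]])
    (intro smooth_intros smooth_on_partial G U N)

lemma partial_zero_on:
  assumes "\<And>q. q \<in> N \<Longrightarrow> f q = 0" "r \<in> N"
  shows "partial v f r = 0"
  using partial_cong[OF N assms(2), of f "\<lambda>_. 0" v] assms(1) partial_eqI[OF has_derivative_const[of 0 "at r"], of v]
  by simp

lemma second_order:
  assumes r: "r \<in> N"
  shows "partial e_u (partial e_x X) r = 0" "partial e_w (partial e_x X) r = 0"
    "partial e_w (partial e_x U) r = 0" "partial e_w (partial e_u U) r = 0"
    "partial e_x (partial e_u U) r = partial e_u (partial e_x U) r"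
proof -
  show "partial e_u (partial e_x X) r = 0"
    unfolding partial_commute[OF X r, of e_u e_x] by (rule partial_zero_on[OF X_u r])
  show "partial e_w (partial e_x X) r = 0"
    unfolding partial_commute[OF X r, of e_w e_x] by (rule partial_zero_on[OF X_w r])
  show "partial e_w (partial e_x U) r = 0"
    unfolding partial_commute[OF U r, of e_w e_x] by (rule partial_zero_on[OF U_w r])
  show "partial e_w (partial e_u U) r = 0"
    unfolding partial_commute[OF U r, of e_w e_u] by (rule partial_zero_on[OF U_w r])
  show "partial e_x (partial e_u U) r = partial e_u (partial e_x U) r"
    by (rule partial_commute[OF U r])
qed

lemma partial_u1: "partial v (\<lambda>r :: point. snd (snd r)) r = snd (snd v)"
  by (rule partial_eqI) (intro derivative_eq_intros | rule refl)+

lemma partial_W: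
  assumes r: "r \<in> N"
  shows "partial v W r = partial v (partial e_x U) r * G r + partial e_x U r * partial v G r
    + (partial v (partial e_u U) r * snd (snd r) + partial e_u U r * snd (snd v))"
proof -
  note d = differentiable_at[OF r]
  have "partial v W r = partial v (\<lambda>r. partial e_x U r * G r + partial e_u U r * snd (snd r)) r"
    by (rule partial_cong[OF N r W_eq])
  also have "\<dots> = partial v (partial e_x U) r * G r + partial e_x U r * partial v G r
    + (partial v (partial e_u U) r * snd (snd r) + partial e_u U r * snd (snd v))"
    by (simp add: partial_rules d partial_u1 differentiable_mult)
  finally show ?thesis .
qed

lemma map_has_derivative:
  assumes r: "r \<in> N"
  shows "((\<lambda>r. map_to r) has_derivative (\<lambda>v. (partial v X r, partial v U r, partial v W r))) (at r)"
  by (intro has_derivative_Pair smooth_on_has_derivative[OF X r] smooth_on_has_derivative[OF U r]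
      smooth_on_has_derivative[OF W r])

lemma partial_pullback:
  assumes g: "g differentiable at (map_to r)" and r: "r \<in> N"
  shows "partial v (\<lambda>r. g (map_to r)) r = partial (partial v X r, partial v U r, partial v W r) g (map_to r)"
  by (rule partial_eqI[OF has_derivative_compose[OF map_has_derivative[OF r] has_derivative_partial[OF g]]])

lemma partial_pullback_coordinates:
  fixes g :: "point \<Rightarrow> real"
  assumes g: "g differentiable at (map_to r)" and r: "r \<in> N"
  shows "partial v (\<lambda>r. g (map_to r)) r = partial v X r * partial e_x g (map_to r)
    + partial v U r * partial e_u g (map_to r) + partial v W r * partial e_w g (map_to r)"
  unfolding partial_pullback[OF assms] by (subst partial_point[OF g]) simp

text \<open>The derivative of \<open>W\<close> in \<open>u1\<close>, by which F_{u1} is divided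
  under the transformation. The locale does not assume that it is nonzero; where \<open>G\<close> is
  regular this follows from F_{u1} S = X_x G_{u1}.\<close>

definition "S r = partial e_x U r * partial e_w G r + partial e_u U r"

lemma partial_w_W: "r \<in> N \<Longrightarrow> partial e_w W r = S r"
  unfolding partial_W S_def by (simp add: second_order)

lemma S: "smooth_on N S"
  unfolding S_def[abs_def] by (intro smooth_intros smooth_on_partial G U)

text \<open>Derivatives of \<open>F_eq\<close> along the axes, in the order \<open>u1\<close>,
  \<open>u\<close>, \<open>x\<close>, so that each equation brings in one more derivative of
  \<open>F\<close>.\<close>

lemma first_order:
  assumes r: "r \<in> N"
  shows "partial e_w F (map_to r) * S r = partial e_x X r * partial e_w G r"
    and "partial e_u F (map_to r) * partial e_u U r + partial e_w F (map_to r) * partial e_u W r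
      = partial e_x X r * partial e_u G r"
    and "partial e_x F (map_to r) * partial e_x X r + partial e_u F (map_to r) * partial e_x U r
      + partial e_w F (map_to r) * partial e_x W r
      = partial e_x (partial e_x X) r * G r + partial e_x X r * partial e_x G r"
proof -
  note d = differentiable_at[OF r]
  have "partial v (\<lambda>r. F (map_to r)) r = partial v (\<lambda>r. partial e_x X r * G r) r" for v
    by (rule partial_cong[OF N r F_eq])
  then have eq: "partial v X r * partial e_x F (map_to r)
      + partial v U r * partial e_u F (map_to r) + partial v W r * partial e_w F (map_to r)
      = partial v (partial e_x X) r * G r + partial e_x X r * partial v G r" for v
    using partial_pullback_coordinates[OF smooth_on_differentiable[OF F maps[OF r]] r] partial_rules(2)[OF d(5,1)]
    by metis
  show "partial e_w F (map_to r) * S r = partial e_x X r * partial e_w G r"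
    using eq[of e_w] by (simp add: second_order[OF r] X_w[OF r] U_w[OF r] partial_w_W[OF r] mult.commute)
  show "partial e_u F (map_to r) * partial e_u U r + partial e_w F (map_to r) * partial e_u W r
      = partial e_x X r * partial e_u G r"
    using eq[of e_u] by (simp add: second_order[OF r] X_u[OF r] mult.commute)
  show "partial e_x F (map_to r) * partial e_x X r + partial e_u F (map_to r) * partial e_x U r
      + partial e_w F (map_to r) * partial e_x W r
      = partial e_x (partial e_x X) r * G r + partial e_x X r * partial e_x G r"
    using eq[of e_x] by (simp add: mult.commute)
qed

lemma partial_S:
  assumes r: "r \<in> N"
  shows "partial v S r = partial v (partial e_x U) r * partial e_w G r + partial e_x U r * partial v (partial e_w G) r
    + partial v (partial e_u U) r"
  unfolding S_def[abs_def] using differentiable_at[OF r] by (simp add: partial_rules differentiable_mult)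

text \<open>Differentiates the first relation of \<open>first_order\<close> again. The direction
  stays free since two are used: \<open>e_w\<close> yields F_{u1u1}, and the sum of the first and
  third frame fields yields the last component of its image.\<close>

lemma partial_F_w:
  assumes r: "r \<in> N"
  shows "(partial v X r * partial e_x (partial e_w F) (map_to r) + partial v U r * partial e_u (partial e_w F) (map_to r)
      + partial v W r * partial e_w (partial e_w F) (map_to r)) * S r + partial e_w F (map_to r) * partial v S r
    = partial v (partial e_x X) r * partial e_w G r + partial e_x X r * partial v (partial e_w G) r"
proof -
  note d = differentiable_at[OF r]
  have Fw: "partial e_w F differentiable at (map_to r)"
    by (rule smooth_on_differentiable[OF smooth_on_partial[OF F] maps[OF r]])
  have Fm: "(\<lambda>r. partial e_w F (map_to r)) differentiable at r"
    by (rule differentiableI[OF has_derivative_compose[OF map_has_derivative[OF r] has_derivative_partial[OF Fw]]])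
  have "partial v (\<lambda>r. partial e_w F (map_to r) * S r) r = partial v (\<lambda>r. partial e_x X r * partial e_w G r) r"
    by (rule partial_cong[OF N r first_order(1)])
  then show ?thesis
    using partial_pullback_coordinates[OF Fw r, of v] partial_rules(2)[OF Fm smooth_on_differentiable[OF S r], of v]
      partial_rules(2)[OF d(5,4), of v] by simp
qed

context
  fixes r :: point
  assumes r: "r \<in> N" and regular: "regular_jet (infinite_jet G r)"
begin

lemma G_nonzero: "G r \<noteq> 0" "partial e_w G r \<noteq> 0" "partial e_w (partial e_w G) r \<noteq> 0"
  "snd (snd r) * partial e_w G r - G r \<noteq> 0"
  using regular by (auto simp: regular_jet_infinite_jet)

lemma S_nonzero: "S r \<noteq> 0"
  using first_order(1)[OF r] X_x_nonzero[OF r] G_nonzero by auto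

lemma F_w: "partial e_w F (map_to r) = partial e_x X r * partial e_w G r / S r"
  using first_order(1)[OF r] S_nonzero by (simp add: field_simps)

lemma F_ww: "partial e_w (partial e_w F) (map_to r)
    = partial e_x X r * partial e_w (partial e_w G) r * partial e_u U r / S r ^ 3"
proof -
  note S_nz = S_nonzero
  have "partial e_w (partial e_w F) (map_to r) * S r * S r
      + partial e_x X r * partial e_w G r / S r * (partial e_x U r * partial e_w (partial e_w G) r)
      = partial e_x X r * partial e_w (partial e_w G) r"
    using partial_F_w[OF r, of e_w]
    by (simp add: X_w[OF r] U_w[OF r] partial_w_W[OF r] partial_S[OF r] second_order[OF r] F_w mult.commute)
  then have "partial e_w (partial e_w F) (map_to r) * S r * S r * S r
      = partial e_x X r * partial e_w (partial e_w G) r * (S r - partial e_w G r * partial e_x U r)"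
    using S_nz by (simp add: field_simps)
  also have "S r - partial e_w G r * partial e_x U r = partial e_u U r"
    by (simp add: S_def)
  finally show ?thesis using S_nz by (simp add: field_simps power3_eq_cube)
qed

text \<open>With \<open>F_w\<close> and \<open>F_eq\<close> this gives the transformation of u1
  f_{u1} - f: it is multiplied by X_x U_u / S.\<close>

lemma W_shift: "W r * partial e_w G r - S r * G r = partial e_u U r * (snd (snd r) * partial e_w G r - G r)"
  by (simp add: W_eq[OF r] S_def algebra_simps)

lemma regular_map_to: "regular_jet (infinite_jet F (map_to r))"
proof -
  have "snd (snd (map_to r)) * partial e_w F (map_to r) - F (map_to r)
      = partial e_x X r * (W r * partial e_w G r - S r * G r) / S r"
    using S_nonzero by (simp add: F_w F_eq[OF r] field_simps)
  then show ?thesis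
    unfolding regular_jet_infinite_jet W_shift
    using S_nonzero G_nonzero X_x_nonzero[OF r] U_u_nonzero[OF r] by (simp add: F_w F_ww F_eq[OF r])
qed

text \<open>The quantities f, f_{u1}, f_{u1u1} and u1 f_{u1} - f are multiplied by X_x, X_x / S, X_x
  U_u / S^3 and X_x U_u / S, and in J these factors cancel.\<close>

lemma on_system_inv_J_map_to: "on_system inv_J F (map_to r) = on_system inv_J G r"
proof -
  have cancel: "(x * g)\<^sup>2 * (x * gww * u / s ^ 3) / (x * (u * m) / s * (x * gw / s)\<^sup>2) = g\<^sup>2 * gww / (m * gw\<^sup>2)"
    if "x \<noteq> 0" "u \<noteq> 0" "s \<noteq> 0" "m \<noteq> 0" "gw \<noteq> 0" for x g gww u s m gw :: real
    using that by (simp add: field_simps power2_eq_square power3_eq_cube)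
  have "snd (snd (map_to r)) * partial e_w F (map_to r) - F (map_to r)
      = partial e_x X r * (W r * partial e_w G r - S r * G r) / S r"
    using S_nonzero by (simp add: F_w F_eq[OF r] field_simps)
  then have "on_system inv_J F (map_to r) = (partial e_x X r * G r)\<^sup>2
      * (partial e_x X r * partial e_w (partial e_w G) r * partial e_u U r / S r ^ 3)
      / (partial e_x X r * (partial e_u U r * (snd (snd r) * partial e_w G r - G r)) / S r
        * (partial e_x X r * partial e_w G r / S r)\<^sup>2)"
    unfolding on_system_def inv_J_def Let_def jet_values W_shift F_ww F_w F_eq[OF r] by simp
  also have "\<dots> = (G r)\<^sup>2 * partial e_w (partial e_w G) r
      / ((snd (snd r) * partial e_w G r - G r) * (partial e_w G r)\<^sup>2)"
    using S_nonzero G_nonzero X_x_nonzero[OF r] U_u_nonzero[OF r] by (intro cancel)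
  also have "\<dots> = on_system inv_J G r"
    unfolding on_system_def inv_J_def Let_def jet_values ..
  finally show ?thesis .
qed

lemma frame2_map_to: "(partial (frame2 G r) X r, partial (frame2 G r) U r, partial (frame2 G r) W r) = frame2 F (map_to r)"
proof -
  note d = differentiable_at[OF r] smooth_on_differentiable[OF W r]
  show ?thesis
    unfolding partial_point[OF d(2), of "frame2 G r"] partial_point[OF d(3), of "frame2 G r"] partial_point[OF d(8), of "frame2 G r"]
    unfolding frame2_def on_system_def coef_values
    using S_nonzero G_nonzero X_x_nonzero[OF r]
    by (simp add: X_w[OF r] U_w[OF r] partial_w_W[OF r] F_w F_eq[OF r])
qed

lemma frame1_map_to: "(partial (frame1 G r) X r, partial (frame1 G r) U r, partial (frame1 G r) W r) = frame1 F (map_to r)"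
proof -
  note d = differentiable_at[OF r] smooth_on_differentiable[OF W r]
  \<comment> \<open>The quotient f / f_{u1} is multiplied by \<open>S\<close>, which reduces the
    middle component to the identity \<open>u\<close> below; for the last one, F_u is eliminated by
    the \<open>u\<close>-derivative of \<open>F_eq\<close>.\<close>
  define q where "q = G r / partial e_w G r"
  have Gq: "G r = q * partial e_w G r" using G_nonzero by (simp add: q_def)
  have qF: "F (map_to r) / partial e_w F (map_to r) = q * S r"
    using S_nonzero G_nonzero X_x_nonzero[OF r] by (simp add: q_def F_w F_eq[OF r])
  have u: "partial e_u U r * (snd (snd r) - q) = W r - q * S r"
    unfolding W_eq[OF r] S_def Gq by (simp add: algebra_simps)
  have "(W r - q * S r) * partial e_u F (map_to r) / partial e_w F (map_to r)
     = (snd (snd r) - q) * (partial e_u U r * partial e_u F (map_to r)) / partial e_w F (map_to r)"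
    unfolding u[symmetric] by simp
  also have "\<dots> = (snd (snd r) - q) * (partial e_x X r * partial e_u G r / partial e_w F (map_to r) - partial e_u W r)"
  proof -
    have "partial e_u U r * partial e_u F (map_to r)
        = partial e_x X r * partial e_u G r - partial e_w F (map_to r) * partial e_u W r"
      using first_order(2)[OF r] by (simp add: algebra_simps)
    moreover have "partial e_w F (map_to r) \<noteq> 0"
      using S_nonzero G_nonzero X_x_nonzero[OF r] by (simp add: F_w)
    ultimately show ?thesis by (simp only: times_divide_eq_right[symmetric] diff_divide_distrib) simp
  qed
  also have "partial e_x X r * partial e_u G r / partial e_w F (map_to r) = S r * partial e_u G r / partial e_w G r"
    using S_nonzero G_nonzero X_x_nonzero[OF r] F_w by simp
  finally have w: "(W r - q * S r) * partial e_u F (map_to r) / partial e_w F (map_to r)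
    = (snd (snd r) - q) * (S r * partial e_u G r / partial e_w G r - partial e_u W r)" .
  show ?thesis
    unfolding partial_point[OF d(2), of "frame1 G r"] partial_point[OF d(3), of "frame1 G r"] partial_point[OF d(8), of "frame1 G r"]
    unfolding frame1_def on_system_def coef_values
      q_def[symmetric] qF
    using w u by (simp add: X_u[OF r] X_w[OF r] U_w[OF r] partial_w_W[OF r] algebra_simps add_divide_distrib diff_divide_distrib)
qed

text \<open>The sum \<open>\<nabla>\<^sub>1 + \<nabla>\<^sub>3\<close> equals \<open>f d/dx + u\<^sub>1 d/du\<close> up to a multiple of \<open>d/du\<^sub>1\<close>, which is
  determined by the requirement that \<open>f\<^bsub>u\<^sub>1\<^esub>\<close> be mapped to \<open>f\<^sub>x f\<^bsub>u\<^sub>1\<^esub> + f\<^sub>u\<close>.\<close>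

lemma frame13_map_to:
  "(partial (frame1 G r + frame3 G r) X r, partial (frame1 G r + frame3 G r) U r, partial (frame1 G r + frame3 G r) W r)
     = frame1 F (map_to r) + frame3 F (map_to r)"
proof -
  note d = differentiable_at[OF r] smooth_on_differentiable[OF W r]
  let ?w = "snd (snd r)" and ?Fx = "partial e_x F (map_to r)" and ?Fu = "partial e_u F (map_to r)"
    and ?Fw = "partial e_w F (map_to r)"
  define T where "T = frame1 G r + frame3 G r"
  have T: "T = (G r, ?w, coef_b (infinite_jet G r))"
    unfolding T_def frame1_def frame3_def on_system_def coef_w3_def coef_values jet_values by simp
  have TF: "frame1 F (map_to r) + frame3 F (map_to r) = (F (map_to r), W r, coef_b (infinite_jet F (map_to r)))"
    unfolding T_def frame1_def frame3_def on_system_def coef_w3_def coef_values jet_values by simp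
  have Gw: "partial T (partial e_w G) r = partial e_x G r * partial e_w G r + partial e_u G r"
    unfolding partial_point[OF d(4), of "T"] unfolding T coef_values using G_nonzero by (simp add: field_simps)
  have TX: "partial T X r = F (map_to r)" and TU: "partial T U r = W r"
    unfolding partial_point[OF d(2), of "T"] partial_point[OF d(3), of "T"] unfolding T
    by (simp add: X_u[OF r] X_w[OF r] F_eq[OF r] mult.commute, simp add: U_w[OF r] W_eq[OF r] mult.commute)
  have TXx: "partial T (partial e_x X) r = partial e_x (partial e_x X) r * G r"
    and TUx: "partial T (partial e_x U) r = G r * partial e_x (partial e_x U) r + ?w * partial e_u (partial e_x U) r"
    and TUu: "partial T (partial e_u U) r = G r * partial e_u (partial e_x U) r + ?w * partial e_u (partial e_u U) r"
    unfolding partial_point[OF d(5), of "T"] partial_point[OF d(6), of "T"] unfolding T second_order[OF r] by simp_all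
  have "(?Fx * ?Fw + ?Fu) * S r + ?Fw * partial T S r
      = partial T (partial e_x X) r * partial e_w G r + partial e_x X r * partial T (partial e_w G) r"
  proof -
    have 1: "?Fw * S r = partial e_x X r * partial e_w G r" by (rule first_order(1)[OF r])
    have 2: "?Fu * partial e_u U r = partial e_x X r * partial e_u G r - ?Fw * partial e_u W r"
      using first_order(2)[OF r] by simp
    have 3: "?Fx * partial e_x X r = partial e_x (partial e_x X) r * G r + partial e_x X r * partial e_x G r
        - ?Fu * partial e_x U r - ?Fw * partial e_x W r"
      using first_order(3)[OF r] by simp
    have "(?Fx * ?Fw + ?Fu) * S r = (?Fx * partial e_x X r) * partial e_w G r
        + ?Fu * partial e_u U r + ?Fu * (partial e_x U r * partial e_w G r)"
      using 1 by (simp add: distrib_right mult.assoc) (simp add: S_def algebra_simps)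
    then show ?thesis
      unfolding 2 3 partial_S[OF r] Gw TXx TUx TUu partial_W[OF r]
      by (simp add: second_order[OF r] algebra_simps)
  qed
  \<comment> \<open>Both relations have the same right-hand side. Cancelling \<open>S\<close> leaves
    for \<open>partial T W r\<close> the linear equation, with coefficient F_{u1u1}, whose solution
    is \<open>coef_b\<close> of \<open>F\<close>.\<close>
  with partial_F_w[OF r, of T]
  have "F (map_to r) * partial e_x (partial e_w F) (map_to r) + W r * partial e_u (partial e_w F) (map_to r)
      + partial T W r * partial e_w (partial e_w F) (map_to r) = ?Fx * ?Fw + ?Fu"
    using S_nonzero unfolding TX TU by (metis add_right_cancel mult_right_cancel)
  then have "partial T W r = coef_b (infinite_jet F (map_to r))"
    using regular_map_to unfolding coef_values regular_jet_infinite_jet by (simp add: field_simps)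
  then show ?thesis unfolding T_def[symmetric] TF TX TU by simp
qed

lemma frame3_map_to: "(partial (frame3 G r) X r, partial (frame3 G r) U r, partial (frame3 G r) W r) = frame3 F (map_to r)"
  using frame13_map_to frame1_map_to
  unfolding partial_linear(1)[OF differentiable_at(2)[OF r]] partial_linear(1)[OF differentiable_at(3)[OF r]]
    partial_linear(1)[OF smooth_on_differentiable[OF W r]]
  by (metis (no_types, lifting) add_Pair add_left_imp_eq)

lemma frame_pullback:
  assumes "g differentiable at (map_to r)"
  shows "partial (frame1 G r) (\<lambda>r. g (map_to r)) r = partial (frame1 F (map_to r)) g (map_to r)"
    "partial (frame2 G r) (\<lambda>r. g (map_to r)) r = partial (frame2 F (map_to r)) g (map_to r)"
    "partial (frame3 G r) (\<lambda>r. g (map_to r)) r = partial (frame3 F (map_to r)) g (map_to r)"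
  unfolding partial_pullback[OF assms r] frame1_map_to frame2_map_to frame3_map_to by simp_all

end

context
  assumes regular_F: "regular_jets_on F DF" and regular_G: "regular_jets_on G N"
begin

lemma on_system_nabla_map_to:
  assumes \<phi>: "\<phi> \<in> rational_jet_functions"
    and inv: "\<And>r. r \<in> N \<Longrightarrow> on_system \<phi> F (map_to r) = on_system \<phi> G r" and r: "r \<in> N"
  shows "on_system (nabla1 \<phi>) F (map_to r) = on_system (nabla1 \<phi>) G r"
    "on_system (nabla2 \<phi>) F (map_to r) = on_system (nabla2 \<phi>) G r"
    "on_system (nabla3 \<phi>) F (map_to r) = on_system (nabla3 \<phi>) G r"
  unfolding on_system_nabla[OF regular_F \<phi> maps[OF r]] on_system_nabla[OF regular_G \<phi> r]
    frame_pullback[OF r regular_jets_onD(3)[OF regular_G r]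
      smooth_on_differentiable[OF smooth_on_system[OF regular_F \<phi>] maps[OF r]], symmetric]
  by (rule partial_cong[OF N r inv]; assumption)+

text \<open>K can be read off from its bracket on a single function not killed by the second frame
  field: for \<open>F\<close> take the coordinate \<open>u1\<close>, for \<open>G\<close> its
  pullback \<open>W\<close>.\<close>

lemma on_system_inv_K_map_to:
  assumes r: "r \<in> N"
  shows "on_system inv_K F (map_to r) = on_system inv_K G r"
proof -
  note rational_u1 = rational_jet_coordinates(3)
  have W_eq: "on_system jet_u1 F (map_to r) = W r" for r
    by (simp add: on_system_coordinates)
  have regular: "regular_jet (infinite_jet G r)" if "r \<in> N" for r
    using regular_jets_onD(3)[OF regular_G that] .
  have d: "on_system \<phi> F differentiable at (map_to r)" if "\<phi> \<in> rational_jet_functions" "r \<in> N" for \<phi> r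
    by (rule smooth_on_differentiable[OF smooth_on_system[OF regular_F that(1)] maps[OF that(2)]])
  have 1: "on_system (nabla1 jet_u1) F (map_to r) = partial (frame1 G r) W r"
    and 2: "on_system (nabla2 jet_u1) F (map_to r) = partial (frame2 G r) W r"
    and 3: "on_system (nabla3 jet_u1) F (map_to r) = partial (frame3 G r) W r" if "r \<in> N" for r
    unfolding on_system_nabla[OF regular_F rational_u1 maps[OF that]]
      frame_pullback[OF that regular[OF that] d[OF rational_u1 that], symmetric] W_eq by simp_all
  have 31: "on_system (nabla3 (nabla1 jet_u1)) F (map_to r) = partial (frame3 G r) (\<lambda>r. partial (frame1 G r) W r) r"
    unfolding on_system_nabla[OF regular_F nabla_rational(1)[OF rational_u1] maps[OF r]]
      frame_pullback[OF r regular[OF r] d[OF nabla_rational(1)[OF rational_u1] r], symmetric]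
    by (rule partial_cong[OF N r 1])
  have 13: "on_system (nabla1 (nabla3 jet_u1)) F (map_to r) = partial (frame1 G r) (\<lambda>r. partial (frame3 G r) W r) r"
    unfolding on_system_nabla[OF regular_F nabla_rational(3)[OF rational_u1] maps[OF r]]
      frame_pullback[OF r regular[OF r] d[OF nabla_rational(3)[OF rational_u1] r], symmetric]
    by (rule partial_cong[OF N r 3])
  have "on_system inv_K F (map_to r) * partial (frame2 G r) W r = on_system inv_K G r * partial (frame2 G r) W r"
    using on_system_commutators(3)[OF regular_F rational_u1 maps[OF r]]
      frame_commutators(3)[OF regular_G W order_refl r]
    unfolding 31 13 2[OF r] by metis
  moreover have "partial (frame2 G r) W r \<noteq> 0"
    unfolding 2[OF r, symmetric] on_system_def
    using regular_jets_onD(3)[OF regular_F maps[OF r]] regular_jetD(6)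
    by (simp add: nabla2_eq total_derivative_coordinates)
  ultimately show ?thesis by simp
qed

lemma sigma_map_to:
  assumes r: "r \<in> N"
  shows "sigma F (map_to r) = sigma G r"
proof -
  note regular = regular_jets_onD(3)[OF regular_G]
  note J = on_system_inv_J_map_to[OF _ regular] and K = on_system_inv_K_map_to
  note J1 = on_system_nabla_map_to[OF inv_J_rational J] and K1 = on_system_nabla_map_to[OF inv_K_rational K]
  note J11 = on_system_nabla_map_to[OF nabla_rational(1)[OF inv_J_rational] J1(1)]
    and J12 = on_system_nabla_map_to[OF nabla_rational(2)[OF inv_J_rational] J1(2)]
    and J13 = on_system_nabla_map_to[OF nabla_rational(3)[OF inv_J_rational] J1(3)]
  show ?thesis unfolding sigma_def using r by (simp add: J K J1 K1 J11 J12 J13)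
qed

end

end

section \<open>From feedback matching to equality of the images\<close>

lemma partial_compose_fst:
  fixes X :: "real \<Rightarrow> real" and r :: point
  assumes "X differentiable at (fst r)"
  shows "partial v (\<lambda>r. X (fst r)) r = fst v * deriv X (fst r)"
proof -
  have "(X has_derivative (\<lambda>h. deriv X (fst r) * h)) (at (fst r))"
    using assms DERIV_deriv_iff_real_differentiable by (simp add: has_field_derivative_def)
  from partial_eqI[OF has_derivative_compose[OF has_derivative_fst[OF has_derivative_ident] this], of v]
  show ?thesis by (simp add: mult.commute)
qed

lemma partial_compose_fst_snd:
  fixes U :: "real \<times> real \<Rightarrow> real" and r :: point
  assumes "U differentiable at (fst r, fst (snd r))"
  shows "partial v (\<lambda>r. U (fst r, fst (snd r))) r = partial (fst v, fst (snd v)) U (fst r, fst (snd r))"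
proof -
  have "((\<lambda>r :: point. (fst r, fst (snd r))) has_derivative (\<lambda>r. (fst r, fst (snd r)))) (at r)"
    by (intro derivative_intros)
  from partial_eqI[OF has_derivative_compose[OF this has_derivative_partial[OF assms]]]
  show ?thesis .
qed

lemma feedback_matched_imp_prolonged:
  assumes m: "feedback_matched F DF G DG p q" and F: "smooth_on DF F" and G: "smooth_on DG G"
  obtains N X U W where "prolonged_feedback F G DF N X U W" "p \<in> N" "N \<subseteq> DG" "q = (X p, U p, W p)"
proof -
  obtain B X U N where ft: "feedback_transformation B X U" and N: "open N" "p \<in> N" "N \<subseteq> DG"
    and B: "\<forall>(x, u, u1) \<in> N. (x, u) \<in> B" and im: "feedback_lift X U G ` N \<subseteq> DF"
    and q: "feedback_lift X U G p = q"
    and eq: "\<forall>(x, u, u1) \<in> N. F (feedback_lift X U G (x, u, u1)) = deriv X x * G (x, u, u1)"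
    using m unfolding feedback_matched_def by blast
  have X: "smooth_on (fst ` B) X" and U: "smooth_on B U"
    and nz: "\<And>x u. (x, u) \<in> B \<Longrightarrow> deriv X x * partial (0, 1) U (x, u) \<noteq> 0"
    using ft unfolding feedback_transformation_def by auto
  let ?xu = "\<lambda>r :: point. (fst r, fst (snd r))"
  have inB: "?xu r \<in> B" if "r \<in> N" for r using B that by auto
  then have infB: "fst r \<in> fst ` B" if "r \<in> N" for r using that by (metis fst_conv imageI)
  have GN: "smooth_on N G" using smooth_on_subset[OF G N(1,3)] .
  have "smooth_on N (\<lambda>r. r)" by (intro smooth_intros N)
  then have XN: "smooth_on N (\<lambda>r. X (fst r))" and UN: "smooth_on N (\<lambda>r. U (?xu r))"
    using infB inB by (auto intro!: smooth_on_compose[OF X] smooth_on_compose[OF U] smooth_intros)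
  have pX: "partial v (\<lambda>r. X (fst r)) r = fst v * deriv X (fst r)" if "r \<in> N" for v :: point and r
    by (rule partial_compose_fst[OF smooth_on_differentiable[OF X infB[OF that]]])
  have pU: "partial v (\<lambda>r. U (?xu r)) r = partial (?xu v) U (?xu r)" if "r \<in> N" for v r
    by (rule partial_compose_fst_snd[OF smooth_on_differentiable[OF U inB[OF that]]])
  have U0: "partial (0, 0) U (?xu r) = 0" if "r \<in> N" for r
    using partial_linear(4)[OF smooth_on_differentiable[OF U inB[OF that]]] by (simp add: zero_prod_def)
  let ?W = "\<lambda>r. partial (1, 0) U (?xu r) * G r + partial (0, 1) U (?xu r) * snd (snd r)"
  have lift: "feedback_lift X U G r = (X (fst r), U (?xu r), ?W r)" for r
    by (simp add: feedback_lift_def case_prod_unfold)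
  have "prolonged_feedback F G DF N (\<lambda>r. X (fst r)) (\<lambda>r. U (?xu r)) ?W"
  proof
    fix r assume r: "r \<in> N"
    show "(X (fst r), U (?xu r), ?W r) \<in> DF" using im r unfolding lift by blast
    show "F (X (fst r), U (?xu r), ?W r) = partial e_x (\<lambda>r. X (fst r)) r * G r"
      using eq r unfolding lift by (auto simp: pX)
    show "partial e_x (\<lambda>r. X (fst r)) r \<noteq> 0" "partial e_u (\<lambda>r. U (?xu r)) r \<noteq> 0"
      using nz[of "fst r" "fst (snd r)"] inB[OF r] by (auto simp: pX[OF r] pU[OF r])
  qed (simp_all add: F GN XN UN pX pU U0)
  moreover have "q = (X (fst p), U (?xu p), ?W p)" using q lift by simp
  ultimately show ?thesis using that N by blast
qed

lemma regular_jet_truncate: "2 \<le> k \<Longrightarrow> regular_jet (truncate_jet k \<theta>) = regular_jet \<theta>"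
  by (cases \<theta>) (auto simp: regular_jet_def truncate_jet_def jet_f_def jet_u1_def)

text \<open>Membership in a regular orbit says only that some equivalent jet is regular, so
  regularity is carried along the orbit by \<open>regular_map_to\<close>. Truncation at order 4 is
  harmless because regularity involves order at most 2.\<close>

lemma regular_system_imp_regular_jets:
  assumes "regular_system F D"
  shows "regular_jets_on F D"
proof -
  have "smooth_on D F" using assms by (simp add: regular_system_def control_system_def)
  moreover have "regular_jet (infinite_jet F p)" if "p \<in> D" for p
  proof -
    obtain \<theta> where \<theta>: "regular_jet \<theta>" "jet_of 4 F p \<in> feedback_orbit 4 \<theta>"
      using assms \<open>p \<in> D\<close> unfolding regular_system_def regular_orbits_def by blast
    then obtain F' DF G DG p' q' where *: "smooth_on DF F'" "smooth_on DG G" "feedback_matched F' DF G DG p' q'"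
      "\<theta> = jet_of 4 G p'" "jet_of 4 F p = jet_of 4 F' q'"
      unfolding feedback_orbit_def by blast
    from feedback_matched_imp_prolonged[OF *(3,1,2)]
    obtain N X U W where N: "prolonged_feedback F' G DF N X U W" "p' \<in> N" "q' = (X p', U p', W p')" by metis
    have "regular_jet (infinite_jet G p')"
      using \<theta>(1) *(4) regular_jet_truncate[of 4] by (simp add: jet_of_def)
    from prolonged_feedback.regular_map_to[OF N(1,2) this]
    show ?thesis
      using *(5) N(3) regular_jet_truncate[of 4 "infinite_jet F p"] regular_jet_truncate[of 4 "infinite_jet F' q'"]
      by (simp add: jet_of_def)
  qed
  ultimately show ?thesis by (simp add: regular_jets_on_def)
qed

lemma sigma_feedback_matched:
  assumes "regular_jets_on F DF" "regular_jets_on G DG" "feedback_matched F DF G DG p q"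
  shows "sigma F q = sigma G p"
proof -
  from feedback_matched_imp_prolonged[OF assms(3) regular_jets_onD(1)[OF assms(1)] regular_jets_onD(1)[OF assms(2)]]
  obtain N X U W where N: "prolonged_feedback F G DF N X U W" "p \<in> N" "N \<subseteq> DG" "q = (X p, U p, W p)" .
  have "regular_jets_on G N"
    using assms(2) N(3) smooth_on_subset prolonged_feedback.N[OF N(1)] unfolding regular_jets_on_def by blast
  from prolonged_feedback.sigma_map_to[OF N(1) assms(1) this N(2)] show ?thesis by (simp add: N(4))
qed

lemma Sigma_of_eq_if_locally_feedback_equivalent:
  assumes "regular_jets_on F DF" "regular_jets_on G DG" "locally_feedback_equivalent F DF G DG"
  shows "Sigma_of F DF = Sigma_of G DG"
proof -
  have "\<exists>q\<in>DF. sigma G p = sigma F q" if "p \<in> DG" for p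
    using assms(3) that sigma_feedback_matched[OF assms(1,2)] unfolding locally_feedback_equivalent_def by metis
  moreover have "\<exists>p\<in>DG. sigma F q = sigma G p" if "q \<in> DF" for q
    using assms(3) that sigma_feedback_matched[OF assms(1,2)] unfolding locally_feedback_equivalent_def by metis
  ultimately show ?thesis unfolding Sigma_of_def by blast
qed

section \<open>Charts built from invariants\<close>

definition det3 :: "point \<Rightarrow> point \<Rightarrow> point \<Rightarrow> real" where
  "det3 a b c = fst a * (fst (snd b) * snd (snd c) - snd (snd b) * fst (snd c))
     - fst (snd a) * (fst b * snd (snd c) - snd (snd b) * fst c)
     + snd (snd a) * (fst b * fst (snd c) - fst (snd b) * fst c)"

lemma point_linear_eq:
  fixes A :: "point \<Rightarrow> 'a::real_vector"
  assumes "linear A"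
  shows "A v = fst v *\<^sub>R A e_x + fst (snd v) *\<^sub>R A e_u + snd (snd v) *\<^sub>R A e_w"
proof -
  have "v = fst v *\<^sub>R e_x + fst (snd v) *\<^sub>R e_u + snd (snd v) *\<^sub>R e_w" by (cases v) simp
  then have "A v = A (fst v *\<^sub>R e_x + fst (snd v) *\<^sub>R e_u + snd (snd v) *\<^sub>R e_w)" by (rule arg_cong)
  then show ?thesis by (simp only: linear_add[OF assms] linear_scale[OF assms])
qed

lemma det3_linear_image:
  assumes "linear A"
  shows "det3 (A a) (A b) (A c) = det3 (A e_x) (A e_u) (A e_w) * det3 a b c"
  unfolding point_linear_eq[OF assms, of a] point_linear_eq[OF assms, of b] point_linear_eq[OF assms, of c]
  by (simp add: det3_def) algebra

text \<open>The derivative at t = 0 of \<open>det3_linear_image\<close> for the maps 1 + t A, hence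
  the trace.\<close>

lemma det3_trace:
  assumes "linear A"
  shows "det3 (A a) b c + det3 a (A b) c + det3 a b (A c)
    = (fst (A e_x) + fst (snd (A e_u)) + snd (snd (A e_w))) * det3 a b c"
  unfolding point_linear_eq[OF assms, of a] point_linear_eq[OF assms, of b] point_linear_eq[OF assms, of c]
  by (simp add: det3_def) algebra

text \<open>The zero set is relatively closed by continuity, and open by a Gronwall estimate along
  segments issuing from a zero; connectedness finishes.\<close>

lemma zero_set_linear_ode:
  fixes \<delta> :: "'a::real_normed_vector \<Rightarrow> real"
  assumes D: "open D" "connected D"
    and diff: "\<And>p. p \<in> D \<Longrightarrow> \<delta> differentiable at p"
    and C: "continuous_on D C"
    and bound: "\<And>p v. p \<in> D \<Longrightarrow> \<bar>partial v \<delta> p\<bar> \<le> C p * norm v * \<bar>\<delta> p\<bar>"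
    and z: "z \<in> D" "\<delta> z = 0" and p: "p \<in> D"
  shows "\<delta> p = 0"
proof -
  define Z where "Z = {p \<in> D. \<delta> p = 0}"
  have "continuous_on D \<delta>"
    using diff by (simp add: continuous_at_imp_continuous_on differentiable_imp_continuous_within)
  then have closed: "closedin (top_of_set D) Z"
    unfolding Z_def by (rule continuous_closedin_preimage_constant)
  have "open Z"
    unfolding open_contains_ball
  proof
    fix q assume "q \<in> Z"
    then have q: "q \<in> D" "\<delta> q = 0" by (auto simp: Z_def)
    obtain e1 where e1: "e1 > 0" "ball q e1 \<subseteq> D" using D(1) q(1) open_contains_ball by blast
    have "isCont C q" using C D(1) q(1) continuous_on_eq_continuous_at by blast
    then obtain e2 where e2: "e2 > 0" "\<And>r. dist r q < e2 \<Longrightarrow> dist (C r) (C q) < 1"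
      unfolding continuous_at_eps_delta by (metis zero_less_one)
    \<comment> \<open>Near \<open>q\<close> the values of \<open>C\<close> are below
      \<open>C q + 1\<close>, so \<open>B\<close> bounds them on every segment from \<open>q\<close>
      within the ball.\<close>
    define B where "B = \<bar>C q\<bar> + 1"
    have "ball q (min e1 e2) \<subseteq> Z"
    proof
      fix r assume r: "r \<in> ball q (min e1 e2)"
      define g where "g = (\<lambda>t. \<delta> (q + t *\<^sub>R (r - q)))"
      define L where "L = B * norm (r - q)"
      have seg: "q + t *\<^sub>R (r - q) \<in> D" "C (q + t *\<^sub>R (r - q)) \<le> B" if "0 \<le> t" "t \<le> 1" for t
      proof -
        have "dist (q + t *\<^sub>R (r - q)) q = t * norm (r - q)" using that by (simp add: dist_norm)
        also have "\<dots> \<le> norm (r - q)" using that by (simp add: mult_left_le_one_le)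
        also have "\<dots> < min e1 e2" using r by (simp add: dist_norm norm_minus_commute)
        finally have d: "dist (q + t *\<^sub>R (r - q)) q < min e1 e2" .
        then show "q + t *\<^sub>R (r - q) \<in> D" using e1(2) by (auto simp: dist_commute)
        show "C (q + t *\<^sub>R (r - q)) \<le> B"
          using e2(2)[of "q + t *\<^sub>R (r - q)"] d by (simp add: dist_real_def B_def)
      qed
      have dg: "(g has_real_derivative partial (r - q) \<delta> (q + t *\<^sub>R (r - q))) (at t)"
        if "0 \<le> t" "t \<le> 1" for t
        unfolding g_def by (rule has_real_derivative_along_line[OF diff[OF seg(1)[OF that]]])
      \<comment> \<open>As |g'| <= L |g|, the product of g^2 with exp (- 2 L t) cannot increase, and
        it starts at 0. Squaring avoids differentiating an absolute value.\<close>
      have "(g 1)\<^sup>2 * exp (- 2 * L * 1) \<le> (g 0)\<^sup>2 * exp (- 2 * L * 0)"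
      proof (rule DERIV_nonpos_imp_nonincreasing[of 0 1 "\<lambda>t. (g t)\<^sup>2 * exp (- 2 * L * t)"])
        fix t :: real assume t: "0 \<le> t" "t \<le> 1"
        let ?g' = "partial (r - q) \<delta> (q + t *\<^sub>R (r - q))"
        have deriv: "((\<lambda>t. (g t)\<^sup>2 * exp (- 2 * L * t)) has_real_derivative
            (2 * (g t * ?g') - 2 * L * (g t)\<^sup>2) * exp (- 2 * L * t)) (at t)"
          by (auto intro!: derivative_eq_intros dg t simp: algebra_simps)
        have "g t * ?g' \<le> L * (g t)\<^sup>2"
        proof -
          have "g t * ?g' \<le> \<bar>g t\<bar> * \<bar>?g'\<bar>" by (metis abs_ge_self abs_mult)
          also have "\<bar>g t\<bar> * \<bar>?g'\<bar> \<le> \<bar>g t\<bar> * (L * \<bar>g t\<bar>)"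
          proof (rule mult_left_mono)
            have "\<bar>?g'\<bar> \<le> C (q + t *\<^sub>R (r - q)) * norm (r - q) * \<bar>g t\<bar>"
            unfolding g_def by (rule bound[OF seg(1)[OF t]])
            also have "\<dots> \<le> L * \<bar>g t\<bar>"
              unfolding L_def by (intro mult_right_mono seg(2) t) auto
            finally show "\<bar>?g'\<bar> \<le> L * \<bar>g t\<bar>" .
          qed simp
          also have "\<dots> = L * (g t)\<^sup>2" by (simp add: power2_eq_square)
          finally show ?thesis .
        qed
        then have "(2 * (g t * ?g') - 2 * L * (g t)\<^sup>2) * exp (- 2 * L * t) \<le> 0"
          by (intro mult_nonpos_nonneg) auto
        with deriv show "\<exists>y. ((\<lambda>t. (g t)\<^sup>2 * exp (- 2 * L * t)) has_real_derivative y) (at t) \<and> y \<le> 0"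
          by blast
      qed simp
      then have "g 1 = 0" using q(2) by (simp add: g_def mult_le_0_iff)
      then show "r \<in> Z" using seg(1)[of 1] by (simp add: Z_def g_def)
    qed
    then show "\<exists>e>0. ball q e \<subseteq> Z" using e1(1) e2(1) by (intro exI[of _ "min e1 e2"]) auto
  qed
  then have "openin (top_of_set D) Z" by (simp add: Z_def openin_open_eq[OF D(1)] subset_iff)
  then have "Z = {} \<or> Z = D" using D(2) closed by (auto simp: connected_clopen)
  then show ?thesis using z p by (auto simp: Z_def)
qed

lemma has_derivative_det3:
  assumes "(a has_derivative a') (at p)" "(b has_derivative b') (at p)" "(c has_derivative c') (at p)"
  shows "((\<lambda>p. det3 (a p) (b p) (c p)) has_derivative
    (\<lambda>v. det3 (a' v) (b p) (c p) + det3 (a p) (b' v) (c p) + det3 (a p) (b p) (c' v))) (at p)"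
  unfolding det3_def
  by (rule has_derivative_eq_rhs) ((rule derivative_intros assms)+, auto simp: algebra_simps)

lemma struct_b_rational [rational_intros]: "struct_b \<in> rational_jet_functions"
  unfolding struct_b_def[abs_def] by (intro rational_intros regular_jetD)

text \<open>The coefficients of \<open>v\<close> in the frame, that is, the dual coframe. Only the
  third field has an x-component and the second has only a \<open>u1\<close>-component, so back
  substitution finds the coefficients in the order 3, 1, 2, dividing by the nonzero f,
  \<open>coef_p\<close> and \<open>coef_q\<close>.\<close>

definition coframe3 :: "(point \<Rightarrow> real) \<Rightarrow> point \<Rightarrow> point \<Rightarrow> real" where
  "coframe3 F v p = fst v / on_system (jet_f 0 0 0) F p"

definition coframe1 :: "(point \<Rightarrow> real) \<Rightarrow> point \<Rightarrow> point \<Rightarrow> real" where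
  "coframe1 F v p = (fst (snd v) - on_system coef_q F p * coframe3 F v p) / on_system coef_p F p"

definition coframe2 :: "(point \<Rightarrow> real) \<Rightarrow> point \<Rightarrow> point \<Rightarrow> real" where
  "coframe2 F v p = (snd (snd v) - on_system coef_w1 F p * coframe1 F v p
     - on_system coef_w3 F p * coframe3 F v p) / on_system coef_q F p"

lemma on_system_nonzero:
  assumes "regular_jets_on F D" "p \<in> D"
  shows "on_system (jet_f 0 0 0) F p \<noteq> 0" "on_system coef_q F p \<noteq> 0" "on_system coef_p F p \<noteq> 0"
    "on_system inv_J F p \<noteq> 0"
  using regular_jetD[OF regular_jets_onD(3)[OF assms]] inv_J_nonzero[OF regular_jets_onD(3)[OF assms]]
  unfolding on_system_def by blast+

lemma coframe:
  assumes "regular_jets_on F D" "p \<in> D"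
  shows "coframe1 F v p *\<^sub>R frame1 F p + coframe2 F v p *\<^sub>R frame2 F p + coframe3 F v p *\<^sub>R frame3 F p = v"
  using on_system_nonzero[OF assms]
  by (cases v) (simp add: coframe1_def coframe2_def coframe3_def frame1_def frame2_def frame3_def)

lemma smooth_on_coframe:
  assumes "regular_jets_on F D"
  shows "smooth_on D (coframe1 F v)" "smooth_on D (coframe2 F v)" "smooth_on D (coframe3 F v)"
proof -
  note * = smooth_on_system[OF assms] regular_jets_onD(2)[OF assms] on_system_nonzero[OF assms] coef_rational
    rational_jet_coordinates
  show 3: "smooth_on D (coframe3 F v)" unfolding coframe3_def[abs_def] by (intro smooth_intros *)
  show 1: "smooth_on D (coframe1 F v)" unfolding coframe1_def[abs_def] by (intro smooth_intros * 3)
  show "smooth_on D (coframe2 F v)" unfolding coframe2_def[abs_def] by (intro smooth_intros * 1 3)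
qed

lemma smooth_on_frame:
  assumes "regular_jets_on F D"
  shows "smooth_on D (frame1 F)" "smooth_on D (frame2 F)" "smooth_on D (frame3 F)"
  unfolding frame1_def[abs_def] frame2_def[abs_def] frame3_def[abs_def]
  by (intro smooth_intros smooth_on_system[OF assms] regular_jets_onD(2)[OF assms] coef_rational
      rational_jet_coordinates)+

lemma partial_bounded_linear:
  assumes "bounded_linear L" "f differentiable at p"
  shows "partial v (\<lambda>p. L (f p)) p = L (partial v f p)"
  by (rule partial_eqI[OF bounded_linear.has_derivative[OF assms(1) has_derivative_partial[OF assms(2)]]])

lemma partial_compose:
  assumes "f differentiable at p" "g differentiable at (f p)"
  shows "partial v (\<lambda>p. g (f p)) p = partial (partial v f p) g (f p)"
  by (rule partial_eqI[OF has_derivative_compose[OF assms[THEN has_derivative_partial]]])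

text \<open>The map \<open>y\<close> pushes the frame forward to fields on \<open>E\<close>, which
  is open as part of their smoothness. That \<open>y\<close> has injective derivative is not assumed
  but proved, as \<open>chart_injective\<close>. Two systems are compared by interpreting the locale
  with the same \<open>E\<close> and the same fields.\<close>

locale frame_chart =
  fixes F :: "point \<Rightarrow> real" and D :: "point set" and y :: "point \<Rightarrow> point" and E :: "point set"
    and M1 M2 M3 :: "point \<Rightarrow> point"
  assumes F: "regular_jets_on F D" and D: "connected D" "D \<noteq> {}"
    and y: "smooth_on D y" and E: "E = y ` D"
    and M: "smooth_on E M1" "smooth_on E M2" "smooth_on E M3"
    and y1: "p \<in> D \<Longrightarrow> partial (frame1 F p) y p = M1 (y p)"
    and y2: "p \<in> D \<Longrightarrow> partial (frame2 F p) y p = M2 (y p)"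
    and y3: "p \<in> D \<Longrightarrow> partial (frame3 F p) y p = M3 (y p)"
begin

lemma D_open: "open D" by (rule regular_jets_onD(2)[OF F])

lemma y_in_E: "p \<in> D \<Longrightarrow> y p \<in> E" by (simp add: E)

lemma M_differentiable:
  assumes "p \<in> D"
  shows "M1 differentiable at (y p)" "M2 differentiable at (y p)" "M3 differentiable at (y p)"
  using M[THEN smooth_on_differentiable] y_in_E[OF assms] by auto

lemma y_differentiable: "p \<in> D \<Longrightarrow> y differentiable at p"
  by (rule smooth_on_differentiable[OF y])

abbreviation "dM M v p \<equiv> partial v M (y p)"

text \<open>Fields related by \<open>y\<close> have brackets related by \<open>y\<close>. As
  \<open>frame_commutators\<close> concerns real functions, \<open>y\<close> is followed by a linear
  functional \<open>L\<close>, later a coordinate projection.\<close>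

lemma chart_commutators_aux:
  fixes L :: "point \<Rightarrow> real"
  assumes L: "bounded_linear L" and p: "p \<in> D"
  shows "L (dM M2 (M1 (y p)) p) - L (dM M1 (M2 (y p)) p) = - on_system inv_J F p * L (M1 (y p))"
    and "L (dM M3 (M2 (y p)) p) - L (dM M2 (M3 (y p)) p) = L (M3 (y p)) - on_system inv_J F p * L (M1 (y p))
      + on_system struct_b F p * L (M2 (y p))"
    and "L (dM M1 (M3 (y p)) p) - L (dM M3 (M1 (y p)) p) = on_system inv_K F p * L (M2 (y p))"
proof -
  have first: "partial v (\<lambda>q. L (y q)) q = L (partial v y q)" if "q \<in> D" for v q
    by (rule partial_bounded_linear[OF L y_differentiable[OF that]])
  have second: "partial v (\<lambda>q. L (M (y q))) p = L (partial (partial v y p) M (y p))"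
    if "M differentiable at (y p)" for v and M :: "point \<Rightarrow> point"
    using partial_bounded_linear[OF L differentiable_chain_at[OF y_differentiable[OF p] that], of v]
    by (simp add: partial_compose[OF y_differentiable[OF p] that] o_def)
  have "partial v (\<lambda>q. partial (frame1 F q) (\<lambda>q. L (y q)) q) p = L (partial (partial v y p) M1 (y p))"
    and "partial v (\<lambda>q. partial (frame2 F q) (\<lambda>q. L (y q)) q) p = L (partial (partial v y p) M2 (y p))"
    and "partial v (\<lambda>q. partial (frame3 F q) (\<lambda>q. L (y q)) q) p = L (partial (partial v y p) M3 (y p))" for v
    unfolding second[OF M_differentiable(1)[OF p], symmetric] second[OF M_differentiable(2)[OF p], symmetric]
      second[OF M_differentiable(3)[OF p], symmetric]
    by (rule partial_cong[OF D_open p], simp add: first y1 y2 y3)+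
  note eqs = this y1[OF p] y2[OF p] y3[OF p] first[OF p]
  show "L (dM M2 (M1 (y p)) p) - L (dM M1 (M2 (y p)) p) = - on_system inv_J F p * L (M1 (y p))"
    and "L (dM M3 (M2 (y p)) p) - L (dM M2 (M3 (y p)) p) = L (M3 (y p)) - on_system inv_J F p * L (M1 (y p))
      + on_system struct_b F p * L (M2 (y p))"
    and "L (dM M1 (M3 (y p)) p) - L (dM M3 (M1 (y p)) p) = on_system inv_K F p * L (M2 (y p))"
    using frame_commutators[OF F smooth_on_bounded_linear[OF L y] order_refl p] unfolding eqs by simp_all
qed

lemma chart_commutators:
  assumes p: "p \<in> D"
  shows "dM M2 (M1 (y p)) p = dM M1 (M2 (y p)) p - on_system inv_J F p *\<^sub>R M1 (y p)"
    and "dM M3 (M2 (y p)) p = dM M2 (M3 (y p)) p + M3 (y p) - on_system inv_J F p *\<^sub>R M1 (y p)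
      + on_system struct_b F p *\<^sub>R M2 (y p)"
    and "dM M1 (M3 (y p)) p = dM M3 (M1 (y p)) p + on_system inv_K F p *\<^sub>R M2 (y p)"
proof -
  have "bounded_linear (\<lambda>v :: point. fst v)" "bounded_linear (\<lambda>v :: point. fst (snd v))"
    "bounded_linear (\<lambda>v :: point. snd (snd v))"
    by (intro bounded_linear_fst bounded_linear_snd bounded_linear_compose[OF bounded_linear_fst]
        bounded_linear_compose[OF bounded_linear_snd])+
  note * = this[THEN chart_commutators_aux(1), OF p] this[THEN chart_commutators_aux(2), OF p]
    this[THEN chart_commutators_aux(3), OF p]
  show "dM M2 (M1 (y p)) p = dM M1 (M2 (y p)) p - on_system inv_J F p *\<^sub>R M1 (y p)"
    and "dM M3 (M2 (y p)) p = dM M2 (M3 (y p)) p + M3 (y p) - on_system inv_J F p *\<^sub>R M1 (y p)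
      + on_system struct_b F p *\<^sub>R M2 (y p)"
    and "dM M1 (M3 (y p)) p = dM M3 (M1 (y p)) p + on_system inv_K F p *\<^sub>R M2 (y p)"
    using * by (auto simp: prod_eq_iff algebra_simps)
qed

text \<open>This equals the Jacobian determinant of \<open>y\<close> times the nonzero determinant
  of the frame, so its zeros are the critical points of \<open>y\<close>.\<close>

definition "\<delta> p = det3 (M1 (y p)) (M2 (y p)) (M3 (y p))"

definition "divergence M p = fst (partial e_x M (y p)) + fst (snd (partial e_u M (y p))) + snd (snd (partial e_w M (y p)))"

lemma delta_has_derivative:
  assumes p: "p \<in> D"
  shows "(\<delta> has_derivative (\<lambda>v. det3 (dM M1 (partial v y p) p) (M2 (y p)) (M3 (y p))
    + det3 (M1 (y p)) (dM M2 (partial v y p) p) (M3 (y p))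
    + det3 (M1 (y p)) (M2 (y p)) (dM M3 (partial v y p) p))) (at p)"
  unfolding \<delta>_def[abs_def]
  by (intro has_derivative_det3 has_derivative_compose[OF has_derivative_partial has_derivative_partial]
      y_differentiable M_differentiable p)

text \<open>By the commutation relations, the frame derivatives of \<open>\<delta>\<close> are multiples of \<open>\<delta>\<close> (Liouville's
  formula).\<close>

lemma delta_along_frame:
  assumes p: "p \<in> D"
  shows "partial (frame1 F p) \<delta> p = divergence M1 p * \<delta> p"
    and "partial (frame2 F p) \<delta> p = (divergence M2 p + on_system inv_J F p + 1) * \<delta> p"
    and "partial (frame3 F p) \<delta> p = (divergence M3 p - on_system struct_b F p) * \<delta> p"
proof -
  note lin = M_differentiable[OF p, THEN has_derivative_partial, THEN has_derivative_linear]
  note c = chart_commutators[OF p]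
  have c': "dM M1 (M2 (y p)) p = dM M2 (M1 (y p)) p + on_system inv_J F p *\<^sub>R M1 (y p)"
    "dM M2 (M3 (y p)) p = dM M3 (M2 (y p)) p - M3 (y p) + on_system inv_J F p *\<^sub>R M1 (y p)
      - on_system struct_b F p *\<^sub>R M2 (y p)"
    "dM M3 (M1 (y p)) p = dM M1 (M3 (y p)) p - on_system inv_K F p *\<^sub>R M2 (y p)"
    unfolding c by simp_all
  \<comment> \<open>Along the i-th field, each slot j of the determinant contains the derivative of
    M_j along M_i. A bracket turns it into the derivative of M_i along M_j, and these add up to the
    divergence. Of the bracket terms only multiples of M_j in slot j survive: none for i = 1, J and
    1 for i = 2, and -b for i = 3.\<close>
  note tr = lin[THEN det3_trace, of "M1 (y p)" "M2 (y p)" "M3 (y p)", folded \<delta>_def, folded divergence_def]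
  have bil: "det3 a b (c + k *\<^sub>R d) = det3 a b c + k * det3 a b d"
    "det3 a (b + k *\<^sub>R d) c = det3 a b c + k * det3 a d c"
    "det3 (a + k *\<^sub>R d) b c = det3 a b c + k * det3 d b c"
    "det3 a b (c - k *\<^sub>R d) = det3 a b c - k * det3 a b d"
    "det3 a (b - k *\<^sub>R d) c = det3 a b c - k * det3 a d c"
    "det3 a b (c + d) = det3 a b c + det3 a b d" "det3 a (b + d) c = det3 a b c + det3 a d c"
    "det3 a (b - d) c = det3 a b c - det3 a d c" "det3 a (k *\<^sub>R b) c = k * det3 a b c"
    "det3 a b (k *\<^sub>R c) = k * det3 a b c"
    "det3 a a c = 0" "det3 a b b = 0" "det3 a b a = 0" for a b c d k
    by (simp_all add: det3_def algebra_simps)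
  note pd = partial_eqI[OF delta_has_derivative[OF p]]
  show "partial (frame1 F p) \<delta> p = divergence M1 p * \<delta> p"
    unfolding pd y1[OF p] c(1) c'(3) tr(1)[symmetric] by (simp add: bil)
  show "partial (frame2 F p) \<delta> p = (divergence M2 p + on_system inv_J F p + 1) * \<delta> p"
    unfolding pd y2[OF p] c'(1) c(2) distrib_right tr(2)[symmetric] by (simp add: bil \<delta>_def)
  show "partial (frame3 F p) \<delta> p = (divergence M3 p - on_system struct_b F p) * \<delta> p"
    unfolding pd y3[OF p] c(3) c'(2) left_diff_distrib tr(3)[symmetric] by (simp add: bil \<delta>_def)
qed

definition "delta_factor v p = coframe1 F v p * divergence M1 p
  + coframe2 F v p * (divergence M2 p + on_system inv_J F p + 1)
  + coframe3 F v p * (divergence M3 p - on_system struct_b F p)"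

lemma partial_delta:
  assumes p: "p \<in> D"
  shows "partial v \<delta> p = delta_factor v p * \<delta> p"
proof -
  have d: "\<delta> differentiable at p" by (rule differentiableI[OF delta_has_derivative[OF p]])
  have "partial v \<delta> p = partial (coframe1 F v p *\<^sub>R frame1 F p + coframe2 F v p *\<^sub>R frame2 F p
      + coframe3 F v p *\<^sub>R frame3 F p) \<delta> p"
    unfolding coframe[OF F p] ..
  also have "\<dots> = delta_factor v p * \<delta> p"
    unfolding partial_linear(1,3)[OF d] delta_along_frame[OF p] delta_factor_def by (simp add: algebra_simps)
  finally show ?thesis .
qed

lemma continuous_on_delta_factor: "continuous_on D (delta_factor v)"
proof -
  have div: "smooth_on D (divergence M)" if "smooth_on E M" for M
    unfolding divergence_def[abs_def]
    by (intro smooth_intros smooth_on_compose[OF smooth_on_partial[OF that] y] y_in_E)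
  have "smooth_on D (delta_factor v)"
    unfolding delta_factor_def[abs_def]
    by (intro smooth_intros div smooth_on_coframe[OF F] M smooth_on_system[OF F] rational_intros D_open)
  then show ?thesis by (rule smooth_on_continuous_on)
qed

lemma delta_zero_everywhere:
  assumes "p0 \<in> D" "\<delta> p0 = 0" "p \<in> D"
  shows "\<delta> p = 0"
\<comment> \<open>The bound must hold uniformly in the direction, whereas
  \<open>delta_factor\<close> is continuous for each fixed direction; hence the sum over the three
  axes.\<close>
proof (rule zero_set_linear_ode[where z = p0 and D = D
      and C = "\<lambda>p. \<bar>delta_factor e_x p\<bar> + \<bar>delta_factor e_u p\<bar> + \<bar>delta_factor e_w p\<bar>"])
  show "\<delta> differentiable at p" if "p \<in> D" for p
    by (rule differentiableI[OF delta_has_derivative[OF that]])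
  show "continuous_on D (\<lambda>p. \<bar>delta_factor e_x p\<bar> + \<bar>delta_factor e_u p\<bar> + \<bar>delta_factor e_w p\<bar>)"
    by (intro continuous_intros continuous_on_delta_factor)
  show "\<bar>partial v \<delta> p\<bar> \<le> (\<bar>delta_factor e_x p\<bar> + \<bar>delta_factor e_u p\<bar> + \<bar>delta_factor e_w p\<bar>) * norm v * \<bar>\<delta> p\<bar>"
    if p: "p \<in> D" for p v
  proof -
    have d: "\<delta> differentiable at p" by (rule differentiableI[OF delta_has_derivative[OF p]])
    have n: "\<bar>fst v\<bar> \<le> norm v" "\<bar>fst (snd v)\<bar> \<le> norm v" "\<bar>snd (snd v)\<bar> \<le> norm v"
      using norm_fst_le[of "fst v" "snd v"] norm_snd_le[of "snd v" "fst v"]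
        norm_fst_le[of "fst (snd v)" "snd (snd v)"] norm_snd_le[of "snd (snd v)" "fst (snd v)"] by auto
    have "partial v \<delta> p = (fst v * delta_factor e_x p + fst (snd v) * delta_factor e_u p
        + snd (snd v) * delta_factor e_w p) * \<delta> p"
      unfolding partial_point[OF d, of v] unfolding partial_delta[OF p] by (simp add: algebra_simps)
    then have "\<bar>partial v \<delta> p\<bar> = \<bar>fst v * delta_factor e_x p + fst (snd v) * delta_factor e_u p
        + snd (snd v) * delta_factor e_w p\<bar> * \<bar>\<delta> p\<bar>" by (simp add: abs_mult)
    also have "\<dots> \<le> (norm v * \<bar>delta_factor e_x p\<bar> + norm v * \<bar>delta_factor e_u p\<bar>
        + norm v * \<bar>delta_factor e_w p\<bar>) * \<bar>\<delta> p\<bar>"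
    proof (rule mult_right_mono)
      show "\<bar>fst v * delta_factor e_x p + fst (snd v) * delta_factor e_u p + snd (snd v) * delta_factor e_w p\<bar>
          \<le> norm v * \<bar>delta_factor e_x p\<bar> + norm v * \<bar>delta_factor e_u p\<bar> + norm v * \<bar>delta_factor e_w p\<bar>"
        by (intro order_trans[OF abs_triangle_ineq] add_mono)
          (auto simp: abs_mult intro!: mult_right_mono n)
    qed simp
    finally show ?thesis by (simp add: algebra_simps)
  qed
qed (use D_open D(1) assms in auto)

text \<open>If \<open>\<delta>\<close> vanished identically, all points would be critical for \<open>y\<close>, and by Sard's theorem the
  open set \<open>E\<close> would be negligible.\<close>

lemma delta_nonzero:
  assumes p: "p \<in> D"
  shows "\<delta> p \<noteq> 0"
proof
  assume "\<delta> p = 0"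
  then have zero: "\<delta> q = 0" if "q \<in> D" for q using delta_zero_everywhere[OF p _ that] by simp
  \<comment> \<open>\<open>baby_Sard\<close> and \<open>det\<close> speak about
    \<open>real ^ 3\<close>, so the chart is conjugated by the coordinate isomorphism
    \<open>P\<close> and its inverse \<open>V\<close>.\<close>
  define P where "P = (\<lambda>v :: real ^ 3. (v $ 1, v $ 2, v $ 3))"
  define V where "V = (\<lambda>p. vector [fst p, fst (snd p), snd (snd p)] :: real ^ 3)"
  have PV [simp]: "P (V p) = p" for p by (simp add: P_def V_def)
  have VP [simp]: "V (P v) = v" for v by (simp add: P_def V_def vec_eq_iff forall_3)
  have linP: "bounded_linear P"
    unfolding P_def by (intro bounded_linear_Pair bounded_linear_vec_nth)
  have linV: "bounded_linear V"
    by (rule linear_conv_bounded_linear[THEN iffD1], unfold_locales) (simp_all add: V_def vec_eq_iff forall_3)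
  have "negligible ((\<lambda>v. V (y (P v))) ` (P -` D))"
  proof (rule baby_Sard)
    show "CARD(3) \<le> CARD(3)" by simp
    fix v assume "v \<in> P -` D"
    then have q: "P v \<in> D" by simp
    let ?A = "\<lambda>h. V (partial (P h) y (P v))"
    have "((\<lambda>v. V (y (P v))) has_derivative ?A) (at v)"
      by (rule bounded_linear.has_derivative[OF linV has_derivative_compose[OF bounded_linear.has_derivative[OF linP has_derivative_ident]
              smooth_on_has_derivative[OF y q]]])
    then show d: "((\<lambda>v. V (y (P v))) has_derivative ?A) (at v within P -` D)"
      by (rule has_derivative_at_withinI)
    have lin: "linear (\<lambda>h. partial h y (P v))"
      by (rule has_derivative_linear[OF smooth_on_has_derivative[OF y q]])
    \<comment> \<open>The determinant of the pushed-forward frame factors into the Jacobian of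
      \<open>y\<close> and the determinant of the frame; the latter is f times \<open>coef_p\<close>
      times \<open>coef_q\<close>, so the Jacobian has to vanish.\<close>
    have "det3 (partial e_x y (P v)) (partial e_u y (P v)) (partial e_w y (P v))
        * det3 (frame1 F (P v)) (frame2 F (P v)) (frame3 F (P v)) = 0"
      unfolding det3_linear_image[OF lin, symmetric] y1[OF q] y2[OF q] y3[OF q]
      using zero[OF q] by (simp add: \<delta>_def)
    moreover have "det3 (frame1 F (P v)) (frame2 F (P v)) (frame3 F (P v)) \<noteq> 0"
      using on_system_nonzero[OF F q] by (simp add: det3_def frame1_def frame2_def frame3_def)
    moreover have "det (matrix ?A) = det3 (partial e_x y (P v)) (partial e_u y (P v)) (partial e_w y (P v))"
      by (simp add: det_3 matrix_def det3_def V_def P_def axis_def) (simp add: algebra_simps)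
    ultimately have "det (matrix ?A) = 0" by simp
    then show "rank (matrix ?A) < CARD(3)" by (simp add: det_eq_0_rank)
  qed
  moreover have "(\<lambda>v. V (y (P v))) ` (P -` D) = P -` E"
  proof (intro equalityI subsetI)
    fix v assume "v \<in> P -` E"
    then obtain q where "q \<in> D" "P v = y q" by (auto simp: E)
    then have "v = V (y (P (V q)))" "V q \<in> P -` D" by (metis PV VP, simp)
    then show "v \<in> (\<lambda>v. V (y (P v))) ` (P -` D)" by blast
  qed (auto simp: E)
  moreover have "open (P -` E)"
    using smooth_on_open[OF M(1)] linP linear_continuous_on open_vimage by blast
  moreover have "P -` E \<noteq> {}"
  proof -
    have "V (y p) \<in> P -` E" using y_in_E[OF p] by simp
    then show ?thesis by blast
  qed
  ultimately show False using open_not_negligible by metis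
qed

lemma det3_combination:
  fixes k l m :: real and a b c :: point
  shows
  "det3 (k *\<^sub>R a + l *\<^sub>R b + m *\<^sub>R c) b c = k * det3 a b c"
  "det3 a (k *\<^sub>R a + l *\<^sub>R b + m *\<^sub>R c) c = l * det3 a b c"
  "det3 a b (k *\<^sub>R a + l *\<^sub>R b + m *\<^sub>R c) = m * det3 a b c"
  by (simp_all add: det3_def algebra_simps)

text \<open>Cramer's rule: the pushed-forward fields are independent since \<open>\<delta>\<close>
  is nonzero, so all frame coefficients of \<open>v\<close> vanish.\<close>

lemma chart_injective:
  assumes p: "p \<in> D" and v: "partial v y p = 0"
  shows "v = 0"
proof -
  have "partial v y p = partial (coframe1 F v p *\<^sub>R frame1 F p + coframe2 F v p *\<^sub>R frame2 F p
      + coframe3 F v p *\<^sub>R frame3 F p) y p"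
    unfolding coframe[OF F p] ..
  also have "\<dots> = coframe1 F v p *\<^sub>R M1 (y p) + coframe2 F v p *\<^sub>R M2 (y p) + coframe3 F v p *\<^sub>R M3 (y p)"
    unfolding partial_linear(1,3)[OF y_differentiable[OF p]] y1[OF p] y2[OF p] y3[OF p] ..
  finally have 0: "coframe1 F v p *\<^sub>R M1 (y p) + coframe2 F v p *\<^sub>R M2 (y p) + coframe3 F v p *\<^sub>R M3 (y p) = 0"
    using v by simp
  have "det3 0 b c = 0" "det3 b 0 c = 0" "det3 b c 0 = 0" for b c by (simp_all add: det3_def)
  with det3_combination[where a = "M1 (y p)" and b = "M2 (y p)" and c = "M3 (y p)"
      and k = "coframe1 F v p" and l = "coframe2 F v p" and m = "coframe3 F v p"]
  have "coframe1 F v p = 0" "coframe2 F v p = 0" "coframe3 F v p = 0"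
    unfolding 0 using delta_nonzero[OF p] by (simp_all add: \<delta>_def)
  then show ?thesis using coframe[OF F p, of v] by simp
qed

end

section \<open>Maps preserving the frame\<close>

lemma sigma_nth:
  "sigma F p $ 1 = on_system inv_J F p"
  "sigma F p $ 2 = on_system (nabla1 inv_J) F p"
  "sigma F p $ 3 = on_system (nabla2 inv_J) F p"
  "sigma F p $ 4 = on_system (nabla3 inv_J) F p"
  "sigma F p $ 5 = on_system (nabla1 (nabla1 inv_J)) F p"
  "sigma F p $ 6 = on_system (nabla1 (nabla2 inv_J)) F p"
  "sigma F p $ 7 = on_system (nabla1 (nabla3 inv_J)) F p"
  "sigma F p $ 8 = on_system (nabla2 (nabla2 inv_J)) F p"
  "sigma F p $ 9 = on_system (nabla2 (nabla3 inv_J)) F p"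
  "sigma F p $ 10 = on_system (nabla3 (nabla3 inv_J)) F p"
  "sigma F p $ 11 = on_system inv_K F p"
  "sigma F p $ 12 = on_system (nabla1 inv_K) F p"
  "sigma F p $ 13 = on_system (nabla2 inv_K) F p"
  "sigma F p $ 14 = on_system (nabla3 inv_K) F p"
  unfolding sigma_def vector_def by simp_all

definition basic_invariant :: "14 \<Rightarrow> jet \<Rightarrow> real" where
  "basic_invariant a = (if a = 1 then inv_J else if a = 2 then nabla1 inv_J else if a = 3 then nabla2 inv_J
     else if a = 4 then nabla3 inv_J else inv_K)"

text \<open>The derivatives \<open>\<nabla>\<^sub>i(z\<^sub>a)\<close> of the coordinates \<open>z\<^sub>a\<close> with \<open>a = 1, 2, 3, 4, 11\<close>, as functions on
  \<open>\<Sigma>\<^sub>F\<close>. Those not among the coordinates of \<open>\<real>\<^sup>1\<^sup>4\<close> come from the commutation relations.\<close>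

definition sigma_deriv1 :: "14 \<Rightarrow> real ^ 14 \<Rightarrow> real" where
  "sigma_deriv1 a z = (if a = 1 then z $ 2 else if a = 2 then z $ 5 else if a = 3 then z $ 6
     else if a = 4 then z $ 7 else z $ 12)"

definition sigma_deriv2 :: "14 \<Rightarrow> real ^ 14 \<Rightarrow> real" where
  "sigma_deriv2 a z = (if a = 1 then z $ 3 else if a = 2 then z $ 6 + z $ 1 * z $ 2 else if a = 3 then z $ 8
     else if a = 4 then z $ 9 else z $ 13)"

definition sigma_deriv3 :: "14 \<Rightarrow> real ^ 14 \<Rightarrow> real" where
  "sigma_deriv3 a z = (if a = 1 then z $ 4 else if a = 2 then z $ 7 + z $ 11 * z $ 3
     else if a = 3 then z $ 9 - (z $ 4 - z $ 1 * z $ 2 - (z $ 2 + z $ 4) / z $ 1 * z $ 3)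
     else if a = 4 then z $ 10 else z $ 14)"

lemma basic_invariant_rational [rational_intros]: "basic_invariant a \<in> rational_jet_functions"
  unfolding basic_invariant_def by (auto intro: rational_intros)

lemma sigma_nth_basic_invariant:
  "a \<in> {1, 2, 3, 4, 11} \<Longrightarrow> sigma F p $ a = on_system (basic_invariant a) F p"
  by (auto simp: basic_invariant_def sigma_nth)

text \<open>The derivatives \<open>nabla2\<close> of j_1 and \<open>nabla3\<close> of j_1 and j_2
  have the wrong order to be coordinates; swapping costs brackets. For j_2 this involves
  \<open>struct_b\<close>, which \<open>struct_b_eq\<close> expresses through j, j_1 and
  j_3.\<close>

lemma nabla_basic_invariant:
  assumes F: "regular_jets_on F D" and p: "p \<in> D" and a: "a \<in> {1, 2, 3, 4, 11}"
  shows "on_system (nabla1 (basic_invariant a)) F p = sigma_deriv1 a (sigma F p)"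
    and "on_system (nabla2 (basic_invariant a)) F p = sigma_deriv2 a (sigma F p)"
    and "on_system (nabla3 (basic_invariant a)) F p = sigma_deriv3 a (sigma F p)"
proof -
  note comm = on_system_commutators[OF F inv_J_rational p]
  have "on_system (nabla3 (nabla2 inv_J)) F p = on_system (nabla2 (nabla3 inv_J)) F p
      - (on_system (nabla3 inv_J) F p - on_system inv_J F p * on_system (nabla1 inv_J) F p
        - (on_system (nabla1 inv_J) F p + on_system (nabla3 inv_J) F p) / on_system inv_J F p
          * on_system (nabla2 inv_J) F p)"
    using comm(2) on_system_nonzero(4)[OF F p] unfolding struct_b_eq[OF F p] by (simp add: field_simps)
  moreover have "on_system (nabla2 (nabla1 inv_J)) F p = on_system (nabla1 (nabla2 inv_J)) F p
      + on_system inv_J F p * on_system (nabla1 inv_J) F p"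
    "on_system (nabla3 (nabla1 inv_J)) F p = on_system (nabla1 (nabla3 inv_J)) F p
      + on_system inv_K F p * on_system (nabla2 inv_J) F p"
    using comm(1,3) by simp_all
  ultimately show "on_system (nabla1 (basic_invariant a)) F p = sigma_deriv1 a (sigma F p)"
    "on_system (nabla2 (basic_invariant a)) F p = sigma_deriv2 a (sigma F p)"
    "on_system (nabla3 (basic_invariant a)) F p = sigma_deriv3 a (sigma F p)"
    using a by (auto simp: basic_invariant_def sigma_deriv1_def sigma_deriv2_def sigma_deriv3_def sigma_nth)
qed

lemma smooth_on_sigma_deriv:
  assumes s: "smooth_on E s" and nz: "\<And>e. e \<in> E \<Longrightarrow> s e $ 1 \<noteq> 0"
  shows "smooth_on E (\<lambda>e. sigma_deriv1 a (s e))" "smooth_on E (\<lambda>e. sigma_deriv2 a (s e))"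
    "smooth_on E (\<lambda>e. sigma_deriv3 a (s e))"
proof -
  have "smooth_on E (\<lambda>e. s e $ k)" for k
    by (rule smooth_on_bounded_linear[OF bounded_linear_vec_nth s])
  note * = this smooth_on_open[OF s] nz
  show "smooth_on E (\<lambda>e. sigma_deriv1 a (s e))" "smooth_on E (\<lambda>e. sigma_deriv2 a (s e))"
    "smooth_on E (\<lambda>e. sigma_deriv3 a (s e))"
    unfolding sigma_deriv1_def sigma_deriv2_def sigma_deriv3_def
    by (cases "a = 1"; cases "a = 2"; cases "a = 3"; cases "a = 4"; simp; intro smooth_intros *)+
qed

definition sigma_chart :: "14 \<Rightarrow> 14 \<Rightarrow> 14 \<Rightarrow> real ^ 14 \<Rightarrow> point" where
  "sigma_chart a b c z = (z $ a, z $ b, z $ c)"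

text \<open>The inverse \<open>s\<close> of the projection recovers all fourteen invariants from the
  three chosen ones, so the derivatives of the latter become functions of themselves. Everything
  except \<open>y\<close> is built from \<open>\<Sigma>\<close> and the indices, so systems with
  equal images obtain identical fields.\<close>

lemma frame_chart_sigma:
  assumes F: "regular_jets_on F D" and D: "connected D" "D \<noteq> {}" and \<Sigma>: "\<Sigma> = Sigma_of F D"
    and abc: "a \<in> {1, 2, 3, 4, 11}" "b \<in> {1, 2, 3, 4, 11}" "c \<in> {1, 2, 3, 4, 11}"
    and coord: "coordinates_on \<Sigma> a b c"
  defines "s \<equiv> inv_into \<Sigma> (sigma_chart a b c)"
  shows "frame_chart F D (\<lambda>p. sigma_chart a b c (sigma F p)) (sigma_chart a b c ` \<Sigma>)
    (\<lambda>e. (sigma_deriv1 a (s e), sigma_deriv1 b (s e), sigma_deriv1 c (s e)))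
    (\<lambda>e. (sigma_deriv2 a (s e), sigma_deriv2 b (s e), sigma_deriv2 c (s e)))
    (\<lambda>e. (sigma_deriv3 a (s e), sigma_deriv3 b (s e), sigma_deriv3 c (s e)))"
proof
  let ?\<pi> = "sigma_chart a b c"
  have \<pi>: "?\<pi> = (\<lambda>z. (z $ a, z $ b, z $ c))" by (simp add: sigma_chart_def fun_eq_iff)
  have inj: "inj_on ?\<pi> \<Sigma>" and s: "smooth_on (?\<pi> ` \<Sigma>) s"
    using coord unfolding coordinates_on_def Let_def s_def \<pi> by auto
  have s_sigma: "s (?\<pi> (sigma F p)) = sigma F p" if "p \<in> D" for p
    unfolding s_def using inj that by (simp add: \<Sigma> Sigma_of_def)
  have nz: "s e $ 1 \<noteq> 0" if "e \<in> ?\<pi> ` \<Sigma>" for e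
  proof -
    have "s e \<in> \<Sigma>" unfolding s_def using that by (rule inv_into_into)
    then show ?thesis using on_system_nonzero(4)[OF F] by (auto simp: \<Sigma> Sigma_of_def sigma_nth)
  qed
  show "regular_jets_on F D" "connected D" "D \<noteq> {}" by fact+
  have y: "(\<lambda>p. ?\<pi> (sigma F p)) = (\<lambda>p. (on_system (basic_invariant a) F p, on_system (basic_invariant b) F p,
      on_system (basic_invariant c) F p))"
    using abc[THEN sigma_nth_basic_invariant] by (simp add: sigma_chart_def)
  show "smooth_on D (\<lambda>p. ?\<pi> (sigma F p))"
    unfolding y by (intro smooth_intros smooth_on_system[OF F] rational_intros)
  show "?\<pi> ` \<Sigma> = (\<lambda>p. ?\<pi> (sigma F p)) ` D" by (simp add: \<Sigma> Sigma_of_def image_image)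
  show "smooth_on (?\<pi> ` \<Sigma>) (\<lambda>e. (sigma_deriv1 a (s e), sigma_deriv1 b (s e), sigma_deriv1 c (s e)))"
    "smooth_on (?\<pi> ` \<Sigma>) (\<lambda>e. (sigma_deriv2 a (s e), sigma_deriv2 b (s e), sigma_deriv2 c (s e)))"
    "smooth_on (?\<pi> ` \<Sigma>) (\<lambda>e. (sigma_deriv3 a (s e), sigma_deriv3 b (s e), sigma_deriv3 c (s e)))"
    by (intro smooth_intros smooth_on_sigma_deriv s nz; assumption)+
  fix p assume p: "p \<in> D"
  have dy: "partial v (\<lambda>p. ?\<pi> (sigma F p)) p = (partial v (on_system (basic_invariant a) F) p,
      partial v (on_system (basic_invariant b) F) p, partial v (on_system (basic_invariant c) F) p)" for v
    unfolding y
    by (rule partial_eqI, intro has_derivative_Pair smooth_on_has_derivative[OF smooth_on_system[OF F] p] rational_intros)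
  show "partial (frame1 F p) (\<lambda>p. ?\<pi> (sigma F p)) p = (sigma_deriv1 a (s (?\<pi> (sigma F p))),
      sigma_deriv1 b (s (?\<pi> (sigma F p))), sigma_deriv1 c (s (?\<pi> (sigma F p))))"
    "partial (frame2 F p) (\<lambda>p. ?\<pi> (sigma F p)) p = (sigma_deriv2 a (s (?\<pi> (sigma F p))),
      sigma_deriv2 b (s (?\<pi> (sigma F p))), sigma_deriv2 c (s (?\<pi> (sigma F p))))"
    "partial (frame3 F p) (\<lambda>p. ?\<pi> (sigma F p)) p = (sigma_deriv3 a (s (?\<pi> (sigma F p))),
      sigma_deriv3 b (s (?\<pi> (sigma F p))), sigma_deriv3 c (s (?\<pi> (sigma F p))))"
    unfolding dy on_system_nabla[OF F basic_invariant_rational p, symmetric] s_sigma[OF p]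
    using nabla_basic_invariant[OF F p] abc by simp_all
qed

section \<open>Local maps that match the frames of two systems\<close>

text \<open>The map is a local inverse of \<open>yF\<close> after \<open>yG\<close>. Both charts
  send the frames to the same fields, and injectivity of the derivative of \<open>yF\<close> lifts
  this equality back to the frames.\<close>

lemma frame_map_exists:
  assumes CF: "frame_chart F DF yF E M1 M2 M3" and CG: "frame_chart G DG yG E M1 M2 M3"
    and p: "p \<in> DG" and q: "q \<in> DF" and pq: "yF q = yG p"
  obtains N \<phi> where "open N" "p \<in> N" "N \<subseteq> DG" "\<phi> p = q" "\<And>r. r \<in> N \<Longrightarrow> \<phi> r \<in> DF"
    "\<And>r. r \<in> N \<Longrightarrow> \<phi> differentiable at r"
    "\<And>r. r \<in> N \<Longrightarrow> partial (frame1 G r) \<phi> r = frame1 F (\<phi> r)"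
    "\<And>r. r \<in> N \<Longrightarrow> partial (frame2 G r) \<phi> r = frame2 F (\<phi> r)"
    "\<And>r. r \<in> N \<Longrightarrow> partial (frame3 G r) \<phi> r = frame3 F (\<phi> r)"
proof -
  interpret F: frame_chart F DF yF E M1 M2 M3 by (rule CF)
  interpret G: frame_chart G DG yG E M1 M2 M3 by (rule CG)
  \<comment> \<open>The inverse function theorem asks for a derivative that is continuous as an
    operator-valued map; in finite dimension this can be tested on single vectors.\<close>
  define f' where "f' = (\<lambda>x. Blinfun (\<lambda>v. partial v yF x))"
  have bl: "bounded_linear (\<lambda>v. partial v yF x)" if "x \<in> DF" for x
    using has_derivative_bounded_linear[OF smooth_on_has_derivative[OF F.y that]] .
  have f': "blinfun_apply (f' x) = (\<lambda>v. partial v yF x)" if "x \<in> DF" for x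
    unfolding f'_def using bl[OF that] by (simp add: bounded_linear_Blinfun_apply)
  have derf: "(yF has_derivative blinfun_apply (f' x)) (at x)" if "x \<in> DF" for x
    unfolding f'[OF that] by (rule smooth_on_has_derivative[OF F.y that])
  have contf: "continuous_on DF f'"
  proof (rule continuous_on_blinfun_componentwise)
    fix i :: point
    show "continuous_on DF (\<lambda>x. blinfun_apply (f' x) i)"
      by (rule continuous_on_eq[OF smooth_on_continuous_on[OF smooth_on_partial[OF F.y, of i]]]) (simp add: f')
  qed
  have inj: "inj (\<lambda>v. partial v yF x)" if "x \<in> DF" for x
    using F.chart_injective[OF that] linear_injective_0[OF bounded_linear.linear[OF bl[OF that]]] by blast
  obtain g0 where g0: "linear g0" "g0 \<circ> (\<lambda>v. partial v yF q) = id"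
    using linear_injective_left_inverse[OF bounded_linear.linear[OF bl[OF q]] inj[OF q]] by blast
  have "g0 (partial i yF q) = i" for i
    using fun_cong[OF g0(2), of i] by simp
  then have invf: "Blinfun g0 o\<^sub>L f' q = id_blinfun"
    using g0(1) by (intro blinfun_eqI)
      (simp only: blinfun_apply_blinfun_compose f'[OF q] bounded_linear_Blinfun_apply linear_conv_bounded_linear
        blinfun_apply_id_blinfun)
  obtain U' V g g' where U': "open U'" "U' \<subseteq> DF" "q \<in> U'" and V: "open V" "yF q \<in> V"
    and hom: "homeomorphism U' V yF g" and g': "\<And>e. e \<in> V \<Longrightarrow> (g has_derivative g' e) (at e)"
    by (rule inverse_function_theorem[OF F.D_open derf contf q invf]) blast+
  define N where "N = {r \<in> DG. yG r \<in> V}"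
  define \<phi> where "\<phi> = (\<lambda>r. g (yG r))"
  have N: "open N"
    unfolding N_def using continuous_open_preimage[OF smooth_on_continuous_on[OF G.y] G.D_open V(1)]
    by (simp add: vimage_def Int_def)
  have \<phi>: "\<phi> r \<in> DF" "yF (\<phi> r) = yG r" if "r \<in> N" for r
    using hom U'(2) that by (auto simp: N_def \<phi>_def homeomorphism_def)
  have diff: "\<phi> differentiable at r" if "r \<in> N" for r
    unfolding \<phi>_def using that
    by (auto simp: N_def intro: differentiableI has_derivative_compose[OF has_derivative_partial[OF G.y_differentiable] g'])
  have chain: "partial (partial v \<phi> r) yF (\<phi> r) = partial v yG r" if "r \<in> N" for v r
  proof -
    have "partial (partial v \<phi> r) yF (\<phi> r) = partial v (\<lambda>r. yF (\<phi> r)) r"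
      by (rule partial_compose[OF diff[OF that] F.y_differentiable[OF \<phi>(1)[OF that]], symmetric])
    also have "\<dots> = partial v yG r" by (rule partial_cong[OF N that \<phi>(2)])
    finally show ?thesis .
  qed
  have inj': "a = b" if "r \<in> N" "partial a yF (\<phi> r) = partial b yF (\<phi> r)" for a b r
    using inj[OF \<phi>(1)[OF that(1)]] that(2) by (auto dest: injD)
  have "partial (frame1 G r) \<phi> r = frame1 F (\<phi> r)" "partial (frame2 G r) \<phi> r = frame2 F (\<phi> r)"
    "partial (frame3 G r) \<phi> r = frame3 F (\<phi> r)" if r: "r \<in> N" for r
  proof -
    have rG: "r \<in> DG" using r by (simp add: N_def)
    note * = chain[OF r] F.y1[OF \<phi>(1)[OF r]] F.y2[OF \<phi>(1)[OF r]] F.y3[OF \<phi>(1)[OF r]]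
      G.y1[OF rG] G.y2[OF rG] G.y3[OF rG] \<phi>(2)[OF r]
    show "partial (frame1 G r) \<phi> r = frame1 F (\<phi> r)" "partial (frame2 G r) \<phi> r = frame2 F (\<phi> r)"
      "partial (frame3 G r) \<phi> r = frame3 F (\<phi> r)"
      by (rule inj'[OF r]; simp only: *)+
  qed
  moreover have "p \<in> N" "N \<subseteq> DG" "\<phi> p = q"
    using p pq V(2) hom U'(3) by (auto simp: N_def \<phi>_def homeomorphism_def)
  ultimately show ?thesis using that N \<phi>(1) diff by blast
qed

text \<open>The inverse function theorem supplied only differentiability. Matching frames express
  the derivative of \<open>\<phi>\<close> smoothly through the point and \<open>\<phi>\<close>
  itself, so regularity bootstraps.\<close>

lemma smooth_on_frame_map:
  assumes F: "regular_jets_on F DF" and G: "regular_jets_on G DG"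
    and N: "open N" "N \<subseteq> DG" and maps: "\<And>r. r \<in> N \<Longrightarrow> \<phi> r \<in> DF"
    and diff: "\<And>r. r \<in> N \<Longrightarrow> \<phi> differentiable at r"
    and frame: "\<And>r. r \<in> N \<Longrightarrow> partial (frame1 G r) \<phi> r = frame1 F (\<phi> r)"
      "\<And>r. r \<in> N \<Longrightarrow> partial (frame2 G r) \<phi> r = frame2 F (\<phi> r)"
      "\<And>r. r \<in> N \<Longrightarrow> partial (frame3 G r) \<phi> r = frame3 F (\<phi> r)"
  shows "smooth_on N \<phi>"
proof (rule smooth_on_bootstrap[OF N(1)])
  fix r assume r: "r \<in> N"
  have "partial v \<phi> r = coframe1 G v r *\<^sub>R frame1 F (\<phi> r) + coframe2 G v r *\<^sub>R frame2 F (\<phi> r)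
      + coframe3 G v r *\<^sub>R frame3 F (\<phi> r)" for v
  proof -
    have "partial v \<phi> r = partial (coframe1 G v r *\<^sub>R frame1 G r + coframe2 G v r *\<^sub>R frame2 G r
        + coframe3 G v r *\<^sub>R frame3 G r) \<phi> r"
      unfolding coframe[OF G subsetD[OF N(2) r]] ..
    then show ?thesis unfolding partial_linear(1,3)[OF diff[OF r]] frame[OF r] .
  qed
  then show "(\<phi> has_derivative (\<lambda>v. coframe1 G v r *\<^sub>R frame1 F (\<phi> r) + coframe2 G v r *\<^sub>R frame2 F (\<phi> r)
      + coframe3 G v r *\<^sub>R frame3 F (\<phi> r))) (at r)"
    using has_derivative_partial[OF diff[OF r]] by simp
next
  fix n v
  assume \<phi>: "differentiable_upto n N \<phi>"
  have "differentiable_upto n N (\<lambda>r. k r *\<^sub>R A (\<phi> r))" if "smooth_on DG k" "smooth_on DF A"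
    for k :: "point \<Rightarrow> real" and A :: "point \<Rightarrow> point"
    using smooth_on_subset[OF that(1) N] that(2) \<phi> maps N(1)
    by (intro differentiable_upto_scaleR differentiable_upto_compose[of N DF n \<phi> A])
      (auto simp: smooth_on_iff)
  then show "differentiable_upto n N (\<lambda>r. coframe1 G v r *\<^sub>R frame1 F (\<phi> r) + coframe2 G v r *\<^sub>R frame2 F (\<phi> r)
      + coframe3 G v r *\<^sub>R frame3 F (\<phi> r))"
    by (intro differentiable_upto_add N(1)) (use smooth_on_coframe[OF G] smooth_on_frame[OF F] in auto)
qed

section \<open>From frame maps to feedback transformations\<close>

lemma frame13_eq:
  "frame1 F p + frame3 F p = (F p, snd (snd p), coef_b (infinite_jet F p))"
  unfolding frame1_def frame3_def on_system_def coef_w3_def coef_values jet_values by simp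

lemma constant_if_derivative_zero:
  fixes f :: "'a::real_normed_vector \<Rightarrow> real"
  assumes "convex S" and "\<And>a. a \<in> S \<Longrightarrow> (f has_derivative (\<lambda>_. 0)) (at a)" and "a \<in> S" "b \<in> S"
  shows "f a = f b"
  using has_derivative_zero_constant[OF assms(1), of f] assms(2-4) has_derivative_at_withinI by metis

text \<open>A map that preserves the frames is a feedback transformation: \<open>\<partial>\<^bsub>u\<^sub>1\<^esub>\<close> is a multiple of \<open>\<nabla>\<^sub>2\<close>
  and \<open>\<partial>\<^sub>u\<close> lies in the span of \<open>\<nabla>\<^sub>1, \<nabla>\<^sub>2\<close>, so \<open>X\<close> depends on \<open>x\<close> alone and \<open>U\<close> on \<open>(x, u)\<close>;
  the image of \<open>\<nabla>\<^sub>1 + \<nabla>\<^sub>3\<close> gives the equation for \<open>F\<close> and the prolongation formula.\<close>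

lemma frame_map_feedback_matched:
  assumes F: "regular_jets_on F DF" and G: "regular_jets_on G DG"
    and N: "open N" "p \<in> N" "N \<subseteq> DG" and maps: "\<And>r. r \<in> N \<Longrightarrow> \<phi> r \<in> DF"
    and diff: "\<And>r. r \<in> N \<Longrightarrow> \<phi> differentiable at r"
    and frame1: "\<And>r. r \<in> N \<Longrightarrow> partial (frame1 G r) \<phi> r = frame1 F (\<phi> r)"
    and frame2: "\<And>r. r \<in> N \<Longrightarrow> partial (frame2 G r) \<phi> r = frame2 F (\<phi> r)"
    and frame3: "\<And>r. r \<in> N \<Longrightarrow> partial (frame3 G r) \<phi> r = frame3 F (\<phi> r)"
  shows "feedback_matched F DF G DG p (\<phi> p)"
proof -
  have smooth: "smooth_on N \<phi>"
    by (rule smooth_on_frame_map[OF F G N(1,3) maps diff frame1 frame2 frame3])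
  let ?X = "\<lambda>r. fst (\<phi> r)" and ?U = "\<lambda>r. fst (snd (\<phi> r))"
  have X: "smooth_on N ?X" and U: "smooth_on N ?U" by (intro smooth_intros smooth)+
  note dX = smooth_on_differentiable[OF X] and dU = smooth_on_differentiable[OF U]
  have pX: "partial v ?X r = fst (partial v \<phi> r)" and pU: "partial v ?U r = fst (snd (partial v \<phi> r))"
    if "r \<in> N" for v r
    by (rule partial_bounded_linear[OF _ diff[OF that]],
        intro bounded_linear_fst bounded_linear_compose[OF bounded_linear_fst bounded_linear_snd])+
  have nzG: "on_system coef_q G r \<noteq> 0" "on_system coef_p G r \<noteq> 0" if "r \<in> N" for r
    using on_system_nonzero[OF G subsetD[OF N(3) that]] by blast+
  have nzF: "on_system coef_p F (\<phi> r) \<noteq> 0" "F (\<phi> r) \<noteq> 0" if "r \<in> N" for r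
    using on_system_nonzero[OF F maps[OF that]] by (auto simp: on_system_def jet_values)
  have w: "partial e_w ?X r = 0" "partial e_w ?U r = 0" if r: "r \<in> N" for r
    using frame2[OF r] pX[OF r, of "frame2 G r"] pU[OF r, of "frame2 G r"] nzG[OF r]
      partial_point[OF dX[OF r], of "frame2 G r"] partial_point[OF dU[OF r], of "frame2 G r"]
    by (auto simp: frame2_def)
  have u: "partial e_u ?X r = 0" and Uu: "on_system coef_p G r * partial e_u ?U r = on_system coef_p F (\<phi> r)"
    if r: "r \<in> N" for r
    using frame1[OF r] pX[OF r, of "frame1 G r"] pU[OF r, of "frame1 G r"] nzG[OF r] w[OF r]
      partial_point[OF dX[OF r], of "frame1 G r"] partial_point[OF dU[OF r], of "frame1 G r"]
    by (auto simp: frame1_def)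
  have 13: "partial (frame1 G r + frame3 G r) \<phi> r = (F (\<phi> r), snd (snd (\<phi> r)), coef_b (infinite_jet F (\<phi> r)))"
    if r: "r \<in> N" for r
    unfolding partial_linear(1)[OF diff[OF r]] frame1[OF r] frame3[OF r] by (rule frame13_eq)
  have x: "partial e_x ?X r * G r = F (\<phi> r)"
    and W: "partial e_x ?U r * G r + partial e_u ?U r * snd (snd r) = snd (snd (\<phi> r))" if r: "r \<in> N" for r
    using 13[OF r] pX[OF r, of "frame1 G r + frame3 G r"] pU[OF r, of "frame1 G r + frame3 G r"] w[OF r] u[OF r]
      partial_point[OF dX[OF r], of "frame1 G r + frame3 G r"] partial_point[OF dU[OF r], of "frame1 G r + frame3 G r"]
    by (auto simp: frame13_eq mult.commute)
  obtain x0 u0 w0 where p: "p = (x0, u0, w0)" by (cases p)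
  \<comment> \<open>The neighbourhood is shrunk to a box, whose slices are convex: there the
    vanishing partial derivatives really make \<open>?X\<close> a function of \<open>x\<close> and
    \<open>?U\<close> a function of \<open>(x, u)\<close>.\<close>
  obtain A C where "open A" "open C" "p \<in> A \<times> C" "A \<times> C \<subseteq> N"
    using N(1,2) by (metis open_prod_elim)
  moreover from this obtain C1 C2 where "open C1" "open C2" "snd p \<in> C1 \<times> C2" "C1 \<times> C2 \<subseteq> C"
    by (metis mem_Times_iff open_prod_elim)
  ultimately have A: "open A" "x0 \<in> A" and C1: "open C1" "u0 \<in> C1" and C2: "open C2" "w0 \<in> C2"
    and sub: "A \<times> C1 \<times> C2 \<subseteq> N"
    by (auto simp: p)
  obtain ea where ea: "ea > 0" "ball x0 ea \<subseteq> A" using A open_contains_ball by blast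
  obtain eb where eb: "eb > 0" "ball u0 eb \<subseteq> C1" using C1 open_contains_ball by blast
  obtain ec where ec: "ec > 0" "ball w0 ec \<subseteq> C2" using C2 open_contains_ball by blast
  let ?A = "ball x0 ea" and ?B = "ball u0 eb" and ?C = "ball w0 ec"
  define N' where "N' = ?A \<times> ?B \<times> ?C"
  have N': "open N'" "N' \<subseteq> N" "p \<in> N'"
    using ea eb ec sub by (auto simp: N'_def p open_Times)
  have const_X: "?X (a, b, c) = ?X (a, u0, w0)" if "a \<in> ?A" "b \<in> ?B" "c \<in> ?C" for a b c
  proof (rule constant_if_derivative_zero[where f = "\<lambda>z. ?X (a, z)" and S = "?B \<times> ?C", of "(b, c)" "(u0, w0)"])
    show "convex (?B \<times> ?C)" by (simp add: convex_Times)
    fix z assume "z \<in> ?B \<times> ?C"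
    then have r: "(a, z) \<in> N" using that N'(2) by (auto simp: N'_def)
    have "((\<lambda>z. (a, z)) has_derivative (\<lambda>h. (0, h))) (at z)"
      by (intro derivative_intros)
    from has_derivative_compose[OF this has_derivative_partial[OF dX[OF r]]]
    have "((\<lambda>z. ?X (a, z)) has_derivative (\<lambda>h. partial (0, h) ?X (a, z))) (at z)" .
    moreover have "partial (0, h) ?X (a, z) = 0" for h
      unfolding partial_point[OF dX[OF r], of "(0, h)"] u[OF r] w[OF r] by simp
    ultimately show "((\<lambda>z. ?X (a, z)) has_derivative (\<lambda>_. 0)) (at z)" by simp
  qed (use that eb ec in auto)
  have const_U: "?U (a, b, c) = ?U (a, b, w0)" if "a \<in> ?A" "b \<in> ?B" "c \<in> ?C" for a b c
  proof (rule constant_if_derivative_zero[where f = "\<lambda>z. ?U (a, b, z)" and S = "?C"])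
    fix z assume "z \<in> ?C"
    then have r: "(a, b, z) \<in> N" using that N'(2) by (auto simp: N'_def)
    have "((\<lambda>z. (a, b, z)) has_derivative (\<lambda>h. (0, 0, h))) (at z)"
      by (intro derivative_intros)
    from has_derivative_compose[OF this has_derivative_partial[OF dU[OF r]]]
    have "((\<lambda>z. ?U (a, b, z)) has_derivative (\<lambda>h. partial (0, 0, h) ?U (a, b, z))) (at z)" .
    moreover have "partial (0, 0, h) ?U (a, b, z) = 0" for h
      unfolding partial_point[OF dU[OF r], of "(0, 0, h)"] w[OF r] by simp
    ultimately show "((\<lambda>z. ?U (a, b, z)) has_derivative (\<lambda>_. 0)) (at z)" by simp
  qed (use that ec in auto)
  define X1 where "X1 = (\<lambda>a. ?X (a, u0, w0))"
  define U1 where "U1 = (\<lambda>(a, b). ?U (a, b, w0))"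
  have smX1: "smooth_on ?A X1"
    unfolding X1_def
    by (rule smooth_on_compose[OF X], intro smooth_intros) (use N'(2) eb ec in \<open>auto simp: N'_def\<close>)
  have smU1: "smooth_on (?A \<times> ?B) U1"
    unfolding U1_def case_prod_unfold
    by (rule smooth_on_compose[OF U], intro smooth_intros) (use N'(2) eb ec in \<open>auto simp: N'_def open_Times\<close>)
  have derivX1: "deriv X1 (fst r) = partial e_x ?X r" and derivU1: "partial (fst v, fst (snd v)) U1 (fst r, fst (snd r)) = partial v ?U r"
    and X1_eq: "?X r = X1 (fst r)" and U1_eq: "?U r = U1 (fst r, fst (snd r))"
    if r: "r \<in> N'" for r v
  proof -
    have rA: "fst r \<in> ?A" and rB: "(fst r, fst (snd r)) \<in> ?A \<times> ?B" using r by (auto simp: N'_def)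
    have eqX: "?X q = X1 (fst q)" and eqU: "?U q = U1 (fst q, fst (snd q))" if "q \<in> N'" for q
      using that const_X[of "fst q" "fst (snd q)" "snd (snd q)"] const_U[of "fst q" "fst (snd q)" "snd (snd q)"]
      by (auto simp: N'_def X1_def U1_def)
    have "partial e_x ?X r = partial e_x (\<lambda>r. X1 (fst r)) r"
      by (rule partial_cong[OF N'(1) r eqX])
    then show "deriv X1 (fst r) = partial e_x ?X r"
      by (simp add: partial_compose_fst[OF smooth_on_differentiable[OF smX1 rA]])
    have "partial v ?U r = partial v (\<lambda>r. U1 (fst r, fst (snd r))) r"
      by (rule partial_cong[OF N'(1) r eqU])
    then show "partial (fst v, fst (snd v)) U1 (fst r, fst (snd r)) = partial v ?U r"
      by (simp add: partial_compose_fst_snd[OF smooth_on_differentiable[OF smU1 rB]])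
    show "?X r = X1 (fst r)" "?U r = U1 (fst r, fst (snd r))" by (rule eqX[OF r] eqU[OF r])+
  qed
  have lift: "feedback_lift X1 U1 G r = \<phi> r" if r: "r \<in> N'" for r
  proof -
    have "partial (1, 0) U1 (fst r, fst (snd r)) = partial e_x ?U r"
      "partial (0, 1) U1 (fst r, fst (snd r)) = partial e_u ?U r"
      using derivU1[OF r, of e_x] derivU1[OF r, of e_u] by simp_all
    then have "feedback_lift X1 U1 G r = (?X r, ?U r, snd (snd (\<phi> r)))"
      using W[of r] N'(2) r X1_eq[OF r] U1_eq[OF r] by (auto simp: feedback_lift_def case_prod_unfold)
    then show ?thesis by simp
  qed
  have transf: "feedback_transformation (?A \<times> ?B) X1 U1"
    unfolding feedback_transformation_def
  proof (intro conjI ballI)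
    show "smooth_on (fst ` (?A \<times> ?B)) X1" using smX1 eb(1) by (simp add: fst_image_times)
    show "smooth_on (?A \<times> ?B) U1" by (rule smU1)
    fix z assume z: "z \<in> ?A \<times> ?B"
    \<comment> \<open>Nondegeneracy is required at every point of the base; the point above it with
      last coordinate \<open>w0\<close> lies in the box, where the frame relations apply.\<close>
    have r: "(fst z, snd z, w0) \<in> N'" using z ec(1) by (auto simp: N'_def)
    then have rN: "(fst z, snd z, w0) \<in> N" using N'(2) by blast
    have "partial e_x ?X (fst z, snd z, w0) \<noteq> 0" "partial e_u ?U (fst z, snd z, w0) \<noteq> 0"
      using x[OF rN] Uu[OF rN] nzF[OF rN] by auto
    then show "case z of (x, u) \<Rightarrow> deriv X1 x * partial (0, 1) U1 (x, u) \<noteq> 0"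
      using derivX1[OF r] derivU1[OF r, of e_u] by (simp add: case_prod_unfold)
  qed
  have Feq: "F (feedback_lift X1 U1 G r) = deriv X1 (fst r) * G r" if "r \<in> N'" for r
    using x[of r] N'(2) that unfolding lift[OF that] derivX1[OF that] by auto
  show ?thesis
    unfolding feedback_matched_def
  proof (intro exI conjI)
    show "feedback_transformation (?A \<times> ?B) X1 U1" by (rule transf)
    show "open N'" "p \<in> N'" by (rule N')+
    show "N' \<subseteq> DG" using N'(2) N(3) by blast
    show "\<forall>(x, u, u1)\<in>N'. (x, u) \<in> ?A \<times> ?B" by (auto simp: N'_def)
    show "feedback_lift X1 U1 G ` N' \<subseteq> DF" using lift maps N'(2) by auto
    show "feedback_lift X1 U1 G p = \<phi> p" by (rule lift[OF N'(3)])
    show "\<forall>(x, u, u1)\<in>N'. F (feedback_lift X1 U1 G (x, u, u1)) = deriv X1 x * G (x, u, u1)"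
      using Feq by fastforce
  qed
qed

section \<open>Equality of the images implies equivalence\<close>

lemma feedback_matched_if_chart_eq:
  assumes CF: "frame_chart F DF yF E M1 M2 M3" and CG: "frame_chart G DG yG E M1 M2 M3"
    and p: "p \<in> DG" and q: "q \<in> DF" and pq: "yF q = yG p"
  shows "feedback_matched F DF G DG p q"
proof (rule frame_map_exists[OF assms])
  fix N \<phi>
  assume N: "open N" "p \<in> N" "N \<subseteq> DG" and q: "\<phi> p = q" and frame: "\<And>r. r \<in> N \<Longrightarrow> \<phi> r \<in> DF"
    "\<And>r. r \<in> N \<Longrightarrow> \<phi> differentiable at r"
    "\<And>r. r \<in> N \<Longrightarrow> partial (frame1 G r) \<phi> r = frame1 F (\<phi> r)"
    "\<And>r. r \<in> N \<Longrightarrow> partial (frame2 G r) \<phi> r = frame2 F (\<phi> r)"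
    "\<And>r. r \<in> N \<Longrightarrow> partial (frame3 G r) \<phi> r = frame3 F (\<phi> r)"
  have "feedback_matched F DF G DG p (\<phi> p)"
    by (rule frame_map_feedback_matched[OF frame_chart.F[OF CF] frame_chart.F[OF CG] N frame])
  then show ?thesis by (simp only: q)
qed

lemma locally_feedback_equivalent_if_Sigma_of_eq:
  assumes F: "regular_system F DF" and G: "regular_system G DG" and eq: "Sigma_of F DF = Sigma_of G DG"
  shows "locally_feedback_equivalent F DF G DG"
proof -
  \<comment> \<open>Three coordinates chosen for \<open>F\<close> serve \<open>G\<close> as well,
    because \<open>coordinates_on\<close> refers to the common image alone.\<close>
  obtain a b c where abc: "a \<in> {1, 2, 3, 4, 11}" "b \<in> {1, 2, 3, 4, 11}" "c \<in> {1, 2, 3, 4, 11}"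
    and coord: "coordinates_on (Sigma_of F DF) a b c"
    using F unfolding regular_system_def by blast
  have D: "connected DF" "DF \<noteq> {}" "connected DG" "DG \<noteq> {}"
    using F G by (auto simp: regular_system_def control_system_def)
  note CF = frame_chart_sigma[OF regular_system_imp_regular_jets[OF F] D(1,2) refl abc coord]
  note CG = frame_chart_sigma[OF regular_system_imp_regular_jets[OF G] D(3,4) eq abc coord]
  have "feedback_matched F DF G DG p q" if "p \<in> DG" "q \<in> DF" "sigma F q = sigma G p" for p q
    by (rule feedback_matched_if_chart_eq[OF CF CG that(1,2)]) (simp add: that(3))
  moreover have "\<exists>q\<in>DF. sigma F q = sigma G p" if "p \<in> DG" for p
    using eq that unfolding Sigma_of_def by (metis imageE imageI)
  moreover have "\<exists>p\<in>DG. sigma F q = sigma G p" if "q \<in> DF" for q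
    using eq that unfolding Sigma_of_def by (metis imageE imageI)
  ultimately show ?thesis unfolding locally_feedback_equivalent_def by blast
qed

theorem theorem5:
  fixes F G :: "point \<Rightarrow> real" and DF DG :: "point set"
  assumes "regular_system F DF" and "regular_system G DG"
  shows "locally_feedback_equivalent F DF G DG \<longleftrightarrow> Sigma_of F DF = Sigma_of G DG"
  using Sigma_of_eq_if_locally_feedback_equivalent[OF assms[THEN regular_system_imp_regular_jets]]
    locally_feedback_equivalent_if_Sigma_of_eq[OF assms] by blast

end
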